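(* Let $\varepsilon>0$. There exists $r_0>0$ such that the following holds for all $r=r(n)\le r_0$ (with $p=p(n)$ and $q=\pi r^2 p$). If $q \le (1-\varepsilon)\log n / n$, then with probability tending to $1$ as $n\to\infty$, $G(n,r,p)$ is disconnected and in particular has isolated vertices. If $q \ge (1+\varepsilon)\log n / n$, then with probability tending to $1$ as $n\to\infty$, $G(n,r,p)$ is connected.
   Context: The random graph $G(n,r,p)$ is defined as follows. Place $n$ points independently and uniformly at random in the unit torus $[0,1]^2$ (opposite sides identified), and join two points by an edge if their distance in the torus metric is at most $r$; this is the random geometric graph $G(n,r)$. Independently, let $G(n,p)$ be the Erdős–Rényi random graph on the same $n$ vertices, where each pair is an edge independently with probability $p$. Then $G(n,r,p)=G(n,r)\cap G(n,p)$. The quantity $q=\pi r^2 p$ is the probability that two given vertices are adjacent. Logarithms are natural. *)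

theory Defs
  imports "HOL-Probability.Probability" "Graph_Theory.Graph_Theory"
begin

text \<open>The unit torus is the square \<open>[0,1]\<^sup>2\<close> with opposite sides identified, i.e. the
  quotient of the plane by the lattice of integer vectors, with the quotient of the Euclidean metric
  (the product metric on \<^typ>\<open>real \<times> real\<close> is the Euclidean one).\<close>

definition torus_dist :: "real \<times> real \<Rightarrow> real \<times> real \<Rightarrow> real" where
  "torus_dist x y = (INF (a, b) \<in> (UNIV :: (int \<times> int) set). dist x (y + (of_int a, of_int b)))"

definition uniform_points :: "nat \<Rightarrow> (nat \<Rightarrow> real \<times> real) measure" where
  "uniform_points n = PiM {..<n} (\<lambda>_. uniform_measure lborel ({0..1} \<times> {0..1}))"

definition vertex_pairs :: "nat \<Rightarrow> nat set set" where
  "vertex_pairs n = {e. e \<subseteq> {..<n} \<and> card e = 2}"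

definition edge_coins :: "nat \<Rightarrow> real \<Rightarrow> (nat set \<Rightarrow> bool) measure" where
  "edge_coins n p = PiM (vertex_pairs n) (\<lambda>_. measure_pmf (bernoulli_pmf p))"

text \<open>Simple graphs are loop-free symmetric digraphs (locale \<^locale>\<open>pair_graph\<close>): an edge
  \<open>{i, j}\<close> is represented by the two arcs \<open>(i, j)\<close> and \<open>(j, i)\<close>.\<close>

definition geometric_graph ::
    "nat \<Rightarrow> real \<Rightarrow> (nat \<Rightarrow> real \<times> real) \<Rightarrow> nat pair_pre_digraph" where
  "geometric_graph n r X = \<lparr> pverts = {..<n},
     parcs = {(i, j). i < n \<and> j < n \<and> i \<noteq> j \<and> torus_dist (X i) (X j) \<le> r} \<rparr>"

definition coin_graph :: "nat \<Rightarrow> (nat set \<Rightarrow> bool) \<Rightarrow> nat pair_pre_digraph" where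
  "coin_graph n C = \<lparr> pverts = {..<n},
     parcs = {(i, j). i < n \<and> j < n \<and> i \<noteq> j \<and> C {i, j}} \<rparr>"

definition graph_inter ::
    "'a pair_pre_digraph \<Rightarrow> 'a pair_pre_digraph \<Rightarrow> 'a pair_pre_digraph" where
  "graph_inter G H = \<lparr> pverts = pverts G \<inter> pverts H, parcs = parcs G \<inter> parcs H \<rparr>"

text \<open>The sample space of \<open>G(n,r,p)\<close> does not involve \<open>r\<close>, which only enters the graph
  built from a sample: the points of \<open>G(n,r)\<close> and the coins of \<open>G(n,p)\<close>,
  independent of each other.\<close>

definition grp_space :: "nat \<Rightarrow> real \<Rightarrow> ((nat \<Rightarrow> real \<times> real) \<times> (nat set \<Rightarrow> bool)) measure" where
  "grp_space n p = uniform_points n \<Otimes>\<^sub>M edge_coins n p"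

definition grp_graph ::
    "nat \<Rightarrow> real \<Rightarrow> (nat \<Rightarrow> real \<times> real) \<times> (nat set \<Rightarrow> bool) \<Rightarrow> nat pair_pre_digraph" where
  "grp_graph n r \<omega> = graph_inter (geometric_graph n r (fst \<omega>)) (coin_graph n (snd \<omega>))"

definition isolated_vertex :: "'a pair_pre_digraph \<Rightarrow> 'a \<Rightarrow> bool" where
  "isolated_vertex G v \<longleftrightarrow> v \<in> pverts G \<and> (\<forall>w. (v, w) \<notin> parcs G \<and> (w, v) \<notin> parcs G)"

abbreviation connected_graph :: "'a pair_pre_digraph \<Rightarrow> bool" where
  "connected_graph G \<equiv> Digraph_Component.connected (with_proj G)"

lemma torus_dist_commute: "torus_dist x y = torus_dist y x"
proof -
  have "range (\<lambda>(a::int, b::int). dist x (y + (of_int a, of_int b))) \<subseteq>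
        range (\<lambda>(a::int, b::int). dist y (x + (of_int a, of_int b)))" for x y :: "real \<times> real"
  proof clarsimp
    fix a b :: int
    have "dist x (y + (of_int a, of_int b)) = dist y (x + (of_int (-a), of_int (-b)))"
      by (cases x; cases y) (simp add: dist_Pair_Pair dist_real_def abs_minus_commute algebra_simps)
    then show "dist x (y + (of_int a, of_int b)) \<in>
        range (\<lambda>(a::int, b::int). dist y (x + (of_int a, of_int b)))"
      by (intro image_eqI[of _ _ "(-a, -b)"]) auto
  qed
  then show ?thesis unfolding torus_dist_def by (metis subset_antisym)
qed

lemma pair_graph_grp_graph: "pair_graph (grp_graph n r \<omega>)"
proof -
  have "parcs (grp_graph n r \<omega>) \<subseteq> {..<n} \<times> {..<n}"
    by (auto simp: grp_graph_def graph_inter_def coin_graph_def)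
  then have "finite (parcs (grp_graph n r \<omega>))"
    by (rule finite_subset) simp
  moreover have "sym (parcs (grp_graph n r \<omega>))"
    by (auto simp: sym_def grp_graph_def graph_inter_def geometric_graph_def coin_graph_def
        torus_dist_commute insert_commute)
  ultimately show ?thesis
    by unfold_locales
      (auto simp: grp_graph_def graph_inter_def geometric_graph_def coin_graph_def
        symmetric_def)
qed

lemma prob_space_grp_space: "prob_space (grp_space n p)"
proof -
  have "emeasure lborel ({0..1} \<times> {0..1} :: (real \<times> real) set) = 1"
    by (simp add: lborel_prod[symmetric] lborel.emeasure_pair_measure_Times)
  then have "prob_space (uniform_points n)"
    unfolding uniform_points_def
    by (intro prob_space_PiM prob_space_uniform_measure) auto
  moreover have "prob_space (edge_coins n p)"
    unfolding edge_coins_def by (intro prob_space_PiM measure_pmf.prob_space_axioms)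
  ultimately show ?thesis
    unfolding grp_space_def by (rule prob_space_pair)
qed

end

theory Submission
  imports Defs "HOL-Real_Asymp.Real_Asymp"
begin

text \<open>
  Isolated vertices come from the second moment method: given their positions, two vertices are both
  isolated with probability at most \<open>(1 - 2q + p\<^sup>2 s)\<close> to the power \<open>n - 2\<close>, where \<open>s\<close> is the area of the overlap of their
  discs, and \<open>s\<close> has mean \<open>(\<pi> r\<^sup>2)\<^sup>2\<close>.

  Connectivity is split according to the mean geometric degree \<open>D = n \<pi> r\<^sup>2\<close>.

  If \<open>D \<ge> C ln n\<close>, cut the torus into cells of side about \<open>\<delta> r\<close>; all of them contain almost as many points as
  expected. With high probability there is an edge between any two disjoint sets that contain a fraction \<open>\<delta>\<close> of the
  points of two adjacent cells, so a union of components or its complement contains at most a fraction \<open>\<delta>\<close> of every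
  cell. Such a set \<open>S\<close> has nearly \<open>D\<close> geometric neighbours outside \<open>S\<close> per vertex, and the union
  bound over \<open>S\<close> is a convergent binomial sum.

  If \<open>D \<le> C ln n\<close>, then \<open>p\<close> is bounded below. A component of diameter \<open>O(r)\<close> has a leftmost vertex without
  neighbours in its left half-disc and a rightmost vertex without neighbours in its right half-disc; the two half-discs
  are disjoint and have total area \<open>\<pi> r\<^sup>2\<close>, so there is no such component. Call a cell bad if some two vertices near
  it have no common neighbour in it. A bounded window contains fewer than a constant number \<open>J\<close> of bad cells, so most of its
  rows and columns are free of bad cells. These rows and columns belong to one component, and edges are too short to jump
  over them, so all other components have diameter \<open>O(r)\<close>.
\<close>

subsection \<open>Areas on the torus\<close>

text \<open>All limit statements use one null sequence \<open>g\<close>, valid for every admissible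
  r and p at once, because r(n) and p(n) may alternate between the two regimes. The dense regime
  fixes C, and the sparse one accepts any C >= 1. The split is forced: for D of order ln n the
  counts in cells of side \<open>\<delta>\<close> r need not concentrate, while for small p two
  vertices need not have a common neighbour in a cell. In the sparse regime a single cell may be bad
  with a probability that is only a small negative power of n, more than a union bound over about n
  / ln n cells can bear. Asking for J bad cells in one window multiplies these powers, and J of
  order C^2 suffices. The half-discs have to come as a pair: a leftmost vertex alone exposes area pi
  r^2 / 2, and for \<epsilon> < 1 the resulting bound grows like a power of n, whereas the pair
  gives n^(-\<epsilon>). The price is the choice of the second vertex close to the first one, a
  factor of order ln n.\<close>

abbreviation shift :: "int \<Rightarrow> int \<Rightarrow> real \<times> real" where
  "shift a b \<equiv> (of_int a, of_int b)"

text \<open>Regions of the torus are handled as lattice-invariant subsets of the plane. This is the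
  full preimage of the projection of \<open>Z\<close>, so membership does not depend on the
  representative of a torus point.\<close>

definition periodize :: "(real \<times> real) set \<Rightarrow> (real \<times> real) set" where
  "periodize Z = {y. \<exists>a b. y + shift a b \<in> Z}"

definition unif_sq :: "(real \<times> real) measure" where
  "unif_sq = uniform_measure lborel ({0..1} \<times> {0..1})"

text \<open>Injectivity on \<open>Z\<close> of the projection from the plane to the torus.\<close>

definition packing :: "(real \<times> real) set \<Rightarrow> bool" where
  "packing Z \<longleftrightarrow> (\<forall>z a b. z \<in> Z \<longrightarrow> z + shift a b \<in> Z \<longrightarrow> a = 0 \<and> b = 0)"

lemma emeasure_unit_square: "emeasure lborel ({0..1} \<times> {0..1} :: (real \<times> real) set) = 1"
  by (simp add: lborel_prod[symmetric] lborel.emeasure_pair_measure_Times)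

lemma prob_space_unif_sq: "prob_space unif_sq"
  unfolding unif_sq_def by (intro prob_space_uniform_measure) (auto simp: emeasure_unit_square)

lemma sets_unif_sq[measurable_cong, simp]: "sets unif_sq = sets borel"
  by (simp add: unif_sq_def)

lemma space_unif_sq[simp]: "space unif_sq = UNIV"
  by (simp add: unif_sq_def)

lemma periodize_eq_UN: "periodize Z = (\<Union>(a, b)\<in>UNIV. (\<lambda>y. y + shift a b) -` Z)"
  unfolding periodize_def by fastforce

lemma borel_translate:
  fixes c :: "real \<times> real"
  assumes "Z \<in> sets borel" shows "(\<lambda>y. y + c) -` Z \<in> sets borel"
proof -
  have "(\<lambda>y. y + c) \<in> borel \<rightarrow>\<^sub>M borel" by measurable
  from measurable_sets[OF this assms] show ?thesis by simp
qed

lemma sets_periodize[measurable]: "Z \<in> sets borel \<Longrightarrow> periodize Z \<in> sets borel"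
  unfolding periodize_eq_UN by (intro sets.countable_UN'') (auto intro: borel_translate)

lemma emeasure_lborel_translate:
  fixes c :: "real \<times> real"
  assumes "Z \<in> sets borel" shows "emeasure lborel ((\<lambda>y. y + c) -` Z) = emeasure lborel Z"
proof -
  have "emeasure lborel Z = emeasure (distr lborel borel (\<lambda>y. c + y)) Z"
    by (simp add: lborel_distr_plus)
  also have "\<dots> = emeasure lborel ((\<lambda>y. y + c) -` Z)"
    using assms by (subst emeasure_distr) (auto simp: fun_eq_iff add.commute intro!: arg_cong[where f = "\<lambda>f. emeasure lborel (f -` Z)"])
  finally show ?thesis by simp
qed

text \<open>The closed square represents points of its sides more than once. Two of the sides form a
  null set, and what remains is an exact fundamental domain.\<close>

lemma emeasure_unif_sq_half_open:
  assumes "A \<in> sets borel"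
  shows "emeasure unif_sq A = emeasure lborel (({0..<1} \<times> {0..<1}) \<inter> A)"
proof -
  define B :: "(real \<times> real) set" where "B = {1} \<times> {0..1} \<union> {0..1} \<times> {1}"
  have "emeasure lborel B \<le> emeasure lborel ({1::real} \<times> {0..1::real}) + emeasure lborel ({0..1::real} \<times> {1::real})"
    unfolding B_def by (intro emeasure_subadditive) (auto intro!: borel_Times)
  also have "\<dots> = 0"
    by (simp add: lborel_prod[symmetric] lborel.emeasure_pair_measure_Times)
  finally have B0: "B \<in> null_sets lborel"
    by (auto simp: null_sets_def B_def intro!: borel_Times)
  have "({0..1} \<times> {0..1}) \<inter> A = (({0..<1} \<times> {0..<1}) \<inter> A) \<union> (B \<inter> A)"
    by (auto simp: B_def)
  moreover have "B \<inter> A \<in> null_sets lborel"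
    using assms B0 by (auto intro: null_set_Int2)
  moreover have "({0..<1} \<times> {0..<1}) \<inter> A \<in> sets lborel"
    using assms by (auto intro!: borel_Times)
  ultimately have "emeasure lborel (({0..1} \<times> {0..1}) \<inter> A) = emeasure lborel (({0..<1} \<times> {0..<1}) \<inter> A)"
    using assms by (simp add: emeasure_Un_null_set borel_Times)
  then show ?thesis
    using assms by (simp add: unif_sq_def emeasure_uniform_measure borel_Times emeasure_unit_square divide_ennreal_def)
qed

lemma shift_add: "z + shift a b + shift c d = z + shift (a + c) (b + d)"
  by (cases z) simp

text \<open>The half-open unit square is a fundamental domain: its integer translates cut \<open>Z\<close> into pieces,
  which are moved back into the square, where they stay disjoint by the packing property.\<close>

lemma emeasure_periodize:
  assumes Z[measurable]: "Z \<in> sets borel" and pack: "packing Z"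
  shows "emeasure unif_sq (periodize Z) = emeasure lborel Z"
proof -
  define Q :: "(real \<times> real) set" where "Q = {0..<1} \<times> {0..<1}"
  have Q[measurable]: "Q \<in> sets borel" unfolding Q_def by (intro borel_Times) auto
  define P where "P k = Q \<inter> (\<lambda>y. y + shift (fst k) (snd k)) -` Z" for k
  define R where "R k = Z \<inter> (\<lambda>y. y + (- shift (fst k) (snd k))) -` Q" for k
  have P: "P k \<in> sets borel" for k unfolding P_def by (intro sets.Int Q borel_translate Z)
  have R: "R k \<in> sets borel" for k unfolding R_def by (intro sets.Int Q borel_translate Z)
  have PR: "emeasure lborel (P k) = emeasure lborel (R k)" for k
  proof -
    have "P k = (\<lambda>y. y + shift (fst k) (snd k)) -` R k"
      by (auto simp: P_def R_def add.assoc)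
    then show ?thesis using emeasure_lborel_translate[OF R] by simp
  qed
  have dP: "disjoint_family P"
  proof (unfold disjoint_family_on_def, intro ballI impI equals0I)
    fix k l y assume ne: "k \<noteq> l" and y: "y \<in> P k \<inter> P l"
    let ?z = "y + shift (fst k) (snd k)"
    have "?z \<in> Z" "?z + shift (fst l - fst k) (snd l - snd k) \<in> Z"
      using y unfolding shift_add by (auto simp: P_def)
    with pack have "fst l - fst k = 0 \<and> snd l - snd k = 0" unfolding packing_def by blast
    with ne show False by (auto simp: prod_eq_iff)
  qed
  have fl: "\<lfloor>fst z\<rfloor> = a \<and> \<lfloor>snd z\<rfloor> = b" if "z + (- shift a b) \<in> Q" for z :: "real \<times> real" and a b
    using that by (cases z) (auto simp: Q_def floor_eq_iff)
  have dR: "disjoint_family R"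
    unfolding disjoint_family_on_def
  proof (intro ballI impI equals0I)
    fix k l z assume ne: "k \<noteq> l" and z: "z \<in> R k \<inter> R l"
    then have "z + (- shift (fst k) (snd k)) \<in> Q" "z + (- shift (fst l) (snd l)) \<in> Q"
      by (auto simp: R_def)
    from fl[OF this(1)] fl[OF this(2)] ne show False by (auto simp: prod_eq_iff)
  qed
  have "(\<Union>k. R k) = Z"
  proof (intro equalityI subsetI)
    fix z assume "z \<in> Z"
    then have "z \<in> R (\<lfloor>fst z\<rfloor>, \<lfloor>snd z\<rfloor>)"
      by (cases z) (auto simp: R_def Q_def, linarith+)
    then show "z \<in> (\<Union>k. R k)" by blast
  qed (auto simp: R_def)
  moreover have "(\<Union>k. P k) = Q \<inter> periodize Z"
    by (fastforce simp: P_def periodize_def)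
  moreover have "emeasure lborel (\<Union>k. P k) = (\<integral>\<^sup>+k. emeasure lborel (P k) \<partial>count_space UNIV)"
    using P dP by (intro emeasure_UN_countable) auto
  moreover have "emeasure lborel (\<Union>k. R k) = (\<integral>\<^sup>+k. emeasure lborel (R k) \<partial>count_space UNIV)"
    using R dR by (intro emeasure_UN_countable) auto
  ultimately show ?thesis
    by (simp add: emeasure_unif_sq_half_open PR Q_def)
qed

lemma packing_box:
  assumes "\<And>z z'. z \<in> Z \<Longrightarrow> z' \<in> Z \<Longrightarrow> \<bar>fst z - fst z'\<bar> < 1 \<and> \<bar>snd z - snd z'\<bar> < 1"
  shows "packing Z"
  unfolding packing_def
proof (intro allI impI)
  fix z a b assume "z \<in> Z" "z + shift a b \<in> Z"
  with assms have "\<bar>fst (z + shift a b) - fst z\<bar> < 1 \<and> \<bar>snd (z + shift a b) - snd z\<bar> < 1" by blast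
  then have "\<bar>of_int a :: real\<bar> < 1" "\<bar>of_int b :: real\<bar> < 1" by (cases z; simp)+
  then show "a = 0 \<and> b = 0" by linarith
qed

lemma coords_le_dist: "\<bar>fst z - fst z'\<bar> \<le> dist z z'" "\<bar>snd z - snd z'\<bar> \<le> dist z (z' :: real \<times> real)"
  using dist_fst_le[of z z'] dist_snd_le[of z z'] by (auto simp: dist_real_def)

text \<open>The infimum is attained: two translates of \<open>y\<close> within 1/2 of
  \<open>x\<close> would be less than 1 apart and hence equal, so one translate comes as close as
  the infimum to every precision. The right-hand side is a countable union, which gives
  measurability later.\<close>

lemma torus_dist_le_iff:
  assumes "\<rho> < 1/2"
  shows "torus_dist x y \<le> \<rho> \<longleftrightarrow> (\<exists>a b. dist x (y + shift a b) \<le> \<rho>)"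
proof
  have bdd: "bdd_below (range (\<lambda>(a, b). dist x (y + shift a b)))"
    by (intro bdd_belowI[of _ 0]) auto
  {
    assume "\<exists>a b. dist x (y + shift a b) \<le> \<rho>"
    then obtain a b where "dist x (y + shift a b) \<le> \<rho>" by blast
    moreover have "torus_dist x y \<le> dist x (y + shift a b)"
      unfolding torus_dist_def using cINF_lower[OF bdd, of "(a, b)"] by simp
    ultimately show "torus_dist x y \<le> \<rho>" by linarith
  }
  assume le: "torus_dist x y \<le> \<rho>"
  have ex: "\<exists>a b. dist x (y + shift a b) < \<sigma>" if "\<rho> < \<sigma>" for \<sigma>
  proof -
    have "(INF (a, b)\<in>UNIV. dist x (y + shift a b)) < \<sigma>"
      using le that unfolding torus_dist_def by linarith
    from this[unfolded cINF_less_iff[OF UNIV_not_empty bdd]] show ?thesis by auto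
  qed
  from ex[of "1/2"] assms obtain a b where ab: "dist x (y + shift a b) < 1/2" by auto
  have "dist x (y + shift a b) \<le> \<sigma>" if "\<rho> < \<sigma>" for \<sigma>
  proof (cases "\<sigma> < 1/2")
    case True
    from ex[OF that] obtain c d where cd: "dist x (y + shift c d) < \<sigma>" by auto
    have "dist (y + shift a b) (y + shift c d) < 1"
      using ab cd True dist_triangle3[of "y + shift a b" "y + shift c d" x] by linarith
    with coords_le_dist[of "y + shift a b" "y + shift c d"]
    have "\<bar>of_int a - of_int c :: real\<bar> < 1" "\<bar>of_int b - of_int d :: real\<bar> < 1" by (cases y; simp)+
    then have "a = c \<and> b = d" by linarith
    with cd show ?thesis by simp
  qed (use ab in linarith)
  then have "dist x (y + shift a b) \<le> \<rho>" by (rule dense_ge)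
  then show "\<exists>a b. dist x (y + shift a b) \<le> \<rho>" by blast
qed

lemma torus_ball_eq: "\<rho> < 1/2 \<Longrightarrow> {y. torus_dist x y \<le> \<rho>} = periodize (cball x \<rho>)"
  by (auto simp: torus_dist_le_iff periodize_def)

lemma packing_cball: "\<rho> < 1/2 \<Longrightarrow> packing (cball x \<rho>)"
proof (rule packing_box)
  fix z z' assume "\<rho> < 1/2" "z \<in> cball x \<rho>" "z' \<in> cball x \<rho>"
  then have "dist z z' < 1" using dist_triangle3[of z z' x] by auto
  with coords_le_dist[of z z'] show "\<bar>fst z - fst z'\<bar> < 1 \<and> \<bar>snd z - snd z'\<bar> < 1" by linarith
qed

lemma emeasure_disc:
  assumes "0 \<le> \<rho>" shows "emeasure lborel (cball (x :: real \<times> real) \<rho>) = ennreal (pi * \<rho>\<^sup>2)"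
  using emeasure_cball[OF assms, of x] by (simp add: unit_ball_vol_2 power2_eq_square)

lemma emeasure_torus_ball:
  assumes "0 \<le> \<rho>" "\<rho> < 1/2"
  shows "emeasure unif_sq {y. torus_dist x y \<le> \<rho>} = ennreal (pi * \<rho>\<^sup>2)"
  using assms by (simp add: torus_ball_eq emeasure_periodize packing_cball emeasure_disc)

lemma torus_dist_le_measurable[measurable]:
  assumes "\<rho> < 1/2" and [measurable]: "f \<in> M \<rightarrow>\<^sub>M borel" "g \<in> M \<rightarrow>\<^sub>M borel"
  shows "Measurable.pred M (\<lambda>\<omega>. torus_dist (f \<omega>) (g \<omega>) \<le> \<rho>)"
  unfolding torus_dist_le_iff[OF assms(1)] by measurable

lemma torus_dist_plus_shift: "torus_dist x (y + shift a b) = torus_dist x y"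
proof -
  have "range (\<lambda>(c, d). dist x (y + shift a b + shift c d)) = range (\<lambda>(c, d). dist x (y + shift c d))"
    (is "?A = ?B")
  proof (intro equalityI subsetI; clarify)
    fix c d show "dist x (y + shift a b + shift c d) \<in> ?B"
      unfolding shift_add by (rule image_eqI[of _ _ "(a + c, b + d)"]) auto
  next
    fix c d show "dist x (y + shift c d) \<in> ?A"
      by (rule image_eqI[of _ _ "(c - a, d - b)"]) (unfold shift_add, auto)
  qed
  then show ?thesis unfolding torus_dist_def by simp
qed

lemma torus_dist_le_dist: "torus_dist x y \<le> dist x (y + shift a b)"
proof -
  have "bdd_below (range (\<lambda>(a, b). dist x (y + shift a b)))"
    by (intro bdd_belowI[of _ 0]) auto
  from cINF_lower[OF this, of "(a, b)"] show ?thesis unfolding torus_dist_def by simp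
qed

subsection \<open>Conditioning on some of the points\<close>

text \<open>Fubini with the coordinates of \<open>U\<close> outermost: once they are fixed, the
  others are independent and identically distributed, and the product over them integrates to a
  power. The Chernoff bound takes \<open>U = {}\<close>; the other uses expose one or more
  vertices.\<close>

lemma nn_integral_PiM_split:
  fixes \<phi> :: "(nat \<Rightarrow> real \<times> real) \<Rightarrow> real \<times> real \<Rightarrow> ennreal"
  assumes V: "finite V" "U \<subseteq> V" and Q: "prob_space Q"
    and g[measurable]: "g \<in> borel_measurable (PiM U (\<lambda>_. Q))"
    and \<phi>[measurable]: "(\<lambda>(x, y). \<phi> x y) \<in> borel_measurable (PiM U (\<lambda>_. Q) \<Otimes>\<^sub>M Q)"
  shows "(\<integral>\<^sup>+X. g (restrict X U) * (\<Prod>v\<in>V - U. \<phi> (restrict X U) (X v)) \<partial>PiM V (\<lambda>_. Q)) =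
    (\<integral>\<^sup>+x. g x * (\<integral>\<^sup>+y. \<phi> x y \<partial>Q) ^ card (V - U) \<partial>PiM U (\<lambda>_. Q))"
proof -
  interpret Q: prob_space Q by fact
  interpret product_sigma_finite "\<lambda>_. Q" ..
  have fin: "finite U" "finite (V - U)" "U \<inter> (V - U) = {}" using V finite_subset by auto
  have UV: "U \<union> (V - U) = V" using V by auto
  let ?F = "\<lambda>X. g (restrict X U) * (\<Prod>v\<in>V - U. \<phi> (restrict X U) (X v))"
  have R: "(\<lambda>X. restrict X U) \<in> PiM (U \<union> (V - U)) (\<lambda>_. Q) \<rightarrow>\<^sub>M PiM U (\<lambda>_. Q)"
    by (rule measurable_restrict_subset) auto
  have comp: "(\<lambda>X. \<phi> (restrict X U) (X v)) \<in> borel_measurable (PiM (U \<union> (V - U)) (\<lambda>_. Q))" if "v \<in> V - U" for v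
  proof -
    have "(\<lambda>X. (restrict X U, X v)) \<in> PiM (U \<union> (V - U)) (\<lambda>_. Q) \<rightarrow>\<^sub>M PiM U (\<lambda>_. Q) \<Otimes>\<^sub>M Q"
      using that by (intro measurable_Pair R measurable_component_singleton) auto
    from measurable_compose[OF this \<phi>] show ?thesis by simp
  qed
  have "(\<integral>\<^sup>+X. ?F X \<partial>PiM (U \<union> (V - U)) (\<lambda>_. Q)) =
     (\<integral>\<^sup>+x. (\<integral>\<^sup>+y. ?F (merge U (V - U) (x, y)) \<partial>PiM (V - U) (\<lambda>_. Q)) \<partial>PiM U (\<lambda>_. Q))"
    using fin comp measurable_compose[OF R g]
    by (intro product_nn_integral_fold borel_measurable_times_ennreal borel_measurable_prod_ennreal) auto
  also have "\<dots> = (\<integral>\<^sup>+x. g x * (\<integral>\<^sup>+y. \<phi> x y \<partial>Q) ^ card (V - U) \<partial>PiM U (\<lambda>_. Q))"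
  proof (rule nn_integral_cong)
    fix x assume x: "x \<in> space (PiM U (\<lambda>_. Q))"
    then have ext: "restrict (merge U (V - U) (x, y)) U = x" for y
      by (auto simp: merge_def space_PiM PiE_def extensional_def fun_eq_iff restrict_def)
    have m: "\<phi> x \<in> borel_measurable Q"
      using measurable_compose[OF measurable_Pair1'[OF x] \<phi>] by simp
    have "(\<integral>\<^sup>+y. ?F (merge U (V - U) (x, y)) \<partial>PiM (V - U) (\<lambda>_. Q)) =
      (\<integral>\<^sup>+y. g x * (\<Prod>v\<in>V - U. \<phi> x (y v)) \<partial>PiM (V - U) (\<lambda>_. Q))"
      unfolding ext by (auto simp: merge_def intro!: nn_integral_cong prod.cong)
    also have "\<dots> = g x * (\<integral>\<^sup>+y. (\<Prod>v\<in>V - U. \<phi> x (y v)) \<partial>PiM (V - U) (\<lambda>_. Q))"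
      using m by (intro nn_integral_cmult borel_measurable_prod_ennreal) (auto intro!: measurable_compose[OF measurable_component_singleton])
    also have "(\<integral>\<^sup>+y. (\<Prod>v\<in>V - U. \<phi> x (y v)) \<partial>PiM (V - U) (\<lambda>_. Q)) = (\<integral>\<^sup>+y. \<phi> x y \<partial>Q) ^ card (V - U)"
      using fin m by (subst product_nn_integral_prod) auto
    finally show "(\<integral>\<^sup>+y. ?F (merge U (V - U) (x, y)) \<partial>PiM (V - U) (\<lambda>_. Q)) = g x * (\<integral>\<^sup>+y. \<phi> x y \<partial>Q) ^ card (V - U)" .
  qed
  finally show ?thesis unfolding UV .
qed

subsection \<open>Coins\<close>

lemma prob_space_edge_coins: "prob_space (edge_coins n p)"
  unfolding edge_coins_def by (intro prob_space_PiM measure_pmf.prob_space_axioms)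

lemma finite_vertex_pairs[simp]: "finite (vertex_pairs n)"
  unfolding vertex_pairs_def by simp

lemma vertex_pairs_memI: "u < n \<Longrightarrow> v < n \<Longrightarrow> u \<noteq> v \<Longrightarrow> {u, v} \<in> vertex_pairs n"
  by (auto simp: vertex_pairs_def)

lemma pred_component: "e \<in> I \<Longrightarrow> Measurable.pred (PiM I (\<lambda>_. measure_pmf q)) (\<lambda>C. C e)"
  using measurable_component_singleton[of e I "\<lambda>_. measure_pmf q"]
  by (simp add: measurable_def)

lemma coin_pred_measurable:
  "e \<in> vertex_pairs n \<Longrightarrow> Measurable.pred (edge_coins n p) (\<lambda>C. C e)"
  unfolding edge_coins_def by (rule pred_component)

lemma prob_no_coin:
  assumes p: "0 \<le> p" "p \<le> 1" and E: "E \<subseteq> vertex_pairs n"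
  shows "measure (edge_coins n p) {C \<in> space (edge_coins n p). \<forall>e\<in>E. \<not> C e} = (1 - p) ^ card E"
    and prob_all_coin: "measure (edge_coins n p) {C \<in> space (edge_coins n p). \<forall>e\<in>E. C e} = p ^ card E"
proof -
  let ?M = "\<lambda>_ :: nat set. measure_pmf (bernoulli_pmf p)"
  have fE: "finite E" using E finite_subset finite_vertex_pairs by blast
  interpret product_prob_space ?M "vertex_pairs n" ..
  have gen: "measure (edge_coins n p) {C \<in> space (edge_coins n p). \<forall>e\<in>E. C e = b} = (pmf (bernoulli_pmf p) b) ^ card E" for b
  proof -
    have rs: "restrict x E = restrict (\<lambda>_. b) E \<longleftrightarrow> (\<forall>e\<in>E. x e = b)" for x
      by (auto simp: fun_eq_iff restrict_def)
    have "{C \<in> space (edge_coins n p). \<forall>e\<in>E. C e = b} = prod_emb (vertex_pairs n) ?M E (Pi\<^sub>E E (\<lambda>_. {b}))"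
      by (intro set_eqI) (simp add: prod_emb_def edge_coins_def space_PiM PiE_singleton PiE_iff rs conj_commute)
    then show ?thesis
      unfolding edge_coins_def using measure_PiM_emb[OF E fE, of "\<lambda>_. {b}"] by (simp add: measure_pmf_single)
  qed
  from gen[of False] p show "measure (edge_coins n p) {C \<in> space (edge_coins n p). \<forall>e\<in>E. \<not> C e} = (1 - p) ^ card E"
    by simp
  from gen[of True] p show "measure (edge_coins n p) {C \<in> space (edge_coins n p). \<forall>e\<in>E. C e} = p ^ card E"
    by simp
qed

text \<open>Disjoint blocks of coins are independent, so the probabilities of the complements of
  "all heads" multiply.\<close>

lemma prob_blocks_not_all_coin:
  assumes p: "0 \<le> p" "p \<le> 1" and L: "finite L" "\<And>v. v \<in> L \<Longrightarrow> K v \<subseteq> vertex_pairs n"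
    and disj: "disjoint_family_on K L"
  shows "measure (edge_coins n p) {C \<in> space (edge_coins n p). \<forall>v\<in>L. \<not> (\<forall>e\<in>K v. C e)} =
    (\<Prod>v\<in>L. 1 - p ^ card (K v))"
proof -
  \<comment> \<open>The independence argument needs a nonempty index set and at least one coin. An
    empty block is vacuously all heads, so it makes the event impossible and a factor of the product
    zero.\<close>
  consider (empty) "L = {}" | (block) v where "v \<in> L" "K v = {}" | (0) "L \<noteq> {}" "\<forall>v\<in>L. K v \<noteq> {}"
    by blast
  then show ?thesis
proof cases
  case empty
  then show ?thesis using prob_space.prob_space[OF prob_space_edge_coins, of n p] by simp
next
  case block
  then have E: "{C \<in> space (edge_coins n p). \<forall>v\<in>L. \<not> (\<forall>e\<in>K v. C e)} = {}" by auto
  have "(\<Prod>v\<in>L. 1 - p ^ card (K v)) = 0"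
    using block L(1) by (auto intro!: prod_zero bexI[of _ v])
  then show ?thesis unfolding E by simp
next
  case 0
  then have False: "L \<noteq> {}" by simp
  let ?M = "\<lambda>_ :: nat set. measure_pmf (bernoulli_pmf p)"
  interpret product_prob_space ?M "vertex_pairs n" ..
  interpret E: prob_space "edge_coins n p" by (rule prob_space_edge_coins)
  have ne: "vertex_pairs n \<noteq> {}"
    using L(2) 0 by blast
  \<comment> \<open>The coordinates are independent because their joint law, the law of the identity
    map, is the product of the marginals.\<close>
  have "E.indep_vars ?M (\<lambda>e C. C e) (vertex_pairs n)"
  proof (subst E.indep_vars_iff_distr_eq_PiM'[OF ne])
    show "(\<lambda>C. C e) \<in> edge_coins n p \<rightarrow>\<^sub>M ?M e" if "e \<in> vertex_pairs n" for e
      unfolding edge_coins_def using that by (rule measurable_component_singleton)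
    have "distr (edge_coins n p) (PiM (vertex_pairs n) ?M) (\<lambda>C. \<lambda>e\<in>vertex_pairs n. C e) =
        distr (edge_coins n p) (edge_coins n p) (\<lambda>C. C)"
      by (rule distr_cong) (auto simp: edge_coins_def space_PiM)
    also have "\<dots> = PiM (vertex_pairs n) (\<lambda>e. distr (edge_coins n p) (?M e) (\<lambda>C. C e))"
      by (simp add: edge_coins_def PiM_component cong: PiM_cong)
    finally show "distr (edge_coins n p) (PiM (vertex_pairs n) ?M) (\<lambda>C. \<lambda>e\<in>vertex_pairs n. C e) =
      PiM (vertex_pairs n) (\<lambda>e. distr (edge_coins n p) (?M e) (\<lambda>C. C e))" .
  qed
  from E.indep_vars_restrict[OF this L(2) disj]
  have ind: "E.indep_vars (\<lambda>v. PiM (K v) ?M) (\<lambda>v C. restrict C (K v)) L"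
    by simp
  define A where "A v = {x \<in> space (PiM (K v) ?M). \<not> (\<forall>e\<in>K v. x e)}" for v
  have A: "A v \<in> sets (PiM (K v) ?M)" if "v \<in> L" for v
  proof -
    have "finite (K v)" using L that finite_subset finite_vertex_pairs by metis
    then have "Measurable.pred (PiM (K v) ?M) (\<lambda>x. \<not> (\<forall>e\<in>K v. x e))"
      by (intro pred_intros_logic pred_intros_finite pred_component)
    then show ?thesis unfolding A_def by (simp add: pred_def)
  qed
  have pre: "(\<lambda>C. restrict C (K v)) -` A v \<inter> space (edge_coins n p) = space (edge_coins n p) - {C \<in> space (edge_coins n p). \<forall>e\<in>K v. C e}" if "v \<in> L" for v
    by (auto simp: A_def space_PiM)
  have ms: "{C \<in> space (edge_coins n p). \<forall>e\<in>K v. C e} \<in> sets (edge_coins n p)" if "v \<in> L" for v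
  proof -
    have "finite (K v)" using L that finite_subset finite_vertex_pairs by metis
    moreover have "\<And>e. e \<in> K v \<Longrightarrow> e \<in> vertex_pairs n" using L that by auto
    ultimately have "Measurable.pred (edge_coins n p) (\<lambda>C. \<forall>e\<in>K v. C e)"
      by (intro pred_intros_finite coin_pred_measurable)
    then show ?thesis by (simp add: pred_def)
  qed
  have "{C \<in> space (edge_coins n p). \<forall>v\<in>L. \<not> (\<forall>e\<in>K v. C e)} =
      (\<Inter>v\<in>L. (\<lambda>C. restrict C (K v)) -` A v \<inter> space (edge_coins n p))"
    using False by (auto simp: A_def space_PiM)
  also have "measure (edge_coins n p) \<dots> = (\<Prod>v\<in>L. measure (edge_coins n p) ((\<lambda>C. restrict C (K v)) -` A v \<inter> space (edge_coins n p)))"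
    using A False L by (intro E.indep_varsD[OF ind]) auto
  also have "\<dots> = (\<Prod>v\<in>L. 1 - p ^ card (K v))"
    using L p by (intro prod.cong) (auto simp: pre E.prob_compl ms prob_all_coin)
  finally show ?thesis .
qed
qed

section \<open>The joint space of positions and coins, and avoidance probabilities\<close>

lemma uniform_points_eq: "uniform_points n = PiM {..<n} (\<lambda>_. unif_sq)"
  by (simp add: uniform_points_def unif_sq_def)

lemma prob_space_uniform_points: "prob_space (uniform_points n)"
  unfolding uniform_points_eq by (intro prob_space_PiM prob_space_unif_sq)

lemma measurable_unif_sq_iff: "f \<in> M \<rightarrow>\<^sub>M unif_sq \<longleftrightarrow> f \<in> borel_measurable M"
  by (simp cong: measurable_cong_sets)

lemma point_measurable[measurable]:
  assumes "v < n" shows "(\<lambda>X. X v) \<in> uniform_points n \<rightarrow>\<^sub>M borel"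
  unfolding uniform_points_eq measurable_unif_sq_iff[symmetric]
  using assms by (intro measurable_component_singleton) auto

lemma grp_point_measurable[measurable]:
  "v < n \<Longrightarrow> (\<lambda>\<omega>. fst \<omega> v) \<in> grp_space n p \<rightarrow>\<^sub>M borel"
  unfolding grp_space_def by (rule measurable_compose[OF measurable_fst point_measurable])

lemma grp_coin_measurable:
  "e \<in> vertex_pairs n \<Longrightarrow> Measurable.pred (grp_space n p) (\<lambda>\<omega>. snd \<omega> e)"
  unfolding grp_space_def by (rule measurable_compose[OF measurable_snd coin_pred_measurable])

lemma emeasure_grp_space:
  assumes "Measurable.pred (grp_space n p) P"
  shows "emeasure (grp_space n p) {\<omega> \<in> space (grp_space n p). P \<omega>} =
    (\<integral>\<^sup>+X. emeasure (edge_coins n p) {C \<in> space (edge_coins n p). P (X, C)} \<partial>uniform_points n)"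
proof -
  interpret E: prob_space "edge_coins n p" by (rule prob_space_edge_coins)
  have "{\<omega> \<in> space (grp_space n p). P \<omega>} \<in> sets (uniform_points n \<Otimes>\<^sub>M edge_coins n p)"
    using assms by (simp add: pred_def grp_space_def)
  then show ?thesis
    unfolding grp_space_def
    by (subst E.emeasure_pair_measure_alt)
       (auto simp: space_pair_measure intro!: nn_integral_cong arg_cong[where f = "emeasure _"])
qed

lemma borel_measurable_fst_snd[measurable (raw)]:
  fixes f :: "'a \<Rightarrow> real \<times> real"
  assumes "f \<in> borel_measurable M"
  shows "(\<lambda>x. fst (f x)) \<in> borel_measurable M" "(\<lambda>x. snd (f x)) \<in> borel_measurable M"
  using assms by (auto intro!: borel_measurable_continuous_on[where g = f] continuous_on_fst continuous_on_snd continuous_on_id)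

text \<open>\<open>U\<close> carries the exposed vertices; a vertex outside \<open>U\<close> is forbidden to lie in any of the disjoint
  regions \<open>R c\<close> while its coins with all of \<open>T c\<close> come up heads.\<close>

lemma prob_avoid:
  fixes R :: "'c \<Rightarrow> (nat \<Rightarrow> real \<times> real) \<Rightarrow> (real \<times> real) set"
  assumes p: "0 \<le> p" "p \<le> 1" and U: "U \<subseteq> {..<n}" and I: "finite I"
    and T: "\<And>c. c \<in> I \<Longrightarrow> T c \<subseteq> U"
    and Q[measurable]: "Measurable.pred (PiM U (\<lambda>_. unif_sq)) Q"
    and R[measurable]: "\<And>c. c \<in> I \<Longrightarrow> Measurable.pred (PiM U (\<lambda>_. unif_sq) \<Otimes>\<^sub>M unif_sq) (\<lambda>(x, y). y \<in> R c x)"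
    and disj: "\<And>x. Q x \<Longrightarrow> disjoint_family_on (\<lambda>c. R c x) I"
    and s: "\<And>x. x \<in> space (PiM U (\<lambda>_. unif_sq)) \<Longrightarrow> Q x \<Longrightarrow> s \<le> (\<Sum>c\<in>I. measure unif_sq (R c x) * p ^ card (T c))"
  shows "Measurable.pred (grp_space n p) (\<lambda>\<omega>. Q (restrict (fst \<omega>) U) \<and>
       (\<forall>v\<in>{..<n} - U. \<forall>c\<in>I. fst \<omega> v \<in> R c (restrict (fst \<omega>) U) \<longrightarrow> \<not> (\<forall>t\<in>T c. snd \<omega> {v, t})))"
      (is "Measurable.pred _ ?A")
    and "emeasure (grp_space n p) {\<omega> \<in> space (grp_space n p). Q (restrict (fst \<omega>) U) \<and>
       (\<forall>v\<in>{..<n} - U. \<forall>c\<in>I. fst \<omega> v \<in> R c (restrict (fst \<omega>) U) \<longrightarrow> \<not> (\<forall>t\<in>T c. snd \<omega> {v, t}))}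
     \<le> ennreal ((1 - s) ^ (n - card U)) * emeasure (PiM U (\<lambda>_. unif_sq)) {x \<in> space (PiM U (\<lambda>_. unif_sq)). Q x}"
proof -
  interpret unif: prob_space unif_sq by (rule prob_space_unif_sq)
  interpret E: prob_space "edge_coins n p" by (rule prob_space_edge_coins)
  have fU: "finite U" using U finite_subset by blast
  have rm[measurable]: "(\<lambda>\<omega>. restrict (fst \<omega>) U) \<in> grp_space n p \<rightarrow>\<^sub>M PiM U (\<lambda>_. unif_sq)"
    unfolding grp_space_def uniform_points_eq
    by (rule measurable_compose[OF measurable_fst measurable_restrict_subset[OF U]])
  have pm: "{v, t} \<in> vertex_pairs n" if "v \<in> {..<n} - U" "t \<in> T c" "c \<in> I" for v t c
    using that U T by (intro vertex_pairs_memI) auto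
  have fT: "finite (T c)" if "c \<in> I" for c using T[OF that] fU finite_subset by blast
  show meas: "Measurable.pred (grp_space n p) ?A"
  proof -
    have r2: "Measurable.pred (grp_space n p) (\<lambda>\<omega>. fst \<omega> v \<in> R c (restrict (fst \<omega>) U))" if "v < n" "c \<in> I" for v c
    proof -
      have "(\<lambda>\<omega>. (restrict (fst \<omega>) U, fst \<omega> v)) \<in> grp_space n p \<rightarrow>\<^sub>M PiM U (\<lambda>_. unif_sq) \<Otimes>\<^sub>M unif_sq"
        using rm grp_point_measurable[OF that(1)] by (intro measurable_Pair) (auto simp: measurable_unif_sq_iff)
      from measurable_compose[OF this R[OF that(2)]] show ?thesis by simp
    qed
    have "Measurable.pred (grp_space n p) (\<lambda>\<omega>. \<forall>v\<in>{..<n} - U. \<forall>c\<in>I. fst \<omega> v \<in> R c (restrict (fst \<omega>) U) \<longrightarrow> \<not> (\<forall>t\<in>T c. snd \<omega> {v, t}))"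
      using I fU fT pm r2 by (intro pred_intros_finite pred_intros_logic grp_coin_measurable) auto
    moreover have "Measurable.pred (grp_space n p) (\<lambda>\<omega>. Q (restrict (fst \<omega>) U))"
      by (rule measurable_compose[OF rm Q])
    ultimately show ?thesis by (auto intro: pred_intros_logic)
  qed
  \<comment> \<open>Conditional probability that a further vertex placed at \<open>y\<close> obeys
    its restriction, given exposed positions \<open>x\<close> with \<open>Q x\<close>. By
    disjointness at most one summand is nonzero.\<close>
  define f where "f x y = 1 - (\<Sum>c\<in>I. indicator (R c x) y * p ^ card (T c))" for x and y :: "real \<times> real"
  define \<phi> where "\<phi> x y = ennreal (f x y)" for x y
  define g :: "(nat \<Rightarrow> real \<times> real) \<Rightarrow> ennreal" where "g x = indicator {x. Q x} x" for x
  have f_in: "f x y = 1 - p ^ card (T c)" if "Q x" "c \<in> I" "y \<in> R c x" for x y c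
  proof -
    have "indicator (R d x) y = (if d = c then 1 else 0 :: real)" if "d \<in> I" for d
      using disj[OF \<open>Q x\<close>] \<open>c \<in> I\<close> \<open>y \<in> R c x\<close> that by (auto simp: disjoint_family_on_def indicator_def)
    then have "(\<Sum>c\<in>I. indicator (R c x) y * p ^ card (T c)) = (\<Sum>d\<in>I. if d = c then p ^ card (T d) else 0)"
      by (intro sum.cong) auto
    then show ?thesis using I that by (simp add: f_def)
  qed
  have f_out: "f x y = 1" if "\<And>c. c \<in> I \<Longrightarrow> y \<notin> R c x" for x y
    using that by (simp add: f_def)
  have f01: "0 \<le> f x y" if "Q x" for x y
  proof (cases "\<exists>c\<in>I. y \<in> R c x")
    case True
    then obtain c where "c \<in> I" "y \<in> R c x" by blast
    from f_in[OF that this] p show ?thesis by (simp add: power_le_one)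
  next
    case False
    then have "f x y = 1" by (intro f_out) blast
    then show ?thesis by simp
  qed
  have key: "emeasure (edge_coins n p) {C \<in> space (edge_coins n p). ?A (X, C)} \<le>
     g (restrict X U) * (\<Prod>v\<in>{..<n} - U. \<phi> (restrict X U) (X v))" for X
  proof (cases "Q (restrict X U)")
    case True
    define x where "x = restrict X U"
    \<comment> \<open>Since the regions are disjoint, a point determines its region, and each vertex
      of \<open>L\<close> is responsible for a single block of coins. Blocks of different vertices
      are disjoint: in \<open>{v, t}\<close> with \<open>v\<close> outside and \<open>t\<close>
      inside \<open>U\<close>, the pair determines \<open>v\<close>.\<close>
    define c where "c v = (SOME c. c \<in> I \<and> X v \<in> R c x)" for v
    define L where "L = {v \<in> {..<n} - U. \<exists>c\<in>I. X v \<in> R c x}"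
    have c: "c v \<in> I \<and> X v \<in> R (c v) x" if "v \<in> L" for v
      using that someI_ex[of "\<lambda>c. c \<in> I \<and> X v \<in> R c x"] unfolding c_def L_def by blast
    have cu: "d = c v" if "v \<in> L" "d \<in> I" "X v \<in> R d x" for v d
      using that c[OF that(1)] disj[of x] True unfolding x_def[symmetric] disjoint_family_on_def by blast
    define K where "K v = (\<lambda>t. {v, t}) ` T (c v)" for v
    have "{C \<in> space (edge_coins n p). ?A (X, C)} = {C \<in> space (edge_coins n p). \<forall>v\<in>L. \<not> (\<forall>e\<in>K v. C e)}"
    proof (intro Collect_cong conj_cong refl)
      fix C
      have "(\<forall>v\<in>{..<n} - U. \<forall>d\<in>I. X v \<in> R d x \<longrightarrow> \<not> (\<forall>t\<in>T d. C {v, t})) \<longleftrightarrow>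
        (\<forall>v\<in>L. \<not> (\<forall>t\<in>T (c v). C {v, t}))"
      proof (intro iffI ballI impI)
        fix v assume a: "\<forall>v\<in>{..<n} - U. \<forall>d\<in>I. X v \<in> R d x \<longrightarrow> \<not> (\<forall>t\<in>T d. C {v, t})" and v: "v \<in> L"
        then show "\<not> (\<forall>t\<in>T (c v). C {v, t})" using c[OF v] unfolding L_def by blast
      next
        fix v d assume a: "\<forall>v\<in>L. \<not> (\<forall>t\<in>T (c v). C {v, t})" and v: "v \<in> {..<n} - U" "d \<in> I" "X v \<in> R d x"
        then have "v \<in> L" unfolding L_def by blast
        with a cu[OF this v(2,3)] show "\<not> (\<forall>t\<in>T d. C {v, t})" by blast
      qed
      then show "?A (X, C) = (\<forall>v\<in>L. \<not> (\<forall>e\<in>K v. C e))"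
        using True by (simp add: x_def K_def)
    qed
    also have "emeasure (edge_coins n p) \<dots> = ennreal (\<Prod>v\<in>L. 1 - p ^ card (K v))"
    proof -
      have "disjoint_family_on K L"
        unfolding disjoint_family_on_def
      proof (intro ballI impI equals0I)
        fix v w e assume vw: "v \<in> L" "w \<in> L" "v \<noteq> w" "e \<in> K v \<inter> K w"
        then obtain t t' where "e = {v, t}" "t \<in> T (c v)" "e = {w, t'}" "t' \<in> T (c w)"
          using vw(4) unfolding K_def by blast
        moreover have "t \<in> U" "t' \<in> U" "v \<notin> U" "w \<notin> U"
          using calculation vw c T by (auto simp: L_def)
        ultimately show False using vw(3) by (auto simp: doubleton_eq_iff)
      qed
      moreover have "K v \<subseteq> vertex_pairs n" if "v \<in> L" for v
        using that pm c[OF that] by (auto simp: K_def L_def)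
      moreover have "finite L" by (auto simp: L_def)
      ultimately show ?thesis
        using p by (subst E.emeasure_eq_measure, subst prob_blocks_not_all_coin) auto
    qed
    also have "(\<Prod>v\<in>L. 1 - p ^ card (K v)) = (\<Prod>v\<in>L. f x (X v))"
    proof (intro prod.cong refl)
      fix v assume v: "v \<in> L"
      have "inj_on (\<lambda>t. {v, t}) (T (c v))" by (auto simp: inj_on_def doubleton_eq_iff)
      then show "1 - p ^ card (K v) = f x (X v)"
        using f_in[of x "c v" "X v"] c[OF v] True by (simp add: K_def card_image x_def)
    qed
    also have "\<dots> = (\<Prod>v\<in>{..<n} - U. f x (X v))"
      by (rule prod.mono_neutral_left) (auto simp: L_def intro!: f_out)
    finally have *: "emeasure (edge_coins n p) {C \<in> space (edge_coins n p). ?A (X, C)} =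
        ennreal (\<Prod>v\<in>{..<n} - U. f x (X v))" .
    have "g (restrict X U) * (\<Prod>v\<in>{..<n} - U. \<phi> (restrict X U) (X v)) = ennreal (\<Prod>v\<in>{..<n} - U. f x (X v))"
      using True f01[of x] by (simp add: g_def \<phi>_def x_def prod_ennreal)
    then show ?thesis by (simp only: * order_refl)
  qed simp
  have fm[measurable]: "(\<lambda>(x, y). f x y) \<in> borel_measurable (PiM U (\<lambda>_. unif_sq) \<Otimes>\<^sub>M unif_sq)"
  proof -
    have "(\<lambda>z. indicator (R c (fst z)) (snd z) :: real) \<in> borel_measurable (PiM U (\<lambda>_. unif_sq) \<Otimes>\<^sub>M unif_sq)" if "c \<in> I" for c
      using R[OF that] by (intro borel_measurable_indicator') (auto simp: case_prod_beta pred_def)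
    then have "(\<lambda>z. f (fst z) (snd z)) \<in> borel_measurable (PiM U (\<lambda>_. unif_sq) \<Otimes>\<^sub>M unif_sq)"
      unfolding f_def by (intro borel_measurable_diff borel_measurable_sum borel_measurable_times) auto
    then show ?thesis by (simp add: case_prod_beta)
  qed
  have "emeasure (grp_space n p) {\<omega> \<in> space (grp_space n p). ?A \<omega>} \<le>
     (\<integral>\<^sup>+X. g (restrict X U) * (\<Prod>v\<in>{..<n} - U. \<phi> (restrict X U) (X v)) \<partial>uniform_points n)"
    unfolding emeasure_grp_space[OF meas] by (intro nn_integral_mono key)
  also have "\<dots> = (\<integral>\<^sup>+x. g x * (\<integral>\<^sup>+y. \<phi> x y \<partial>unif_sq) ^ card ({..<n} - U) \<partial>PiM U (\<lambda>_. unif_sq))"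
    unfolding uniform_points_eq
  proof (rule nn_integral_PiM_split[OF _ U prob_space_unif_sq])
    show "g \<in> borel_measurable (PiM U (\<lambda>_. unif_sq))" unfolding g_def by measurable
    show "(\<lambda>(x, y). \<phi> x y) \<in> borel_measurable (PiM U (\<lambda>_. unif_sq) \<Otimes>\<^sub>M unif_sq)"
      using measurable_compose[OF fm measurable_ennreal] by (simp add: \<phi>_def case_prod_beta)
  qed simp
  also have "\<dots> \<le> (\<integral>\<^sup>+x. g x * ennreal ((1 - s) ^ (n - card U)) \<partial>PiM U (\<lambda>_. unif_sq))"
  proof (intro nn_integral_mono)
    fix x assume x: "x \<in> space (PiM U (\<lambda>_. unif_sq))"
    show "g x * (\<integral>\<^sup>+y. \<phi> x y \<partial>unif_sq) ^ card ({..<n} - U) \<le> g x * ennreal ((1 - s) ^ (n - card U))"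
    proof (cases "Q x")
      case True
      have Rx: "R c x \<in> sets unif_sq" if "c \<in> I" for c
        using measurable_compose[OF measurable_Pair1'[OF x] R[OF that]] by (simp add: pred_def)
      have int: "integrable unif_sq (f x)"
        unfolding f_def using Rx
        by (intro Bochner_Integration.integrable_diff Bochner_Integration.integrable_sum integrable_mult_left integrable_real_indicator unif.integrable_const) 
           (auto simp: less_top[symmetric])
      have "(\<integral>\<^sup>+y. \<phi> x y \<partial>unif_sq) = ennreal (\<integral>y. f x y \<partial>unif_sq)"
        unfolding \<phi>_def using f01[OF True] by (intro nn_integral_eq_integral int) auto
      also have "(\<integral>y. f x y \<partial>unif_sq) = 1 - (\<Sum>c\<in>I. measure unif_sq (R c x) * p ^ card (T c))"
        unfolding f_def using Rx unif.prob_space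
        by (subst Bochner_Integration.integral_diff)
           (auto intro!: integrable_mult_left integrable_real_indicator simp: less_top[symmetric])
      also have "ennreal \<dots> \<le> ennreal (1 - s)"
        using s[OF x True] by (intro ennreal_leI) simp
      finally have le: "(\<integral>\<^sup>+y. \<phi> x y \<partial>unif_sq) \<le> ennreal (1 - s)" .
      \<comment> \<open>The power of 1 - s in the bound needs a nonnegative base; this holds because
        1 - s dominates an integral of a nonnegative function.\<close>
      have "0 \<le> (\<integral>y. f x y \<partial>unif_sq)" using f01[OF True] by (intro Bochner_Integration.integral_nonneg) auto
      then have "0 \<le> 1 - s"
        using s[OF x True] \<open>(\<integral>y. f x y \<partial>unif_sq) = _\<close> by linarith
      moreover have "card ({..<n} - U) = n - card U" using U fU by (simp add: card_Diff_subset)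
      ultimately show ?thesis
        using power_mono[OF le, of "n - card U"] by (intro mult_left_mono) (auto simp: ennreal_power)
    qed (simp add: g_def)
  qed
  also have "\<dots> = ennreal ((1 - s) ^ (n - card U)) * emeasure (PiM U (\<lambda>_. unif_sq)) {x \<in> space (PiM U (\<lambda>_. unif_sq)). Q x}"
  proof -
    have "(\<integral>\<^sup>+x. g x * ennreal ((1 - s) ^ (n - card U)) \<partial>PiM U (\<lambda>_. unif_sq)) =
      (\<integral>\<^sup>+x. ennreal ((1 - s) ^ (n - card U)) * indicator {x \<in> space (PiM U (\<lambda>_. unif_sq)). Q x} x \<partial>PiM U (\<lambda>_. unif_sq))"
      by (intro nn_integral_cong) (auto simp: g_def indicator_def)
    also have "\<dots> = ennreal ((1 - s) ^ (n - card U)) * emeasure (PiM U (\<lambda>_. unif_sq)) {x \<in> space (PiM U (\<lambda>_. unif_sq)). Q x}"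
      using Q by (intro nn_integral_cmult_indicator) (simp add: pred_def)
    finally show ?thesis .
  qed
  finally show "emeasure (grp_space n p) {\<omega> \<in> space (grp_space n p). ?A \<omega>} \<le>
     ennreal ((1 - s) ^ (n - card U)) * emeasure (PiM U (\<lambda>_. unif_sq)) {x \<in> space (PiM U (\<lambda>_. unif_sq)). Q x}" .
qed

subsection \<open>Trapping a component between good rows and columns\<close>

text \<open>The trapping argument is purely combinatorial. Each vertex has an integer cell, taken
  modulo \<open>N\<close>, and \<open>near\<close> compares some lift of that cell with a point of
  the integer plane, so windows live in the plane and wrapping around is never an issue.
  \<open>near\<close> and \<open>closed\<close> are parameters so that an interpretation can supply
  its own notions. The constants fit together: a good cell joins everything within 10 of it and an
  edge spans at most 20, so a vertex more than 10 away on one side of a good line has no neighbour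
  more than 10 away on the other side.\<close>

locale trap =
  fixes V :: "'v set" and adj :: "'v \<Rightarrow> 'v \<Rightarrow> bool" and kx ky :: "'v \<Rightarrow> int" and N h :: int
    and J :: nat and good :: "int \<Rightarrow> int \<Rightarrow> bool"
  fixes near :: "int \<Rightarrow> int \<Rightarrow> int \<Rightarrow> 'v \<Rightarrow> bool" and closed :: "'v set \<Rightarrow> bool"
  assumes near_def: "\<And>m x y v. near m x y v \<longleftrightarrow> (\<exists>a b. \<bar>kx v + N * a - x\<bar> \<le> m \<and> \<bar>ky v + N * b - y\<bar> \<le> m)"
    and closed_def: "\<And>S. closed S \<longleftrightarrow> S \<subseteq> V \<and> (\<forall>u\<in>S. \<forall>v\<in>V. adj u v \<longrightarrow> v \<in> S)"
    and adj_sym: "\<And>u v. adj u v \<Longrightarrow> adj v u"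
    and adj_short: "\<And>u v. u \<in> V \<Longrightarrow> v \<in> V \<Longrightarrow> adj u v \<Longrightarrow> near 20 (kx u) (ky u) v"
    and good_inhabited: "\<And>x y. good x y \<Longrightarrow> \<exists>v\<in>V. near 0 x y v"
    and good_joins: "\<And>x y S u w. good x y \<Longrightarrow> closed S \<Longrightarrow> u \<in> V \<Longrightarrow> w \<in> V \<Longrightarrow> near 10 x y u \<Longrightarrow>
      near 10 x y w \<Longrightarrow> u \<in> S \<Longrightarrow> w \<in> S"
    and few_bad: "\<And>x y. card {(x', y'). \<bar>x' - x\<bar> \<le> h \<and> \<bar>y' - y\<bar> \<le> h \<and> \<not> good x' y'} < J"
    and h: "int J + 20 \<le> h"
begin

definition gcol :: "int \<Rightarrow> int \<Rightarrow> int \<Rightarrow> bool" where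
  "gcol x y \<alpha> \<longleftrightarrow> \<bar>\<alpha> - x\<bar> \<le> h \<and> (\<forall>y'. \<bar>y' - y\<bar> \<le> h \<longrightarrow> good \<alpha> y')"

definition grow :: "int \<Rightarrow> int \<Rightarrow> int \<Rightarrow> bool" where
  "grow x y \<beta> \<longleftrightarrow> \<bar>\<beta> - y\<bar> \<le> h \<and> (\<forall>x'. \<bar>x' - x\<bar> \<le> h \<longrightarrow> good x' \<beta>)"

lemma finite_window: "finite {(x', y'). \<bar>x' - x\<bar> \<le> h \<and> \<bar>y' - y\<bar> \<le> h \<and> \<not> good x' y'}"
proof (rule finite_subset)
  show "{(x', y'). \<bar>x' - x\<bar> \<le> h \<and> \<bar>y' - y\<bar> \<le> h \<and> \<not> good x' y'} \<subseteq> {x - h..x + h} \<times> {y - h..y + h}"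
    by auto
qed auto

lemma in_window: "A \<subseteq> {x - h..x + h} \<Longrightarrow> \<alpha> \<in> A \<Longrightarrow> \<bar>\<alpha> - x\<bar> \<le> h"
  using subsetD[of A "{x - h..x + h}" \<alpha>] by (simp add: abs_le_iff)

text \<open>Pigeonhole: a column that is not good throughout the window has a bad cell of its own,
  and there are fewer than \<open>J\<close> bad cells.\<close>

lemma ex_gcol:
  assumes A: "A \<subseteq> {x - h..x + h}" "J \<le> card A"
  shows "\<exists>\<alpha>\<in>A. gcol x y \<alpha>"
proof (rule ccontr)
  assume "\<not> ?thesis"
  then have "\<forall>\<alpha>\<in>A. \<exists>y'. \<bar>y' - y\<bar> \<le> h \<and> \<not> good \<alpha> y'"
    using in_window[OF A(1)] unfolding gcol_def by blast
  then obtain f where f: "\<forall>\<alpha>\<in>A. \<bar>f \<alpha> - y\<bar> \<le> h \<and> \<not> good \<alpha> (f \<alpha>)" by metis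
  have "card A \<le> card {(x', y'). \<bar>x' - x\<bar> \<le> h \<and> \<bar>y' - y\<bar> \<le> h \<and> \<not> good x' y'}"
    using f in_window[OF A(1)] by (intro card_inj_on_le[OF _ _ finite_window, of "\<lambda>\<alpha>. (\<alpha>, f \<alpha>)"]) (auto simp: inj_on_def)
  with few_bad[of x y] A show False by linarith
qed

lemma ex_grow:
  assumes A: "A \<subseteq> {y - h..y + h}" "J \<le> card A"
  shows "\<exists>\<beta>\<in>A. grow x y \<beta>"
proof (rule ccontr)
  assume "\<not> ?thesis"
  then have "\<forall>\<beta>\<in>A. \<exists>x'. \<bar>x' - x\<bar> \<le> h \<and> \<not> good x' \<beta>"
    using in_window[OF A(1)] unfolding grow_def by blast
  then obtain f where f: "\<forall>\<beta>\<in>A. \<bar>f \<beta> - x\<bar> \<le> h \<and> \<not> good (f \<beta>) \<beta>" by metis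
  have "card A \<le> card {(x', y'). \<bar>x' - x\<bar> \<le> h \<and> \<bar>y' - y\<bar> \<le> h \<and> \<not> good x' y'}"
    using f in_window[OF A(1)] by (intro card_inj_on_le[OF _ _ finite_window, of "\<lambda>\<beta>. (f \<beta>, \<beta>)"]) (auto simp: inj_on_def)
  with few_bad[of x y] A show False by linarith
qed

text \<open>The window has more than 2 \<open>J\<close> columns and fewer than \<open>J\<close> of
  them are spoilt. Having \<open>J\<close> good ones, not just one, lets \<open>ex_gcol\<close> find
  among them a column that is good for a neighbouring window as well.\<close>

lemma card_gcol: "J \<le> card {\<alpha>. gcol x y \<alpha>}"
proof (rule ccontr)
  let ?A = "{x - h..x + h} - {\<alpha>. gcol x y \<alpha>}"
  assume "\<not> ?thesis"
  moreover have "nat (2 * h + 1) - card {\<alpha>. gcol x y \<alpha>} \<le> card ?A"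
  proof -
    have "finite {\<alpha>. gcol x y \<alpha>}"
      by (rule finite_subset[of _ "{x - h..x + h}"]) (auto simp: gcol_def)
    then have "card {x - h..x + h} - card {\<alpha>. gcol x y \<alpha>} \<le> card ?A"
      by (rule diff_card_le_card_Diff)
    moreover have "card {x - h..x + h} = nat (2 * h + 1)" by simp
    ultimately show ?thesis by simp
  qed
  ultimately have "J \<le> card ?A" using h by linarith
  from ex_gcol[OF _ this, of x y] show False by auto
qed

lemma card_grow: "J \<le> card {\<beta>. grow x y \<beta>}"
proof (rule ccontr)
  let ?A = "{y - h..y + h} - {\<beta>. grow x y \<beta>}"
  assume "\<not> ?thesis"
  moreover have "nat (2 * h + 1) - card {\<beta>. grow x y \<beta>} \<le> card ?A"
  proof -
    have "finite {\<beta>. grow x y \<beta>}"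
      by (rule finite_subset[of _ "{y - h..y + h}"]) (auto simp: grow_def)
    then have "card {y - h..y + h} - card {\<beta>. grow x y \<beta>} \<le> card ?A"
      by (rule diff_card_le_card_Diff)
    moreover have "card {y - h..y + h} = nat (2 * h + 1)" by simp
    ultimately show ?thesis by simp
  qed
  ultimately have "J \<le> card ?A" using h by linarith
  from ex_grow[OF _ this, of y x] show False by auto
qed

lemma near_mono:
  assumes "near m x y v" "\<bar>x - x'\<bar> \<le> d" "\<bar>y - y'\<bar> \<le> d" "m + d \<le> m'" shows "near m' x' y' v"
proof -
  obtain a b where "\<bar>kx v + N * a - x\<bar> \<le> m \<and> \<bar>ky v + N * b - y\<bar> \<le> m"
    using assms unfolding near_def by blast
  then have "\<bar>kx v + N * a - x'\<bar> \<le> m' \<and> \<bar>ky v + N * b - y'\<bar> \<le> m'"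
    using assms by linarith
  then show ?thesis unfolding near_def by blast
qed

definition touches :: "'v set \<Rightarrow> int \<Rightarrow> int \<Rightarrow> bool" where
  "touches S x y \<longleftrightarrow> (\<exists>u\<in>V. near 10 x y u \<and> u \<in> S)"

text \<open>A vertex in the first cell is within 10 of both cells, so \<open>good_joins\<close>
  carries membership in \<open>S\<close> across it.\<close>

lemma touches_step:
  assumes "closed S" "good x y" "good x' y'" "\<bar>x - x'\<bar> \<le> 1" "\<bar>y - y'\<bar> \<le> 1"
  shows "touches S x y \<longleftrightarrow> touches S x' y'"
proof -
  obtain v where v: "v \<in> V" "near 0 x y v" using good_inhabited assms by blast
  have "near 10 x y v" by (rule near_mono[OF v(2), of _ 0]) auto
  moreover have "near 10 x' y' v" by (rule near_mono[OF v(2), of _ 1]) (use assms in auto)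
  ultimately show ?thesis
    using v good_joins[OF assms(2,1)] good_joins[OF assms(3,1)] unfolding touches_def by blast
qed

lemma touches_path:
  fixes f :: "int \<Rightarrow> int \<times> int"
  assumes S: "closed S" and ij: "i \<le> j"
    and g: "\<And>k. i \<le> k \<Longrightarrow> k \<le> j \<Longrightarrow> good (fst (f k)) (snd (f k))"
    and st: "\<And>k. \<bar>fst (f k) - fst (f (k + 1))\<bar> \<le> 1 \<and> \<bar>snd (f k) - snd (f (k + 1))\<bar> \<le> 1"
  shows "touches S (fst (f i)) (snd (f i)) \<longleftrightarrow> touches S (fst (f j)) (snd (f j))"
  using ij g
proof (induction j rule: int_ge_induct)
  case (step j)
  have "touches S (fst (f j)) (snd (f j)) \<longleftrightarrow> touches S (fst (f (j + 1))) (snd (f (j + 1)))"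
    using step st[of j] by (intro touches_step[OF S]) auto
  with step show ?case by auto
qed simp

lemma touches_gcol:
  assumes "closed S" "gcol x y \<alpha>" "\<bar>y1 - y\<bar> \<le> h" "\<bar>y2 - y\<bar> \<le> h"
  shows "touches S \<alpha> y1 \<longleftrightarrow> touches S \<alpha> y2"
proof -
  have "touches S \<alpha> i \<longleftrightarrow> touches S \<alpha> j" if "i \<le> j" "\<bar>i - y\<bar> \<le> h" "\<bar>j - y\<bar> \<le> h" for i j
    using touches_path[OF assms(1) that(1), of "\<lambda>k. (\<alpha>, k)"] assms(2) that by (auto simp: gcol_def)
  then show ?thesis using assms by (metis linorder_le_cases)
qed

lemma touches_grow:
  assumes "closed S" "grow x y \<beta>" "\<bar>x1 - x\<bar> \<le> h" "\<bar>x2 - x\<bar> \<le> h"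
  shows "touches S x1 \<beta> \<longleftrightarrow> touches S x2 \<beta>"
proof -
  have "touches S i \<beta> \<longleftrightarrow> touches S j \<beta>" if "i \<le> j" "\<bar>i - x\<bar> \<le> h" "\<bar>j - x\<bar> \<le> h" for i j
    using touches_path[OF assms(1) that(1), of "\<lambda>k. (k, \<beta>)"] assms(2) that by (auto simp: grow_def)
  then show ?thesis using assms by (metis linorder_le_cases)
qed

definition net :: "int \<Rightarrow> int \<Rightarrow> int \<Rightarrow> int \<Rightarrow> bool" where
  "net x y x' y' \<longleftrightarrow> \<bar>x' - x\<bar> \<le> h \<and> \<bar>y' - y\<bar> \<le> h \<and> (gcol x y x' \<or> grow x y y')"

text \<open>Every good column meets every good row inside the window, so any two places of the net
  are linked through a fixed crossing.\<close>

lemma touches_net: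
  assumes S: "closed S" and "net x y x1 y1" "net x y x2 y2"
  shows "touches S x1 y1 \<longleftrightarrow> touches S x2 y2"
proof -
  have "0 < card {\<beta>. grow x y \<beta>}" "0 < card {\<alpha>. gcol x y \<alpha>}"
    using card_grow[of x y] card_gcol[of x y] few_bad[of x y] by linarith+
  then obtain \<alpha> \<beta> where g: "gcol x y \<alpha>" "grow x y \<beta>"
    by (metis (mono_tags, lifting) card_gt_0_iff empty_Collect_eq)
  then have r: "\<bar>\<alpha> - x\<bar> \<le> h" "\<bar>\<beta> - y\<bar> \<le> h" by (auto simp: gcol_def grow_def)
  have "touches S x' y' \<longleftrightarrow> touches S \<alpha> \<beta>" if "net x y x' y'" for x' y'
    using that r touches_gcol[OF S, of x y x' y' \<beta>] touches_grow[OF S g(2), of x' \<alpha>]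
      touches_grow[OF S, of x y y' x' \<alpha>] touches_gcol[OF S g(1), of y' \<beta>]
    unfolding net_def by blast
  then show ?thesis using assms by blast
qed

text \<open>For a closed \<open>S\<close> the net of a window is touched by \<open>S\<close>
  everywhere or nowhere; this records which.\<close>

definition status :: "'v set \<Rightarrow> int \<Rightarrow> int \<Rightarrow> bool" where
  "status S x y \<longleftrightarrow> (\<exists>x' y'. net x y x' y' \<and> touches S x' y')"

lemma status_net: "closed S \<Longrightarrow> net x y x' y' \<Longrightarrow> touches S x' y' \<longleftrightarrow> status S x y"
  unfolding status_def using touches_net by blast

text \<open>Two windows shifted by one have a common good row (or column), since most rows of either are good.\<close>

lemma status_right: "closed S \<Longrightarrow> status S (x + 1) y = status S x y"
proof -
  assume S: "closed S"
  obtain \<beta> where b: "grow x y \<beta>" "grow (x + 1) y \<beta>"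
  proof -
    have "{\<beta>. grow x y \<beta>} \<subseteq> {y - h..y + h}" by (auto simp: grow_def)
    from ex_grow[OF this card_grow] show ?thesis using that by blast
  qed
  then have "net x y x \<beta>" "net (x + 1) y x \<beta>" using h by (auto simp: net_def grow_def)
  with status_net[OF S] show ?thesis by metis
qed

lemma status_up: "closed S \<Longrightarrow> status S x (y + 1) = status S x y"
proof -
  assume S: "closed S"
  obtain \<alpha> where b: "gcol x y \<alpha>" "gcol x (y + 1) \<alpha>"
  proof -
    have "{\<alpha>. gcol x y \<alpha>} \<subseteq> {x - h..x + h}" by (auto simp: gcol_def)
    from ex_gcol[OF this card_gcol] show ?thesis using that by blast
  qed
  then have "net x y \<alpha> y" "net x (y + 1) \<alpha> y" using h by (auto simp: net_def gcol_def)
  with status_net[OF S] show ?thesis by metis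
qed

text \<open>Sliding the window by unit steps reaches every position, so the nets of all windows lie
  in the same component.\<close>

lemma status_const:
  assumes "closed S" shows "status S x y = status S 0 0"
proof -
  have "status S x y = status S 0 y"
  proof (induction x rule: int_induct[where k = 0])
    case (step1 i)
    then show ?case using status_right[OF assms, of i y] by simp
  next
    case (step2 i)
    then show ?case using status_right[OF assms, of "i - 1" y] by simp
  qed simp
  also have "\<dots> = status S 0 0"
  proof (induction y rule: int_induct[where k = 0])
    case (step1 i)
    then show ?case using status_up[OF assms, of 0 i] by simp
  next
    case (step2 i)
    then show ?case using status_up[OF assms, of 0 "i - 1"] by simp
  qed simp
  finally show ?thesis .
qed

text \<open>Four good lines close to \<open>z\<close> enclose a rectangle. Members of
  \<open>S\<close> stay more than 10 away from these lines, and edges are too short to jump over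
  such a gap, so the part of \<open>S\<close> inside the rectangle is itself closed.\<close>

lemma trapped_aux:
  assumes S: "closed S" and z: "z \<in> S"
    and avoid: "\<And>x y x' y' u. net x y x' y' \<Longrightarrow> u \<in> S \<Longrightarrow> \<not> near 10 x' y' u"
  shows "\<exists>T. closed T \<and> z \<in> T \<and> (\<forall>t\<in>T. near h (kx z) (ky z) t)"
proof -
  define x0 y0 where "x0 = kx z" and "y0 = ky z"
  have J: "0 < J" using few_bad[of 0 0] by linarith
  \<comment> \<open>Among any \<open>J\<close> consecutive columns or rows of the window one is
    good, so the enclosing lines can be found within distance \<open>J\<close> on each side.\<close>
  obtain \<alpha> where \<alpha>: "gcol x0 y0 \<alpha>" "x0 < \<alpha>" "\<alpha> \<le> x0 + int J"
    using ex_gcol[of "{x0 + 1..x0 + int J}" x0 y0] h by auto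
  obtain \<alpha>' where \<alpha>': "gcol x0 y0 \<alpha>'" "\<alpha>' < x0" "x0 - int J \<le> \<alpha>'"
    using ex_gcol[of "{x0 - int J..x0 - 1}" x0 y0] h by auto
  obtain \<beta> where \<beta>: "grow x0 y0 \<beta>" "y0 < \<beta>" "\<beta> \<le> y0 + int J"
    using ex_grow[of "{y0 + 1..y0 + int J}" y0 x0] h by auto
  obtain \<beta>' where \<beta>': "grow x0 y0 \<beta>'" "\<beta>' < y0" "y0 - int J \<le> \<beta>'"
    using ex_grow[of "{y0 - int J..y0 - 1}" y0 x0] h by auto
  define inside where "inside x y \<longleftrightarrow> \<alpha>' < x \<and> x < \<alpha> \<and> \<beta>' < y \<and> y < \<beta>" for x y
  \<comment> \<open>\<open>S\<close> may be a union of several components spread over the torus;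
    only the part with a lift in the rectangle is kept.\<close>
  define T where "T = {s \<in> S. \<exists>a b. inside (kx s + N * a) (ky s + N * b)}"
  have SV: "S \<subseteq> V" using S by (simp add: closed_def)
  have "z \<in> T"
  proof -
    have "inside (kx z + N * 0) (ky z + N * 0)"
      using \<alpha> \<alpha>' \<beta> \<beta>' by (simp add: inside_def x0_def y0_def)
    with z show ?thesis unfolding T_def by blast
  qed
  moreover have "near h x0 y0 t" if t: "t \<in> T" for t
  proof -
    obtain a b where "inside (kx t + N * a) (ky t + N * b)"
      using t unfolding T_def by blast
    then have "\<bar>kx t + N * a - x0\<bar> \<le> h \<and> \<bar>ky t + N * b - y0\<bar> \<le> h"
      using \<alpha> \<alpha>' \<beta> \<beta>' h unfolding inside_def by linarith
    then show ?thesis unfolding near_def by blast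
  qed
  moreover have "closed T"
    unfolding closed_def
  proof (intro conjI ballI impI)
    show "T \<subseteq> V" using SV by (auto simp: T_def)
    fix s v assume s: "s \<in> T" and v: "v \<in> V" "adj s v"
    then have sS: "s \<in> S" by (simp add: T_def)
    with S v have vS: "v \<in> S" unfolding closed_def by blast
    from s obtain a b where ins: "inside (kx s + N * a) (ky s + N * b)" by (auto simp: T_def)
    define x y where "x = kx s + N * a" and "y = ky s + N * b"
    obtain a' b' where "\<bar>kx v + N * a' - kx s\<bar> \<le> 20" "\<bar>ky v + N * b' - ky s\<bar> \<le> 20"
      using adj_short[of s v] sS SV v unfolding near_def by blast
    moreover define x' y' where "x' = kx v + N * (a' + a)" and "y' = ky v + N * (b' + b)"
    ultimately have d: "\<bar>x' - x\<bar> \<le> 20" "\<bar>y' - y\<bar> \<le> 20"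
      by (auto simp: x_def y_def algebra_simps)
    have nearI: "near 10 p q s" if "\<bar>x - p\<bar> \<le> 10" "\<bar>y - q\<bar> \<le> 10" for p q
      using that unfolding near_def x_def y_def by blast
    have nearI': "near 10 p q v" if "\<bar>x' - p\<bar> \<le> 10" "\<bar>y' - q\<bar> \<le> 10" for p q
      using that unfolding near_def x'_def y'_def by blast
    have i: "\<alpha>' < x \<and> x < \<alpha> \<and> \<beta>' < y \<and> y < \<beta>"
      using ins unfolding inside_def x_def y_def .
    have cols: "net x0 y0 \<gamma> y \<and> net x0 y0 \<gamma> y'" if "gcol x0 y0 \<gamma>" for \<gamma>
    proof -
      \<comment> \<open>The neighbour may a priori lie up to 20 outside the rectangle; the bound
        \<open>J + 20 \<le> h\<close> keeps it in the window, where the line is still known to be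
        good.\<close>
      have "\<bar>y - y0\<bar> \<le> h" "\<bar>y' - y0\<bar> \<le> h" using i d \<beta> \<beta>' h by linarith+
      then show ?thesis using that by (auto simp: net_def gcol_def)
    qed
    have rows: "net x0 y0 x \<gamma> \<and> net x0 y0 x' \<gamma>" if "grow x0 y0 \<gamma>" for \<gamma>
    proof -
      have "\<bar>x - x0\<bar> \<le> h" "\<bar>x' - x0\<bar> \<le> h" using i d \<alpha> \<alpha>' h by linarith+
      then show ?thesis using that by (auto simp: net_def grow_def)
    qed
    \<comment> \<open>The net cell on the line at the height of each endpoint excludes a distance of
      at most 10. With \<alpha>' < x < \<alpha> and a jump of at most 20, x' cannot get to the other
      side.\<close>
    have colf: "10 < \<bar>x - \<gamma>\<bar> \<and> 10 < \<bar>x' - \<gamma>\<bar>" if "gcol x0 y0 \<gamma>" for \<gamma>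
    proof -
      have "\<not> near 10 \<gamma> y s" "\<not> near 10 \<gamma> y' v"
        using avoid[of x0 y0 \<gamma> y s] avoid[of x0 y0 \<gamma> y' v] cols[OF that] sS vS by blast+
      then have "\<not> \<bar>x - \<gamma>\<bar> \<le> 10" "\<not> \<bar>x' - \<gamma>\<bar> \<le> 10" using nearI[of \<gamma> y] nearI'[of \<gamma> y'] by auto
      then show ?thesis by linarith
    qed
    have rowf: "10 < \<bar>y - \<gamma>\<bar> \<and> 10 < \<bar>y' - \<gamma>\<bar>" if "grow x0 y0 \<gamma>" for \<gamma>
    proof -
      have "\<not> near 10 x \<gamma> s" "\<not> near 10 x' \<gamma> v"
        using avoid[of x0 y0 x \<gamma> s] avoid[of x0 y0 x' \<gamma> v] rows[OF that] sS vS by blast+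
      then have "\<not> \<bar>y - \<gamma>\<bar> \<le> 10" "\<not> \<bar>y' - \<gamma>\<bar> \<le> 10" using nearI[of x \<gamma>] nearI'[of x' \<gamma>] by auto
      then show ?thesis by linarith
    qed
    have "x' < \<alpha>" using i d(1) colf[OF \<alpha>(1)] by linarith
    moreover have "\<alpha>' < x'" using i d(1) colf[OF \<alpha>'(1)] by linarith
    moreover have "y' < \<beta>" using i d(2) rowf[OF \<beta>(1)] by linarith
    moreover have "\<beta>' < y'" using i d(2) rowf[OF \<beta>'(1)] by linarith
    ultimately have "inside x' y'" by (simp add: inside_def)
    with vS show "v \<in> T" unfolding T_def x'_def y'_def by blast
  qed
  ultimately show ?thesis unfolding x0_def y0_def by blast
qed

text \<open>If \<open>S\<close> avoids the nets, it is trapped itself. Otherwise it owns them: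
  everything within 10 of a net cell belongs to \<open>S\<close>, and its complement is
  trapped.\<close>

lemma trapped:
  assumes S: "closed S" "S \<noteq> {}" "S \<noteq> V"
  shows "\<exists>T z. closed T \<and> z \<in> T \<and> (\<forall>t\<in>T. near h (kx z) (ky z) t)"
proof (cases "status S 0 0")
  case False
  have av: "\<not> near 10 x' y' u" if "net x y x' y'" "u \<in> S" for x y x' y' u
  proof
    assume "near 10 x' y' u"
    with that S have "touches S x' y'" by (auto simp: touches_def closed_def)
    with status_net[OF S(1) that(1)] status_const[OF S(1)] False show False by blast
  qed
  from S obtain z where z: "z \<in> S" by blast
  have "\<exists>T. closed T \<and> z \<in> T \<and> (\<forall>t\<in>T. near h (kx z) (ky z) t)"
    by (rule trapped_aux[OF S(1) z]) (erule av, assumption)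
  then show ?thesis by blast
next
  case True
  have cl: "closed (V - S)"
    using S adj_sym unfolding closed_def by blast
  have av: "\<not> near 10 x' y' u" if "net x y x' y'" "u \<in> V - S" for x y x' y' u
  proof
    assume "near 10 x' y' u"
    moreover from status_net[OF S(1) that(1)] status_const[OF S(1)] True
    obtain w where "w \<in> V" "near 10 x' y' w" "w \<in> S" unfolding touches_def by blast
    moreover have "good x' y'" using that(1) by (auto simp: net_def gcol_def grow_def)
    ultimately show False using good_joins[of x' y' S w u] S that by blast
  qed
  from S obtain z where z: "z \<in> V - S" by (auto simp: closed_def)
  have "\<exists>T. closed T \<and> z \<in> T \<and> (\<forall>t\<in>T. near h (kx z) (ky z) t)"
    by (rule trapped_aux[OF cl z]) (erule av, assumption)
  then show ?thesis by blast
qed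

end

subsection \<open>Edges and connectivity\<close>

definition edge :: "nat \<Rightarrow> real \<Rightarrow> (nat \<Rightarrow> real \<times> real) \<times> (nat set \<Rightarrow> bool) \<Rightarrow> nat \<Rightarrow> nat \<Rightarrow> bool" where
  "edge n r \<omega> u v \<longleftrightarrow> (u, v) \<in> parcs (grp_graph n r \<omega>)"

lemma edge_iff: "edge n r \<omega> u v \<longleftrightarrow>
    u < n \<and> v < n \<and> u \<noteq> v \<and> torus_dist (fst \<omega> u) (fst \<omega> v) \<le> r \<and> snd \<omega> {u, v}"
  by (auto simp: edge_def grp_graph_def graph_inter_def geometric_graph_def coin_graph_def)

lemma edge_sym: "edge n r \<omega> u v \<Longrightarrow> edge n r \<omega> v u"
  by (simp add: edge_iff torus_dist_commute insert_commute)

lemma pverts_grp_graph: "pverts (grp_graph n r \<omega>) = {..<n}"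
  by (simp add: grp_graph_def graph_inter_def geometric_graph_def coin_graph_def)

text \<open>These are exactly the unions of connected components.\<close>

definition edge_closed :: "nat \<Rightarrow> real \<Rightarrow> (nat \<Rightarrow> real \<times> real) \<times> (nat set \<Rightarrow> bool) \<Rightarrow> nat set \<Rightarrow> bool" where
  "edge_closed n r \<omega> S \<longleftrightarrow> S \<subseteq> {..<n} \<and> (\<forall>u\<in>S. \<forall>v\<in>{..<n}. edge n r \<omega> u v \<longrightarrow> v \<in> S)"

lemma edge_closed_compl: "edge_closed n r \<omega> S \<Longrightarrow> edge_closed n r \<omega> ({..<n} - S)"
  unfolding edge_closed_def using edge_sym[of n r \<omega>] by blast

text \<open>The set reachable from a vertex is closed, and a closed set contains whatever is
  reachable from it. The condition is a finite conjunction over vertex sets, which serves both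
  measurability and the union bounds; \<open>0 < n\<close> appears because the graph without
  vertices does not count as connected.\<close>

lemma connected_grp_graph_iff:
  "connected_graph (grp_graph n r \<omega>) \<longleftrightarrow> 0 < n \<and> (\<forall>S\<in>Pow {..<n}. edge_closed n r \<omega> S \<longrightarrow> S = {} \<or> S = {..<n})"
proof -
  let ?G = "with_proj (mk_symmetric (with_proj (grp_graph n r \<omega>)))"
  have E: "(u, v) \<in> arcs_ends ?G \<longleftrightarrow> edge n r \<omega> u v" for u v
    using edge_sym[of n r \<omega>]
    by (auto simp: arcs_ends_conv parcs_mk_symmetric edge_def)
  have conn: "connected_graph (grp_graph n r \<omega>) \<longleftrightarrow> 0 < n \<and> (\<forall>u<n. \<forall>v<n. u \<rightarrow>\<^sup>*\<^bsub>?G\<^esub> v)"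
    unfolding Digraph_Component.connected_def strongly_connected_def by (auto simp: pverts_grp_graph)
  have "(\<forall>u<n. \<forall>v<n. u \<rightarrow>\<^sup>*\<^bsub>?G\<^esub> v) \<longleftrightarrow> (\<forall>S\<in>Pow {..<n}. edge_closed n r \<omega> S \<longrightarrow> S = {} \<or> S = {..<n})"
  proof (intro iffI allI impI ballI)
    fix S assume a: "\<forall>u<n. \<forall>v<n. u \<rightarrow>\<^sup>*\<^bsub>?G\<^esub> v" and S: "edge_closed n r \<omega> S"
    have "v \<in> S" if "u \<in> S" "v < n" for u v
    proof -
      have "u < n" using S that by (auto simp: edge_closed_def)
      with a that have "(u, v) \<in> rtrancl_on (verts ?G) (arcs_ends ?G)" unfolding reachable_def by blast
      then show ?thesis
      proof (induction rule: rtrancl_on_induct)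
        case (step x y)
        then have "edge n r \<omega> x y" by (simp only: E)
        with S step show ?case unfolding edge_closed_def edge_iff by auto
      qed (use that in simp)
    qed
    then show "S = {} \<or> S = {..<n}" using S unfolding edge_closed_def by blast
  next
    fix u v assume a: "\<forall>S\<in>Pow {..<n}. edge_closed n r \<omega> S \<longrightarrow> S = {} \<or> S = {..<n}" and u: "u < n" "v < n"
    define S where "S = {w. w < n \<and> u \<rightarrow>\<^sup>*\<^bsub>?G\<^esub> w}"
    have "u \<in> S" using u by (simp add: S_def reachable_def pverts_grp_graph)
    moreover have "edge_closed n r \<omega> S"
      unfolding edge_closed_def
    proof (intro conjI ballI impI)
      fix w x assume "w \<in> S" "x \<in> {..<n}" "edge n r \<omega> w x"
      then show "x \<in> S" 
        unfolding S_def reachable_def E[symmetric]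
        by (auto simp: pverts_grp_graph intro: rtrancl_on_into_rtrancl_on)
    qed (auto simp: S_def)
    moreover have "S \<in> Pow {..<n}" by (auto simp: S_def)
    ultimately have "S = {..<n}" using a by blast
    with u show "u \<rightarrow>\<^sup>*\<^bsub>?G\<^esub> v" by (auto simp: S_def)
  qed
  with conn show ?thesis by simp
qed

lemma isolated_grp_graph_iff:
  "isolated_vertex (grp_graph n r \<omega>) v \<longleftrightarrow> v < n \<and> (\<forall>w\<in>{..<n}. \<not> edge n r \<omega> v w)"
proof -
  have "edge n r \<omega> v w \<Longrightarrow> w \<in> {..<n}" for w
    by (simp add: edge_iff)
  then show ?thesis
    unfolding isolated_vertex_def pverts_grp_graph edge_def[symmetric]
    using edge_sym[of n r \<omega>] by blast
qed

lemma isolated_imp_not_connected: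
  assumes "isolated_vertex (grp_graph n r \<omega>) v" "2 \<le> n"
  shows "\<not> connected_graph (grp_graph n r \<omega>)"
proof
  assume "connected_graph (grp_graph n r \<omega>)"
  moreover have "edge_closed n r \<omega> {v}"
    using assms by (auto simp: isolated_grp_graph_iff edge_closed_def)
  ultimately have "{v} = {..<n}"
    using assms unfolding connected_grp_graph_iff isolated_grp_graph_iff by auto
  then have "card {v} = card {..<n}" by simp
  with assms show False by simp
qed

subsection \<open>The grid\<close>

definition grid_x :: "nat \<Rightarrow> real \<times> real \<Rightarrow> int" where "grid_x N x = \<lfloor>real N * fst x\<rfloor>"
definition grid_y :: "nat \<Rightarrow> real \<times> real \<Rightarrow> int" where "grid_y N x = \<lfloor>real N * snd x\<rfloor>"

text \<open>The cells of the \<open>N \<times> N\<close> grid whose index differs from \<open>(i, j)\<close> by at most \<open>m\<close> in both coordinates,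
  modulo \<open>N\<close>; a single cell for \<open>m = 0\<close>.\<close>

definition block :: "nat \<Rightarrow> int \<Rightarrow> int \<Rightarrow> int \<Rightarrow> (real \<times> real) set" where
  "block N m i j = periodize ({of_int (i - m) / N ..< of_int (i + m + 1) / N} \<times> {of_int (j - m) / N ..< of_int (j + m + 1) / N})"

lemma block_iff:
  assumes "0 < N"
  shows "x \<in> block N m i j \<longleftrightarrow> (\<exists>a b. \<bar>grid_x N x + int N * a - i\<bar> \<le> m \<and> \<bar>grid_y N x + int N * b - j\<bar> \<le> m)"
proof -
  have N: "real N > 0" using assms by simp
  have ax: "t + of_int a \<in> {of_int (i - m) / N ..< of_int (i + m + 1) / N} \<longleftrightarrow> \<bar>\<lfloor>real N * t\<rfloor> + int N * a - i\<bar> \<le> m" for t a i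
  proof -
    have "\<lfloor>real N * t\<rfloor> + int N * a = \<lfloor>real N * (t + of_int a)\<rfloor>"
    proof -
      have "real N * (t + of_int a) = real N * t + of_int (int N * a)" by (simp add: algebra_simps)
      then show ?thesis by (simp only: floor_add_int)
    qed
    moreover have "t + of_int a \<in> {of_int (i - m) / N ..< of_int (i + m + 1) / N} \<longleftrightarrow>
        of_int (i - m) \<le> real N * (t + of_int a) \<and> real N * (t + of_int a) < of_int (i + m + 1)"
      using N by (simp only: atLeastLessThan_iff pos_divide_le_eq pos_less_divide_eq mult.commute)
    moreover have "\<dots> \<longleftrightarrow> i - m \<le> \<lfloor>real N * (t + of_int a)\<rfloor> \<and> \<lfloor>real N * (t + of_int a)\<rfloor> < i + m + 1"
      by (simp only: le_floor_iff floor_less_iff)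
    ultimately show ?thesis by auto
  qed
  show ?thesis
    unfolding block_def periodize_def grid_x_def grid_y_def
    by (cases x) (simp only: mem_Collect_eq add_Pair mem_Times_iff fst_conv snd_conv ax)
qed

lemma block_iff_coords:
  assumes "0 < N"
  shows "x \<in> block N m i j \<longleftrightarrow> (\<exists>a. \<bar>grid_x N x + int N * a - i\<bar> \<le> m) \<and> (\<exists>b. \<bar>grid_y N x + int N * b - j\<bar> \<le> m)"
  unfolding block_iff[OF assms] by blast

lemma sets_block[measurable]: "block N m i j \<in> sets borel"
  unfolding block_def by (intro sets_periodize borel_Times) auto

lemma emeasure_block:
  assumes "0 < N" "0 \<le> m" "2 * m + 1 \<le> int N"
  shows "emeasure unif_sq (block N m i j) = ennreal ((of_int (2 * m + 1) / N)\<^sup>2)"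
proof -
  let ?B = "{of_int (i - m) / N ..< of_int (i + m + 1) / N} \<times> {of_int (j - m) / N ..< of_int (j + m + 1) / real N}"
  have N: "real N > 0" using assms by simp
  have len: "of_int (i + m + 1) / real N - of_int (i - m) / real N = of_int (2 * m + 1) / real N" for i
    by (simp add: diff_divide_distrib[symmetric])
  have le1: "of_int (2 * m + 1) / real N \<le> 1"
  proof -
    have "of_int (2 * m + 1) \<le> real N" using assms by linarith
    then show ?thesis using N by (simp only: pos_divide_le_eq mult_1)
  qed
  have "packing ?B"
  proof (rule packing_box)
    fix z z' assume "z \<in> ?B" "z' \<in> ?B"
    then show "\<bar>fst z - fst z'\<bar> < 1 \<and> \<bar>snd z - snd z'\<bar> < 1"
      using len[of i] len[of j] le1 unfolding mem_Times_iff atLeastLessThan_iff by linarith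
  qed
  then have "emeasure unif_sq (block N m i j) = emeasure lborel ?B"
    unfolding block_def by (intro emeasure_periodize borel_Times) auto
  also have "\<dots> = emeasure lborel {of_int (i - m) / N ..< of_int (i + m + 1) / real N} * emeasure lborel {of_int (j - m) / N ..< of_int (j + m + 1) / real N}"
    unfolding lborel_prod[symmetric] by (intro lborel.emeasure_pair_measure_Times) auto
  also have "\<dots> = ennreal (of_int (2 * m + 1) / N) * ennreal (of_int (2 * m + 1) / N)"
  proof -
    have "0 \<le> of_int (2 * m + 1) / real N" using assms by (intro divide_nonneg_nonneg) auto
    then have "of_int (i - m) / real N \<le> of_int (i + m + 1) / real N" for i using len[of i] by linarith
    then show ?thesis by (simp only: emeasure_lborel_Ico len)
  qed
  also have "\<dots> = ennreal ((of_int (2 * m + 1) / N)\<^sup>2)"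
    using assms by (subst ennreal_mult'[symmetric]) (auto simp: power2_eq_square)
  finally show ?thesis .
qed

lemma measure_block: "0 < N \<Longrightarrow> 0 \<le> m \<Longrightarrow> 2 * m + 1 \<le> int N \<Longrightarrow>
    measure unif_sq (block N m i j) = (of_int (2 * m + 1) / N)\<^sup>2"
  by (simp add: measure_def emeasure_block)

lemma block_0_iff: "0 < N \<Longrightarrow> x \<in> block N 0 i j \<longleftrightarrow> int N dvd grid_x N x - i \<and> int N dvd grid_y N x - j"
proof -
  have "(\<exists>a. \<bar>g + int N * a - i\<bar> \<le> 0) \<longleftrightarrow> int N dvd g - i" for g i
  proof
    assume "\<exists>a. \<bar>g + int N * a - i\<bar> \<le> 0"
    then obtain a where "\<bar>g + int N * a - i\<bar> \<le> 0" by blast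
    then have "g - i = int N * (- a)" by simp
    then show "int N dvd g - i" by (metis dvd_triv_left)
  next
    assume "int N dvd g - i"
    then obtain k where "g - i = int N * k" by auto
    then have "\<bar>g + int N * (- k) - i\<bar> \<le> 0" by simp
    then show "\<exists>a. \<bar>g + int N * a - i\<bar> \<le> 0" by blast
  qed
  then show "0 < N \<Longrightarrow> ?thesis" by (simp add: block_iff del: abs_le_zero_iff)
qed

lemma block_0_unique:
  assumes "0 < N" "x \<in> block N 0 i j" "x \<in> block N 0 i' j'" "\<bar>i - i'\<bar> < int N" "\<bar>j - j'\<bar> < int N"
  shows "i = i' \<and> j = j'"
proof -
  have "int N dvd i - i'" "int N dvd j - j'"
    using assms dvd_diff[of "int N" "grid_x N x - i'" "grid_x N x - i"] dvd_diff[of "int N" "grid_y N x - j'" "grid_y N x - j"]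
    by (auto simp: block_0_iff)
  then have "i - i' = 0" "j - j' = 0"
    using assms dvd_imp_le_int[of "i - i'" "int N"] dvd_imp_le_int[of "j - j'" "int N"] by linarith+
  then show ?thesis by simp
qed

lemma block_mod: "0 < N \<Longrightarrow> block N m (i mod int N) (j mod int N) = block N m i j"
proof -
  assume N: "0 < N"
  have ex: "(\<exists>a. \<bar>g + int N * a - i mod int N\<bar> \<le> m) \<longleftrightarrow> (\<exists>a. \<bar>g + int N * a - i\<bar> \<le> m)" for g i
  proof -
    define k where "k = i div int N"
    have im: "i mod int N = i - int N * k" by (simp add: k_def minus_mult_div_eq_mod)
    have "\<bar>g + int N * a - i mod int N\<bar> \<le> m \<longleftrightarrow> \<bar>g + int N * (a + k) - i\<bar> \<le> m" for a
      unfolding im by (simp add: algebra_simps)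
    then have "(\<exists>a. \<bar>g + int N * a - i mod int N\<bar> \<le> m) \<longleftrightarrow> (\<exists>a. \<bar>g + int N * (a + k) - i\<bar> \<le> m)"
      by blast
    also have "\<dots> \<longleftrightarrow> (\<exists>a. \<bar>g + int N * a - i\<bar> \<le> m)"
      by (rule iffI) (blast, metis diff_add_cancel)
    finally show ?thesis .
  qed
  show ?thesis
    by (rule set_eqI) (simp only: block_iff_coords[OF N] ex)
qed

lemma block_self: "0 < N \<Longrightarrow> x \<in> block N 0 (grid_x N x) (grid_y N x)"
  by (simp add: block_0_iff)

text \<open>The factor 3/2 is a rational upper bound for the square root of 2.\<close>

lemma dist_le_coords:
  fixes x y :: "real \<times> real"
  assumes "\<bar>fst x - fst y\<bar> \<le> d" "\<bar>snd x - snd y\<bar> \<le> d"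
  shows "dist x y \<le> 3/2 * d"
proof -
  have d: "0 \<le> d" using assms by linarith
  have "(fst x - fst y)\<^sup>2 \<le> d\<^sup>2" "(snd x - snd y)\<^sup>2 \<le> d\<^sup>2"
    using assms d by (metis abs_le_square_iff abs_of_nonneg)+
  then have "(dist x y)\<^sup>2 \<le> 2 * d\<^sup>2"
    by (simp add: dist_prod_def dist_real_def)
  also have "\<dots> \<le> (3/2 * d)\<^sup>2" by (simp add: power2_eq_square)
  finally have "(dist x y)\<^sup>2 \<le> (3/2 * d)\<^sup>2" .
  then show ?thesis by (rule power2_le_imp_le) (use d in simp)
qed

lemma block_dist:
  assumes N: "0 < N" and x: "x \<in> block N m i j" and y: "y \<in> block N 0 i j"
  shows "torus_dist x y \<le> 3/2 * (of_int (m + 1) / N)"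
proof -
  obtain a b where ab: "x + shift a b \<in> {of_int (i - m) / N ..< of_int (i + m + 1) / N} \<times> {of_int (j - m) / N ..< of_int (j + m + 1) / real N}"
    using x unfolding block_def periodize_def mem_Collect_eq by (elim exE) (rule that)
  obtain c d where cd: "y + shift c d \<in> {of_int i / N ..< of_int (i + 1) / N} \<times> {of_int j / N ..< of_int (j + 1) / real N}"
    using y unfolding block_def periodize_def mem_Collect_eq diff_0_right add_0_right by (elim exE) (rule that)
  have len: "of_int (i + m + 1) / real N - of_int i / N = of_int (m + 1) / real N"
     "of_int (i + 1) / real N - of_int (i - m) / N = of_int (m + 1) / real N" for i
    by (simp_all add: diff_divide_distrib[symmetric])
  have "dist (x + shift a b) (y + shift c d) \<le> 3/2 * (of_int (m + 1) / N)"
    using ab cd len[of i] len[of j] unfolding mem_Times_iff atLeastLessThan_iff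
    by (intro dist_le_coords; linarith)
  then have "torus_dist (x + shift a b) (y + shift c d) \<le> 3/2 * (of_int (m + 1) / N)"
    using torus_dist_le_dist[of "x + shift a b" "y + shift c d" 0 0] by (simp add: zero_prod_def[symmetric])
  moreover have "torus_dist (x + shift a b) (y + shift c d) = torus_dist x y"
    by (metis torus_dist_plus_shift torus_dist_commute)
  ultimately show ?thesis by simp
qed

text \<open>Converse direction to \<open>block_dist\<close>: scaled coordinates move by at most
  \<open>m\<close>, and taking floors can add one more cell.\<close>

lemma dist_block:
  assumes N: "0 < N" and r: "r < 1/2" and d: "torus_dist x y \<le> r" and m: "real N * r \<le> of_int m"
  shows "y \<in> block N (m + 1) (grid_x N x) (grid_y N x)"
proof -
  obtain a b where ab: "dist x (y + shift a b) \<le> r" using d torus_dist_le_iff[OF r] by blast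
  have fl: "\<bar>\<lfloor>t\<rfloor> - \<lfloor>s\<rfloor>\<bar> \<le> m + 1" if "\<bar>s - t\<bar> \<le> of_int m" for s t :: real using that by linarith
  have c: "\<bar>\<lfloor>real N * t\<rfloor> + int N * a - \<lfloor>real N * s\<rfloor>\<bar> \<le> m + 1" if "\<bar>s - (t + of_int a)\<bar> \<le> r" for s t a
  proof -
    have "real N * (t + of_int a) = real N * t + of_int (int N * a)" by (simp add: algebra_simps)
    then have e: "\<lfloor>real N * t\<rfloor> + int N * a = \<lfloor>real N * (t + of_int a)\<rfloor>" by (simp only: floor_add_int)
    have "\<bar>real N * s - real N * (t + of_int a)\<bar> = real N * \<bar>s - (t + of_int a)\<bar>"
      by (simp add: abs_mult right_diff_distrib[symmetric])
    also have "\<dots> \<le> real N * r" using that by (intro mult_left_mono) auto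
    finally show ?thesis unfolding e using m by (intro fl) linarith
  qed
  have "\<bar>fst x - (fst y + of_int a)\<bar> \<le> r" "\<bar>snd x - (snd y + of_int b)\<bar> \<le> r"
    using coords_le_dist[of x "y + shift a b"] ab by auto
  from c[OF this(1)] c[OF this(2)] show ?thesis
    unfolding block_iff[OF N] grid_x_def grid_y_def by blast
qed

subsection \<open>Small components have two exposed half-discs\<close>

definition left_disc :: "real \<Rightarrow> real \<times> real \<Rightarrow> (real \<times> real) set" where
  "left_disc r x = periodize {z. dist x z \<le> r \<and> fst z < fst x}"

definition right_disc :: "real \<Rightarrow> real \<times> real \<Rightarrow> (real \<times> real) set" where
  "right_disc r x = periodize {z. dist x z \<le> r \<and> fst x < fst z}"

text \<open>Moved to a common centre, the two half-discs fill a disc up to its vertical diameter, a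
  null set. The centres \<open>x\<close> and \<open>y\<close> are arbitrary because area is
  translation invariant.\<close>

lemma half_disc_areas:
  assumes "0 \<le> r" "r < 1/2"
  shows "measure unif_sq (left_disc r x) + measure unif_sq (right_disc r y) = pi * r\<^sup>2"
proof -
  interpret unif: prob_space unif_sq by (rule prob_space_unif_sq)
  let ?L = "\<lambda>x. {z :: real \<times> real. dist x z \<le> r \<and> fst z < fst x}"
  let ?R = "\<lambda>x. {z :: real \<times> real. dist x z \<le> r \<and> fst x < fst z}"
  have s[measurable]: "?L x \<in> sets borel" "?R x \<in> sets borel" for x by measurable
  have sub: "?L x \<subseteq> cball x r" "?R x \<subseteq> cball x r" for x by auto
  have pk: "packing (?L x)" "packing (?R x)" for x
    using packing_cball[OF assms(2), of x] sub[of x] unfolding packing_def by blast+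
  have "emeasure lborel (?R y) = emeasure lborel (?R x)"
  proof -
    have "?R y = (\<lambda>z. z + (x - y)) -` ?R x"
      by (auto simp: dist_norm algebra_simps)
    with emeasure_lborel_translate[OF s(2)[of x], of "x - y"] show ?thesis by (simp only:)
  qed
  then have "emeasure lborel (?L x) + emeasure lborel (?R y) = emeasure lborel (?L x) + emeasure lborel (?R x)"
    by (simp only:)
  also have "\<dots> = emeasure lborel (?L x \<union> ?R x)"
    by (subst plus_emeasure) auto
  also have "\<dots> = emeasure lborel (cball x r)"
  proof -
    define Z where "Z = {fst x} \<times> (UNIV :: real set)"
    have Z: "Z \<in> null_sets lborel"
      unfolding Z_def null_sets_def
      by (auto simp: lborel_prod[symmetric] lborel.emeasure_pair_measure_Times)
    have eq: "(?L x \<union> ?R x) \<union> (Z \<inter> cball x r) = cball x r"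
      by (auto simp: Z_def)
    have "Z \<inter> cball x r \<in> null_sets lborel" using Z by (auto intro: null_set_Int2)
    then have "emeasure lborel ((?L x \<union> ?R x) \<union> (Z \<inter> cball x r)) = emeasure lborel (?L x \<union> ?R x)"
      by (intro emeasure_Un_null_set) simp_all
    then show ?thesis unfolding eq by (rule sym)
  qed
  also have "\<dots> = ennreal (pi * r\<^sup>2)" by (rule emeasure_disc[OF assms(1)])
  finally have "emeasure unif_sq (left_disc r x) + emeasure unif_sq (right_disc r y) = ennreal (pi * r\<^sup>2)"
    using pk s by (simp add: left_disc_def right_disc_def emeasure_periodize)
  then show ?thesis
    using assms by (simp add: unif.emeasure_eq_measure ennreal_plus[symmetric] del: ennreal_plus)
qed

text \<open>The leftmost vertex \<open>v\<close> of a trapped component sees no neighbour in its left half-disc, nor does the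
  rightmost vertex \<open>w\<close> in its right half-disc.\<close>

definition ahead :: "real \<Rightarrow> real \<times> real \<Rightarrow> (real \<times> real) set" where
  "ahead \<rho> x = periodize {z. fst x \<le> fst z \<and> fst z \<le> fst x + \<rho> \<and> \<bar>snd z - snd x\<bar> \<le> \<rho>}"

definition extremal_pair :: "nat \<Rightarrow> real \<Rightarrow> real \<Rightarrow> (nat \<Rightarrow> real \<times> real) \<times> (nat set \<Rightarrow> bool) \<Rightarrow> nat \<Rightarrow> nat \<Rightarrow> bool" where
  "extremal_pair n r \<rho> \<omega> v w \<longleftrightarrow> fst \<omega> w \<in> ahead \<rho> (fst \<omega> v) \<and>
     (\<forall>u\<in>{..<n} - {v, w}. (fst \<omega> u \<in> left_disc r (fst \<omega> v) \<longrightarrow> \<not> snd \<omega> {u, v}) \<and>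
                        (fst \<omega> u \<in> right_disc r (fst \<omega> w) \<longrightarrow> \<not> snd \<omega> {u, w}))"

lemma shift_unique:
  assumes "\<bar>fst (y + shift a b) - fst (y + shift c d)\<bar> < 1" "\<bar>snd (y + shift a b) - snd (y + shift c d)\<bar> < 1"
  shows "a = c \<and> b = d"
proof -
  have "\<bar>real_of_int a - of_int c\<bar> < 1" "\<bar>real_of_int b - of_int d\<bar> < 1"
    using assms by auto
  then show ?thesis by linarith
qed

text \<open>A closed set inside one box can be lifted to the plane, where leftmost and rightmost
  make sense. A neighbour in the left half-disc of the leftmost vertex would belong to the set and
  have its lift further left; the right side is symmetric.\<close>

lemma ex_extremal_pair:
  assumes T: "edge_closed n r \<omega> T" "z \<in> T" and N: "0 < N" and h: "0 \<le> h"
    and trap: "\<And>t. t \<in> T \<Longrightarrow> fst \<omega> t \<in> block N h i j"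
    and small: "of_int (2 * h + 1) / real N + r < 1" and r: "r < 1/2"
  shows "\<exists>v\<in>{..<n}. \<exists>w\<in>{..<n}. extremal_pair n r (of_int (2 * h + 1) / N) \<omega> v w"
proof -
  define \<rho> where "\<rho> = of_int (2 * h + 1) / real N"
  define B where "B = {of_int (i - h) / N ..< of_int (i + h + 1) / N} \<times> {of_int (j - h) / N ..< of_int (j + h + 1) / real N}"
  have len: "of_int (i + h + 1) / real N - of_int (i - h) / real N = \<rho>" for i
    by (simp add: diff_divide_distrib[symmetric] \<rho>_def)
  have B: "\<bar>fst x - fst y\<bar> < \<rho> \<and> \<bar>snd x - snd y\<bar> < \<rho>" if "x \<in> B" "y \<in> B" for x y
    using that len[of i] len[of j] unfolding B_def mem_Times_iff atLeastLessThan_iff by linarith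
  have "\<exists>a b. fst \<omega> t + shift a b \<in> B" if "t \<in> T" for t
    using trap[OF that] unfolding block_def periodize_def B_def by simp
  then obtain fa fb where f: "\<And>t. t \<in> T \<Longrightarrow> fst \<omega> t + shift (fa t) (fb t) \<in> B"
    by metis
  define L where "L t = fst \<omega> t + shift (fa t) (fb t)" for t
  have LB: "L t \<in> B" if "t \<in> T" for t using f[OF that] by (simp add: L_def)
  have Tn: "T \<subseteq> {..<n}" "finite T" "T \<noteq> {}" using T finite_subset by (auto simp: edge_closed_def)
  define v where "v = arg_min_on (\<lambda>t. fst (L t)) T"
  define w where "w = arg_min_on (\<lambda>t. - fst (L t)) T"
  have v: "v \<in> T" "\<And>t. t \<in> T \<Longrightarrow> fst (L v) \<le> fst (L t)"
    unfolding v_def using Tn arg_min_if_finite(1) arg_min_least by (metis (no_types, lifting))+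
  have w: "w \<in> T" "\<And>t. t \<in> T \<Longrightarrow> fst (L t) \<le> fst (L w)"
  proof -
    show "w \<in> T" unfolding w_def using Tn arg_min_if_finite(1) by metis
    fix t assume "t \<in> T"
    from arg_min_least[OF Tn(2,3) this, of "\<lambda>t. - fst (L t)"] show "fst (L t) \<le> fst (L w)"
      by (simp add: w_def)
  qed
  \<comment> \<open>The translate of a neighbour \<open>u\<close> that lies within \<open>r\<close>
    of \<open>L t\<close> must be the chosen lift \<open>L u\<close>: the width of the box plus
    \<open>r\<close> is below 1, which leaves no room for two translates of the same point.\<close>
  have lift: "u \<in> T \<and> L u - L t = x - fst \<omega> t"
    if t: "t \<in> T" and u: "u < n" "u \<noteq> t" "snd \<omega> {u, t}" and x: "x = fst \<omega> u + shift a b" "dist (fst \<omega> t) x \<le> r" for t u x a b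
  proof -
    have "torus_dist (fst \<omega> t) (fst \<omega> u) \<le> r"
      using x torus_dist_le_iff[OF r] by blast
    then have "edge n r \<omega> t u"
      using u t Tn by (auto simp: edge_iff insert_commute)
    then have uT: "u \<in> T" using T t u unfolding edge_closed_def by blast
    define x' where "x' = fst \<omega> u + shift (a + fa t) (b + fb t)"
    have x': "x' = x + shift (fa t) (fb t)" by (simp only: x'_def x shift_add)
    have d: "dist (L t) x' \<le> r" using x by (simp add: L_def x' dist_norm)
    have "\<bar>fst x' - fst (L u)\<bar> < 1 \<and> \<bar>snd x' - snd (L u)\<bar> < 1"
      using coords_le_dist[of "L t" x'] d B[OF LB[OF t] LB[OF uT]] small unfolding \<rho>_def[symmetric] by linarith
    then have "a + fa t = fa u \<and> b + fb t = fb u"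
      unfolding x'_def L_def by (intro shift_unique) auto
    then have "x' = L u" by (simp add: x'_def L_def)
    then have "L u - L t = x + shift (fa t) (fb t) - L t" using x' by simp
    also have "\<dots> = x - fst \<omega> t" by (simp add: L_def)
    finally show ?thesis using uT by blast
  qed
  have "extremal_pair n r \<rho> \<omega> v w"
    unfolding extremal_pair_def
  proof (intro conjI ballI impI notI)
    have "fst \<omega> w + shift (fa w - fa v) (fb w - fb v) = L w - L v + fst \<omega> v"
      by (cases "fst \<omega> w"; cases "fst \<omega> v") (simp add: L_def)
    moreover have "fst (L v) \<le> fst (L w)" using v w by blast
    ultimately show "fst \<omega> w \<in> ahead \<rho> (fst \<omega> v)"
      using B[OF LB[OF v(1)] LB[OF w(1)]] unfolding ahead_def periodize_def
      by (intro CollectI exI[of _ "fa w - fa v"] exI[of _ "fb w - fb v"]) auto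
  next
    fix u assume u: "u \<in> {..<n} - {v, w}" "fst \<omega> u \<in> left_disc r (fst \<omega> v)" "snd \<omega> {u, v}"
    then obtain a b where ab: "dist (fst \<omega> v) (fst \<omega> u + shift a b) \<le> r" "fst (fst \<omega> u + shift a b) < fst (fst \<omega> v)"
      unfolding left_disc_def periodize_def by blast
    from lift[OF v(1) _ _ u(3) refl ab(1)] u have uT: "u \<in> T" and e: "L u - L v = fst \<omega> u + shift a b - fst \<omega> v"
      by auto
    have "fst (L u) - fst (L v) = fst (fst \<omega> u + shift a b) - fst (fst \<omega> v)"
      using arg_cong[OF e, of fst] by (simp only: fst_diff)
    with v(2)[OF uT] ab show False by linarith
  next
    fix u assume u: "u \<in> {..<n} - {v, w}" "fst \<omega> u \<in> right_disc r (fst \<omega> w)" "snd \<omega> {u, w}"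
    then obtain a b where ab: "dist (fst \<omega> w) (fst \<omega> u + shift a b) \<le> r" "fst (fst \<omega> w) < fst (fst \<omega> u + shift a b)"
      unfolding right_disc_def periodize_def by blast
    from lift[OF w(1) _ _ u(3) refl ab(1)] u have uT: "u \<in> T" and e: "L u - L w = fst \<omega> u + shift a b - fst \<omega> w"
      by auto
    have "fst (L u) - fst (L w) = fst (fst \<omega> u + shift a b) - fst (fst \<omega> w)"
      using arg_cong[OF e, of fst] by (simp only: fst_diff)
    with w(2)[OF uT] ab show False by linarith
  qed
  then show ?thesis using v w Tn unfolding \<rho>_def by blast
qed

lemma pred_periodize:
  assumes "\<And>a b. Measurable.pred M (\<lambda>z. g z + shift a b \<in> Z z)"
  shows "Measurable.pred M (\<lambda>z. g z \<in> periodize (Z z))"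
  unfolding periodize_def mem_Collect_eq by (intro pred_intros_countable assms)

lemma
  assumes [measurable]: "f \<in> borel_measurable M" "g \<in> borel_measurable M"
  shows pred_ahead: "Measurable.pred M (\<lambda>z. g z \<in> ahead \<rho> (f z))"
    and pred_left_disc: "Measurable.pred M (\<lambda>z. g z \<in> left_disc r (f z))"
    and pred_right_disc: "Measurable.pred M (\<lambda>z. g z \<in> right_disc r (f z))"
  unfolding ahead_def left_disc_def right_disc_def by (rule pred_periodize, measurable)+

text \<open>\<open>prob_avoid\<close> with \<open>v\<close> and \<open>w\<close> exposed and two
  regions, indexed by \<open>bool\<close>, each tied to a single coin. The areas always add up to pi
  r^2, so only the event that \<open>w\<close> lies ahead of \<open>v\<close>, a rectangle of area 2
  \<open>\<rho>\<^sup>2\<close>, depends on the positions.\<close>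

lemma prob_extremal_pair:
  assumes p: "0 \<le> p" "p \<le> 1" and vw: "v < n" "w < n" and r: "0 \<le> r" and \<rho>: "0 \<le> \<rho>" and small: "2 * r + \<rho> < 1"
    and small2: "2 * \<rho> < 1"
  shows "Measurable.pred (grp_space n p) (\<lambda>\<omega>. extremal_pair n r \<rho> \<omega> v w)"
    and "emeasure (grp_space n p) {\<omega> \<in> space (grp_space n p). extremal_pair n r \<rho> \<omega> v w} \<le>
      ennreal ((1 - pi * r\<^sup>2 * p) ^ (n - card {v, w}) * (if v = w then 1 else 2 * \<rho>\<^sup>2))"
proof -
  interpret unif: prob_space unif_sq by (rule prob_space_unif_sq)
  let ?U = "{v, w}"
  let ?M = "PiM ?U (\<lambda>_. unif_sq)"
  define Q where "Q x \<longleftrightarrow> x w \<in> ahead \<rho> (x v)" for x :: "nat \<Rightarrow> real \<times> real"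
  define R where "R c x = (if c then right_disc r (x w) else left_disc r (x v))" for c and x :: "nat \<Rightarrow> real \<times> real"
  define T where "T c = (if c then {w} else {v})" for c
  have cm: "(\<lambda>x. x v) \<in> ?M \<rightarrow>\<^sub>M borel" "(\<lambda>x. x w) \<in> ?M \<rightarrow>\<^sub>M borel"
    unfolding measurable_unif_sq_iff[symmetric] by (auto intro: measurable_component_singleton)
  have s2: "snd \<in> ?M \<Otimes>\<^sub>M unif_sq \<rightarrow>\<^sub>M borel" unfolding measurable_unif_sq_iff[symmetric] by (rule measurable_snd)
  have c1: "(\<lambda>z. fst z v) \<in> ?M \<Otimes>\<^sub>M unif_sq \<rightarrow>\<^sub>M borel" "(\<lambda>z. fst z w) \<in> ?M \<Otimes>\<^sub>M unif_sq \<rightarrow>\<^sub>M borel"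
    by (rule measurable_compose[OF measurable_fst cm(1)]) (rule measurable_compose[OF measurable_fst cm(2)])
  have Qm: "Measurable.pred ?M Q"
    unfolding Q_def by (rule pred_ahead[OF cm])
  have Rm: "Measurable.pred (?M \<Otimes>\<^sub>M unif_sq) (\<lambda>(x, y). y \<in> R c x)" for c
    unfolding case_prod_beta R_def
    by (cases c) (simp_all only: if_True if_False pred_left_disc[OF c1(1) s2] pred_right_disc[OF c1(2) s2])
  \<comment> \<open>One half-disc lies strictly left of \<open>v\<close>, the other strictly right
    of \<open>w\<close>, and \<open>w\<close> is not left of \<open>v\<close>. The bound on 2 r +
    \<rho> excludes a meeting on the far side of the torus.\<close>
  have dj: "disjoint_family_on (\<lambda>c. R c x) UNIV" if Qx: "Q x" for x
  proof -
    obtain a b where ab: "fst (x v) \<le> fst (x w + shift a b)" "fst (x w + shift a b) \<le> fst (x v) + \<rho>"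
        "\<bar>snd (x w + shift a b) - snd (x v)\<bar> \<le> \<rho>"
      using Qx unfolding Q_def ahead_def periodize_def by blast
    have False if y: "y \<in> left_disc r (x v)" "y \<in> right_disc r (x w)" for y
    proof -
      obtain c d where cd: "dist (x v) (y + shift c d) \<le> r" "fst (y + shift c d) < fst (x v)"
        using y unfolding left_disc_def periodize_def by blast
      obtain c' d' where cd': "dist (x w) (y + shift c' d') \<le> r" "fst (x w) < fst (y + shift c' d')"
        using y unfolding right_disc_def periodize_def by blast
      have "dist (x w + shift a b) (y + shift (c' + a) (d' + b)) \<le> r"
        using cd'(1) by (simp only: shift_add[symmetric] dist_add_cancel2)
      moreover have gt: "fst (x w + shift a b) < fst (y + shift (c' + a) (d' + b))"
        using cd'(2) by simp
      ultimately have "c' + a = c \<and> d' + b = d"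
        using coords_le_dist[of "x v" "y + shift c d"] coords_le_dist[of "x w + shift a b" "y + shift (c' + a) (d' + b)"] cd(1) ab small
        by (intro shift_unique[of y]; linarith)
      with gt cd(2) ab(1) show False by simp
    qed
    then show ?thesis by (auto simp: disjoint_family_on_def R_def UNIV_bool)
  qed
  have s: "pi * r\<^sup>2 * p \<le> (\<Sum>c\<in>UNIV. measure unif_sq (R c x) * p ^ card (T c))" for x
    using half_disc_areas[OF r, of "x v" "x w"] small r \<rho>
    by (simp add: UNIV_bool R_def T_def distrib_right[symmetric] add.commute)
  have ev: "extremal_pair n r \<rho> \<omega> v w \<longleftrightarrow> Q (restrict (fst \<omega>) ?U) \<and>
      (\<forall>u\<in>{..<n} - ?U. \<forall>c\<in>UNIV. fst \<omega> u \<in> R c (restrict (fst \<omega>) ?U) \<longrightarrow> \<not> (\<forall>t\<in>T c. snd \<omega> {u, t}))" for \<omega>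
    unfolding extremal_pair_def Q_def by (auto simp: R_def T_def UNIV_bool)
  note av = prob_avoid[where R = R and T = T and I = UNIV and U = ?U and Q = Q and n = n and p = p and s = "pi * r\<^sup>2 * p",
      OF p _ _ _ Qm Rm dj s]
  show "Measurable.pred (grp_space n p) (\<lambda>\<omega>. extremal_pair n r \<rho> \<omega> v w)"
    unfolding ev using vw by (intro av(1)) (auto simp: T_def)
  have "emeasure (grp_space n p) {\<omega> \<in> space (grp_space n p). extremal_pair n r \<rho> \<omega> v w} \<le>
      ennreal ((1 - pi * r\<^sup>2 * p) ^ (n - card ?U)) * emeasure ?M {x \<in> space ?M. Q x}"
    unfolding ev using vw by (intro av(2)) (auto simp: T_def)
  also have "emeasure ?M {x \<in> space ?M. Q x} \<le> ennreal (if v = w then 1 else 2 * \<rho>\<^sup>2)"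
  proof (cases "v = w")
    case True
    interpret prob_space ?M by (intro prob_space_PiM prob_space_unif_sq)
    show ?thesis using True emeasure_le_1 by simp
  next
    case False
    have UV: "{v} \<subseteq> ?U" "?U - {v} = {w}" using False by auto
    have ar: "emeasure unif_sq (ahead \<rho> x) = ennreal (2 * \<rho>\<^sup>2)" for x
    proof -
      let ?B = "{fst x..fst x + \<rho>} \<times> {snd x - \<rho>..snd x + \<rho>}"
      have B: "{z. fst x \<le> fst z \<and> fst z \<le> fst x + \<rho> \<and> \<bar>snd z - snd x\<bar> \<le> \<rho>} = ?B"
        by (auto simp: abs_le_iff)
      have "packing ?B"
      proof (rule packing_box)
        fix z z' assume "z \<in> ?B" "z' \<in> ?B"
        then show "\<bar>fst z - fst z'\<bar> < 1 \<and> \<bar>snd z - snd z'\<bar> < 1"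
          using small2 \<rho> unfolding mem_Times_iff atLeastAtMost_iff by linarith
      qed
      then have "emeasure unif_sq (ahead \<rho> x) = emeasure lborel ?B"
        unfolding ahead_def B by (intro emeasure_periodize borel_Times) auto
      also have "\<dots> = ennreal \<rho> * ennreal (2 * \<rho>)"
        unfolding lborel_prod[symmetric] using \<rho> by (subst lborel.emeasure_pair_measure_Times) auto
      also have "\<dots> = ennreal (2 * \<rho>\<^sup>2)"
        using \<rho> by (simp add: ennreal_mult[symmetric] power2_eq_square)
      finally show ?thesis .
    qed
    let ?M1 = "PiM {v} (\<lambda>_. unif_sq)"
    interpret M1: prob_space ?M1 by (intro prob_space_PiM prob_space_unif_sq)
    have ind: "(\<lambda>(x, y). indicator (ahead \<rho> (x v)) y :: ennreal) \<in> borel_measurable (?M1 \<Otimes>\<^sub>M unif_sq)"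
    proof -
      have c1: "(\<lambda>z. fst z v) \<in> ?M1 \<Otimes>\<^sub>M unif_sq \<rightarrow>\<^sub>M borel"
        unfolding measurable_unif_sq_iff[symmetric]
        by (rule measurable_compose[OF measurable_fst]) (auto intro: measurable_component_singleton)
      have c2: "snd \<in> ?M1 \<Otimes>\<^sub>M unif_sq \<rightarrow>\<^sub>M borel"
        unfolding measurable_unif_sq_iff[symmetric] by (rule measurable_snd)
      have "Measurable.pred (?M1 \<Otimes>\<^sub>M unif_sq) (\<lambda>z. snd z \<in> ahead \<rho> (fst z v))"
        by (rule pred_ahead[OF c1 c2])
      then show ?thesis
        unfolding case_prod_beta by (intro borel_measurable_indicator') (simp add: pred_def)
    qed
    have "emeasure ?M {x \<in> space ?M. Q x} = (\<integral>\<^sup>+x. indicator {x \<in> space ?M. Q x} x \<partial>?M)"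
      using Qm by (simp add: pred_def)
    also have "\<dots> = (\<integral>\<^sup>+X. 1 * (\<Prod>u\<in>?U - {v}. indicator (ahead \<rho> (restrict X {v} v)) (X u)) \<partial>?M)"
      unfolding UV by (intro nn_integral_cong) (auto simp: Q_def indicator_def)
    also have "\<dots> = (\<integral>\<^sup>+x. 1 * (\<integral>\<^sup>+y. indicator (ahead \<rho> (x v)) y \<partial>unif_sq) ^ card (?U - {v}) \<partial>?M1)"
      by (rule nn_integral_PiM_split[OF _ UV(1) prob_space_unif_sq _ ind]) auto
    also have "\<dots> = (\<integral>\<^sup>+x. ennreal (2 * \<rho>\<^sup>2) \<partial>?M1)"
    proof (intro nn_integral_cong)
      fix x :: "nat \<Rightarrow> real \<times> real"
      have "ahead \<rho> (x v) \<in> sets unif_sq"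
        unfolding ahead_def sets_unif_sq by (intro sets_periodize) measurable
      then show "1 * (\<integral>\<^sup>+y. indicator (ahead \<rho> (x v)) y \<partial>unif_sq) ^ card (?U - {v}) = ennreal (2 * \<rho>\<^sup>2)"
        unfolding UV by (simp add: ar)
    qed
    also have "\<dots> = ennreal (2 * \<rho>\<^sup>2)"
      using M1.emeasure_space_1 by simp
    finally show ?thesis using False by simp
  qed
  finally show "emeasure (grp_space n p) {\<omega> \<in> space (grp_space n p). extremal_pair n r \<rho> \<omega> v w} \<le>
      ennreal ((1 - pi * r\<^sup>2 * p) ^ (n - card {v, w}) * (if v = w then 1 else 2 * \<rho>\<^sup>2))"
    by (simp add: ennreal_mult'' mult_left_mono split: if_splits)
qed

subsection \<open>Bad cells\<close>

text \<open>\<open>T = {}\<close> makes an empty cell bad; \<open>T = {u, w}\<close> asks for a common neighbour of \<open>u\<close> and \<open>w\<close>, which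
  are both within \<open>r\<close> of the whole cell if \<open>N r\<close> is at least 33/2.\<close>

definition bad_cell :: "nat \<Rightarrow> nat \<Rightarrow> (nat \<Rightarrow> real \<times> real) \<times> (nat set \<Rightarrow> bool) \<Rightarrow> int \<Rightarrow> int \<Rightarrow> bool" where
  "bad_cell n N \<omega> i j \<longleftrightarrow> (\<exists>T\<in>Pow {..<n}. card T \<le> 2 \<and> (\<forall>t\<in>T. fst \<omega> t \<in> block N 10 i j) \<and>
     (\<forall>v\<in>{..<n} - T. fst \<omega> v \<in> block N 0 i j \<longrightarrow> \<not> (\<forall>t\<in>T. snd \<omega> {v, t})))"

lemma bad_cell_mod: "0 < N \<Longrightarrow> bad_cell n N \<omega> (i mod int N) (j mod int N) = bad_cell n N \<omega> i j"
  unfolding bad_cell_def by (simp add: block_mod)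

text \<open>Offsets are collected instead of cells: cells of the plane repeat modulo
  \<open>N\<close>, while offsets range over the same finite square for every window, so their
  possible sets can be enumerated once.\<close>

definition bad_window :: "nat \<Rightarrow> nat \<Rightarrow> int \<Rightarrow> (nat \<Rightarrow> real \<times> real) \<times> (nat set \<Rightarrow> bool) \<Rightarrow> int \<Rightarrow> int \<Rightarrow> (int \<times> int) set" where
  "bad_window n N h \<omega> i j = {(a, b) \<in> {- h..h} \<times> {- h..h}. bad_cell n N \<omega> (i + a) (j + b)}"

lemma finite_bad_window: "finite (bad_window n N h \<omega> i j)"
  unfolding bad_window_def by (rule finite_subset[of _ "{- h..h} \<times> {- h..h}"]) auto

text \<open>Interpretation of \<open>trap\<close> with \<open>closed\<close> as unions of
  components. The range for N r is where the constants 10 and 20 of the locale come from: points in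
  a cell and in a block of radius 10 around it are at distance at most 33 / (2 N), hence at most r,
  and N r at most 19 lets an edge span at most 20 cells.\<close>

lemma trapped_component:
  assumes N: "0 < N" and r: "r < 1/2" and Nr: "33/2 \<le> real N * r" "real N * r \<le> 19"
    and h: "int J + 20 \<le> h"
    and few: "\<And>i j. i \<in> {0..<int N} \<Longrightarrow> j \<in> {0..<int N} \<Longrightarrow> card (bad_window n N h \<omega> i j) < J"
    and n: "0 < n" and nc: "\<not> connected_graph (grp_graph n r \<omega>)"
  shows "\<exists>T z. edge_closed n r \<omega> T \<and> z \<in> T \<and>
     (\<forall>t\<in>T. fst \<omega> t \<in> block N h (grid_x N (fst \<omega> z)) (grid_y N (fst \<omega> z)))"
proof -
  let ?kx = "\<lambda>v. grid_x N (fst \<omega> v)" and ?ky = "\<lambda>v. grid_y N (fst \<omega> v)"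
  let ?good = "\<lambda>i j. \<not> bad_cell n N \<omega> i j"
  have close: "torus_dist x y \<le> r" if "x \<in> block N 10 i j" "y \<in> block N 0 i j" for x y i j
  proof -
    have "torus_dist x y \<le> 3/2 * (of_int (10 + 1) / real N)" using block_dist[OF N that] .
    also have "\<dots> \<le> r" using Nr(1) N by (simp add: field_simps)
    finally show ?thesis .
  qed
  interpret trap "{..<n}" "edge n r \<omega>" ?kx ?ky "int N" h J ?good
    "\<lambda>m x y v. fst \<omega> v \<in> block N m x y" "edge_closed n r \<omega>"
  proof unfold_locales
    show "fst \<omega> v \<in> block N m x y \<longleftrightarrow> (\<exists>a b. \<bar>?kx v + int N * a - x\<bar> \<le> m \<and> \<bar>?ky v + int N * b - y\<bar> \<le> m)" for m x y v
      by (rule block_iff[OF N])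
    show "edge_closed n r \<omega> S \<longleftrightarrow> S \<subseteq> {..<n} \<and> (\<forall>u\<in>S. \<forall>v\<in>{..<n}. edge n r \<omega> u v \<longrightarrow> v \<in> S)" for S
      by (rule edge_closed_def)
    show "edge n r \<omega> u v \<Longrightarrow> edge n r \<omega> v u" for u v by (rule edge_sym)
    show "fst \<omega> v \<in> block N 20 (?kx u) (?ky u)" if "edge n r \<omega> u v" for u v
      using dist_block[OF N r, of "fst \<omega> u" "fst \<omega> v" 19] that Nr by (simp add: edge_iff)
    show "\<exists>v\<in>{..<n}. fst \<omega> v \<in> block N 0 x y" if "\<not> bad_cell n N \<omega> x y" for x y
      using that unfolding bad_cell_def by (force dest: bspec[of _ _ "{}"])
    show "w \<in> S" if g: "\<not> bad_cell n N \<omega> x y" and S: "edge_closed n r \<omega> S" and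
      u: "u \<in> {..<n}" "fst \<omega> u \<in> block N 10 x y" "u \<in> S" and w: "w \<in> {..<n}" "fst \<omega> w \<in> block N 10 x y" for x y S u w
    proof -
      have "{u, w} \<in> Pow {..<n}" "card {u, w} \<le> 2" "\<forall>t\<in>{u, w}. fst \<omega> t \<in> block N 10 x y"
        using u w by (auto simp: card_insert_if)
      note uw = this
      have "\<not> (\<forall>v\<in>{..<n} - {u, w}. fst \<omega> v \<in> block N 0 x y \<longrightarrow> \<not> (\<forall>t\<in>{u, w}. snd \<omega> {v, t}))"
      proof
        assume "\<forall>v\<in>{..<n} - {u, w}. fst \<omega> v \<in> block N 0 x y \<longrightarrow> \<not> (\<forall>t\<in>{u, w}. snd \<omega> {v, t})"
        with uw have "bad_cell n N \<omega> x y" unfolding bad_cell_def by (intro bexI[of _ "{u, w}"] conjI)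
        with g show False by contradiction
      qed
      then obtain v where v: "v \<in> {..<n} - {u, w}" "fst \<omega> v \<in> block N 0 x y" "snd \<omega> {v, u}" "snd \<omega> {v, w}"
        by auto
      have "edge n r \<omega> u v" "edge n r \<omega> v w"
        using u w v close[OF u(2) v(2)] close[OF w(2) v(2)]
        by (auto simp: edge_iff insert_commute torus_dist_commute[of "fst \<omega> v"])
      with S u(3) v(1) w(1) show "w \<in> S" unfolding edge_closed_def by blast
    qed
    show "card {(x', y'). \<bar>x' - x\<bar> \<le> h \<and> \<bar>y' - y\<bar> \<le> h \<and> \<not> ?good x' y'} < J" for x y
    proof -
      have "{(x', y'). \<bar>x' - x\<bar> \<le> h \<and> \<bar>y' - y\<bar> \<le> h \<and> \<not> ?good x' y'} \<subseteq>
          (\<lambda>(a, b). (x + a, y + b)) ` bad_window n N h \<omega> (x mod int N) (y mod int N)"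
      proof
        fix c assume "c \<in> {(x', y'). \<bar>x' - x\<bar> \<le> h \<and> \<bar>y' - y\<bar> \<le> h \<and> \<not> ?good x' y'}"
        then obtain x' y' where c: "c = (x', y')" and a: "\<bar>x' - x\<bar> \<le> h" "\<bar>y' - y\<bar> \<le> h" "bad_cell n N \<omega> x' y'"
          by auto
        \<comment> \<open>Badness is periodic modulo \<open>N\<close>, so the window at any integer
          cell is a translate of one that the hypothesis \<open>few\<close> covers.\<close>
        have "bad_cell n N \<omega> (x mod int N + (x' - x)) (y mod int N + (y' - y))"
          using a(3) by (subst bad_cell_mod[OF N, symmetric]) (simp add: mod_simps bad_cell_mod[OF N])
        then have "(x' - x, y' - y) \<in> bad_window n N h \<omega> (x mod int N) (y mod int N)"
          using a by (auto simp: bad_window_def)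
        then show "c \<in> (\<lambda>(a, b). (x + a, y + b)) ` bad_window n N h \<omega> (x mod int N) (y mod int N)"
          by (rule rev_image_eqI) (simp add: c)
      qed
      then have "card {(x', y'). \<bar>x' - x\<bar> \<le> h \<and> \<bar>y' - y\<bar> \<le> h \<and> \<not> ?good x' y'} \<le>
          card (bad_window n N h \<omega> (x mod int N) (y mod int N))"
        using finite_bad_window surj_card_le by blast
      also have "\<dots> < J" using N by (intro few) auto
      finally show ?thesis .
    qed
    show "int J + 20 \<le> h" by (rule h)
  qed
  from nc n obtain S where "edge_closed n r \<omega> S" "S \<noteq> {}" "S \<noteq> {..<n}"
    unfolding connected_grp_graph_iff by blast
  from trapped[OF this] show ?thesis by blast
qed

section \<open>Union bound over simultaneous bad cells in the sparse regime\<close>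

lemma (in prob_space) prob_UN_le:
  assumes "finite I" "\<And>i. i \<in> I \<Longrightarrow> A i \<in> events" "\<And>i. i \<in> I \<Longrightarrow> prob (A i) \<le> b i"
  shows "prob (\<Union>i\<in>I. A i) \<le> (\<Sum>i\<in>I. b i)"
proof -
  have "prob (\<Union>i\<in>I. A i) \<le> (\<Sum>i\<in>I. prob (A i))"
    using assms by (intro finite_measure_subadditive_finite) auto
  also have "\<dots> \<le> (\<Sum>i\<in>I. b i)" using assms by (intro sum_mono)
  finally show ?thesis .
qed

text \<open>A certificate for bad cells at the offsets \<open>B\<close>: \<open>T c\<close>
  witnesses that the cell at \<open>c\<close> is bad, and \<open>U\<close> contains all witnesses.
  Restricting only vertices outside \<open>U\<close> weakens the event slightly but puts it in the
  form of \<open>prob_avoid\<close>, with all cells of \<open>B\<close> treated at once.\<close>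

definition bad_pattern :: "nat \<Rightarrow> nat \<Rightarrow> int \<Rightarrow> int \<Rightarrow> int \<Rightarrow> (int \<times> int) set \<Rightarrow> nat set \<Rightarrow> (int \<times> int \<Rightarrow> nat set) \<Rightarrow>
    (nat \<Rightarrow> real \<times> real) \<times> (nat set \<Rightarrow> bool) \<Rightarrow> bool" where
  "bad_pattern n N h i j B U T \<omega> \<longleftrightarrow> (\<forall>u\<in>U. fst \<omega> u \<in> block N (h + 10) i j) \<and>
     (\<forall>v\<in>{..<n} - U. \<forall>c\<in>B. fst \<omega> v \<in> block N 0 (i + fst c) (j + snd c) \<longrightarrow> \<not> (\<forall>t\<in>T c. snd \<omega> {v, t}))"

lemma block_mono_shift:
  assumes "0 < N" "x \<in> block N m (i + a) (j + b)" "\<bar>a\<bar> \<le> h" "\<bar>b\<bar> \<le> h"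
  shows "x \<in> block N (h + m) i j"
proof -
  obtain c d where "\<bar>grid_x N x + int N * c - (i + a)\<bar> \<le> m" "\<bar>grid_y N x + int N * d - (j + b)\<bar> \<le> m"
    using assms block_iff by blast
  then have "\<bar>grid_x N x + int N * c - i\<bar> \<le> h + m \<and> \<bar>grid_y N x + int N * d - j\<bar> \<le> h + m"
    using assms by linarith
  then show ?thesis using block_iff[OF assms(1)] by blast
qed

lemma ex_bad_pattern:
  assumes N: "0 < N" and bad: "J \<le> card (bad_window n N h \<omega> i j)"
  shows "\<exists>B\<in>{B \<in> Pow ({- h..h} \<times> {- h..h}). card B = J}. \<exists>U\<in>{U \<in> Pow {..<n}. card U \<le> 2 * J}.
     \<exists>T\<in>{T \<in> B \<rightarrow>\<^sub>E Pow U. \<forall>c\<in>B. card (T c) \<le> 2}. bad_pattern n N h i j B U T \<omega>"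
proof -
  from bad obtain B where B: "B \<subseteq> bad_window n N h \<omega> i j" "card B = J" "finite B"
    by (metis obtain_subset_with_card_n)
  have "\<forall>c\<in>B. \<exists>T\<in>Pow {..<n}. card T \<le> 2 \<and> (\<forall>t\<in>T. fst \<omega> t \<in> block N 10 (i + fst c) (j + snd c)) \<and>
     (\<forall>v\<in>{..<n} - T. fst \<omega> v \<in> block N 0 (i + fst c) (j + snd c) \<longrightarrow> \<not> (\<forall>t\<in>T. snd \<omega> {v, t}))"
    using B(1) unfolding bad_window_def bad_cell_def by auto
  then obtain T0 where T0: "\<forall>c\<in>B. T0 c \<in> Pow {..<n} \<and> card (T0 c) \<le> 2 \<and> (\<forall>t\<in>T0 c. fst \<omega> t \<in> block N 10 (i + fst c) (j + snd c)) \<and>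
     (\<forall>v\<in>{..<n} - T0 c. fst \<omega> v \<in> block N 0 (i + fst c) (j + snd c) \<longrightarrow> \<not> (\<forall>t\<in>T0 c. snd \<omega> {v, t}))"
    by metis
  define U where "U = (\<Union>c\<in>B. T0 c)"
  define T where "T = restrict T0 B"
  have "card U \<le> (\<Sum>c\<in>B. card (T0 c))" unfolding U_def by (rule card_UN_le[OF B(3)])
  also have "\<dots> \<le> (\<Sum>c\<in>B. 2)" using T0 by (intro sum_mono) auto
  finally have U: "U \<in> {U \<in> Pow {..<n}. card U \<le> 2 * J}"
    using B(2) T0 by (auto simp: U_def)
  have "fst \<omega> u \<in> block N (h + 10) i j" if u: "u \<in> U" for u
  proof -
    obtain c where c: "c \<in> B" "u \<in> T0 c" using u unfolding U_def by blast
    then have "fst \<omega> u \<in> block N 10 (i + fst c) (j + snd c)" using T0 by blast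
    moreover have "\<bar>fst c\<bar> \<le> h" "\<bar>snd c\<bar> \<le> h" using c B(1) by (auto simp: bad_window_def)
    ultimately show ?thesis by (intro block_mono_shift[OF N])
  qed
  moreover have "\<not> (\<forall>t\<in>T c. snd \<omega> {v, t})" if "v \<in> {..<n} - U" "c \<in> B" "fst \<omega> v \<in> block N 0 (i + fst c) (j + snd c)" for v c
  proof -
    have "v \<in> {..<n} - T0 c" using that by (auto simp: U_def)
    with T0 that have "\<not> (\<forall>t\<in>T0 c. snd \<omega> {v, t})" by blast
    then show ?thesis using that by (simp add: T_def)
  qed
  ultimately have "bad_pattern n N h i j B U T \<omega>" unfolding bad_pattern_def by blast
  moreover have "T \<in> {T \<in> B \<rightarrow>\<^sub>E Pow U. \<forall>c\<in>B. card (T c) \<le> 2}"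
    using T0 by (auto simp: T_def U_def)
  moreover have "B \<in> {B \<in> Pow ({- h..h} \<times> {- h..h}). card B = J}" using B by (auto simp: bad_window_def)
  ultimately show ?thesis using U by blast
qed

text \<open>The cells of \<open>B\<close> are disjoint regions of area 1 / N^2, and a vertex in one
  of them hits its witnesses with probability at least p^2, so the \<open>J\<close> cells add up in
  one exponent. The second factor is the chance that all witnesses fall into the window, enlarged by
  10 cells on each side.\<close>

lemma prob_bad_pattern:
  assumes p: "0 \<le> p" "p \<le> 1" and N: "2 * h + 21 \<le> int N" "0 \<le> h"
    and B: "B \<subseteq> {- h..h} \<times> {- h..h}" "card B = J" and U: "U \<subseteq> {..<n}"
    and T: "T \<in> B \<rightarrow>\<^sub>E Pow U" "\<forall>c\<in>B. card (T c) \<le> 2"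
  shows "Measurable.pred (grp_space n p) (bad_pattern n N h i j B U T)"
    and "measure (grp_space n p) {\<omega> \<in> space (grp_space n p). bad_pattern n N h i j B U T \<omega>} \<le>
      (1 - real J * p\<^sup>2 / (real N)\<^sup>2) ^ (n - card U) * ((of_int (2 * h + 21) / N)\<^sup>2) ^ card U"
proof -
  interpret unif: prob_space unif_sq by (rule prob_space_unif_sq)
  interpret G: prob_space "grp_space n p" by (rule prob_space_grp_space)
  let ?M = "PiM U (\<lambda>_. unif_sq)"
  have N0: "0 < N" using N by linarith
  have fU: "finite U" and fB: "finite B" using U B finite_subset by (blast, metis finite_SigmaI finite_atLeastAtMost_int finite_subset)
  define Q where "Q x \<longleftrightarrow> (\<forall>u\<in>U. x u \<in> block N (h + 10) i j)" for x :: "nat \<Rightarrow> real \<times> real"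
  define R where "R c x = block N 0 (i + fst c) (j + snd c)" for c :: "int \<times> int" and x :: "nat \<Rightarrow> real \<times> real"
  define s where "s = real J * p\<^sup>2 / (real N)\<^sup>2"
  have Q_PiE: "{x \<in> space ?M. Q x} = Pi\<^sub>E U (\<lambda>_. block N (h + 10) i j)"
    by (rule set_eqI) (simp add: space_PiM Q_def PiE_iff conj_commute)
  have Qm: "Measurable.pred ?M Q"
    unfolding pred_def Q_PiE using fU by (intro sets_PiM_I_finite) auto
  have Rm: "Measurable.pred (?M \<Otimes>\<^sub>M unif_sq) (\<lambda>(x, y). y \<in> R c x)" for c
  proof -
    have "Measurable.pred unif_sq (\<lambda>y. y \<in> block N 0 (i + fst c) (j + snd c))" by (simp add: pred_def)
    from measurable_compose[OF measurable_snd this] show ?thesis by (simp add: R_def case_prod_beta)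
  qed
  have dj: "disjoint_family_on (\<lambda>c. R c x) B" for x
    unfolding disjoint_family_on_def
  proof (intro ballI impI equals0I)
    fix c d y assume cd: "c \<in> B" "d \<in> B" "c \<noteq> d" "y \<in> R c x \<inter> R d x"
    have b: "- h \<le> fst c \<and> fst c \<le> h \<and> - h \<le> snd c \<and> snd c \<le> h" if "c \<in> B" for c
      using subsetD[OF B(1) that] by (auto simp: mem_Times_iff)
    have "i + fst c = i + fst d \<and> j + snd c = j + snd d"
      using cd(4) b[OF cd(1)] b[OF cd(2)] N unfolding R_def by (intro block_0_unique[OF N0, of y]) auto
    with cd(3) show False by (auto simp: prod_eq_iff)
  qed
  have s: "s \<le> (\<Sum>c\<in>B. measure unif_sq (R c x) * p ^ card (T c))" for x
  proof -
    have "s = (\<Sum>c\<in>B. p\<^sup>2 / (real N)\<^sup>2)" using B by (simp add: s_def)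
    also have "\<dots> \<le> (\<Sum>c\<in>B. measure unif_sq (R c x) * p ^ card (T c))"
    proof (rule sum_mono)
      fix c assume "c \<in> B"
      have "measure unif_sq (R c x) = 1 / (real N)\<^sup>2"
        unfolding R_def using N by (subst measure_block[OF N0]) (auto simp: power_divide)
      moreover have "p\<^sup>2 \<le> p ^ card (T c)" using T(2) \<open>c \<in> B\<close> p by (intro power_decreasing) auto
      ultimately show "p\<^sup>2 / (real N)\<^sup>2 \<le> measure unif_sq (R c x) * p ^ card (T c)"
        using N0 by (simp add: divide_right_mono)
    qed
    finally show ?thesis .
  qed
  have ev: "bad_pattern n N h i j B U T \<omega> \<longleftrightarrow> Q (restrict (fst \<omega>) U) \<and>
      (\<forall>v\<in>{..<n} - U. \<forall>c\<in>B. fst \<omega> v \<in> R c (restrict (fst \<omega>) U) \<longrightarrow> \<not> (\<forall>t\<in>T c. snd \<omega> {v, t}))" for \<omega>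
    unfolding bad_pattern_def Q_def R_def by auto
  have TU: "T c \<subseteq> U" if "c \<in> B" for c using T(1) that by auto
  note av = prob_avoid[where R = R and T = T and I = B and U = U and Q = Q and n = n and p = p and s = s,
      OF p U fB TU Qm Rm dj s]
  show "Measurable.pred (grp_space n p) (bad_pattern n N h i j B U T)"
    unfolding ev[abs_def] by (intro av(1))
  have "emeasure (grp_space n p) {\<omega> \<in> space (grp_space n p). bad_pattern n N h i j B U T \<omega>} \<le>
      ennreal ((1 - s) ^ (n - card U)) * emeasure ?M {x \<in> space ?M. Q x}"
    unfolding ev by (intro av(2))
  also have "emeasure ?M {x \<in> space ?M. Q x} = ennreal (((of_int (2 * h + 21) / N)\<^sup>2) ^ card U)"
  proof -
    interpret product_sigma_finite "\<lambda>_. unif_sq" ..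
    have "emeasure unif_sq (block N (h + 10) i j) = ennreal ((of_int (2 * h + 21) / N)\<^sup>2)"
      using N emeasure_block[OF N0, of "h + 10" i j] by (simp add: algebra_simps)
    then show ?thesis
      unfolding Q_PiE using fU by (subst emeasure_PiM) (auto simp: ennreal_power)
  qed
  finally have le: "emeasure (grp_space n p) {\<omega> \<in> space (grp_space n p). bad_pattern n N h i j B U T \<omega>} \<le>
      ennreal ((1 - s) ^ (n - card U)) * ennreal (((of_int (2 * h + 21) / N)\<^sup>2) ^ card U)" .
  have "card B \<le> N * N"
  proof -
    have "card B \<le> card ({- h..h} \<times> {- h..h})" using B by (intro card_mono) auto
    also have "\<dots> = nat (2 * h + 1) * nat (2 * h + 1)" by (simp add: card_cartesian_product)
    also have "\<dots> \<le> N * N" using N by (intro mult_mono) auto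
    finally show ?thesis .
  qed
  then have "real J \<le> (real N)\<^sup>2" using B by (metis of_nat_le_iff of_nat_mult power2_eq_square)
  moreover have "p\<^sup>2 \<le> 1" using p by (simp add: power_le_one)
  ultimately have "real J * p\<^sup>2 \<le> (real N)\<^sup>2 * 1" by (intro mult_mono) auto
  then have "0 \<le> 1 - s" using N0 by (simp add: s_def divide_le_eq_1)
  then show "measure (grp_space n p) {\<omega> \<in> space (grp_space n p). bad_pattern n N h i j B U T \<omega>} \<le>
      (1 - real J * p\<^sup>2 / (real N)\<^sup>2) ^ (n - card U) * ((of_int (2 * h + 21) / N)\<^sup>2) ^ card U"
    using le unfolding s_def[symmetric] G.emeasure_eq_measure
    by (subst (asm) ennreal_mult'[symmetric]) (auto simp: ennreal_le_iff)
qed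

lemma pred_edge:
  assumes "r < 1/2" shows "Measurable.pred (grp_space n p) (\<lambda>\<omega>. edge n r \<omega> u v)"
proof (cases "u < n \<and> v < n \<and> u \<noteq> v")
  case True
  then have "Measurable.pred (grp_space n p) (\<lambda>\<omega>. torus_dist (fst \<omega> u) (fst \<omega> v) \<le> r)"
    using assms by (intro torus_dist_le_measurable grp_point_measurable) auto
  moreover have "Measurable.pred (grp_space n p) (\<lambda>\<omega>. snd \<omega> {u, v})"
    using True by (intro grp_coin_measurable vertex_pairs_memI) auto
  ultimately show ?thesis using True unfolding edge_iff by (auto intro: pred_intros_logic)
next
  case False
  then have "edge n r \<omega> u v \<longleftrightarrow> False" for \<omega> by (auto simp: edge_iff)
  then show ?thesis by simp
qed

abbreviation (input) disconnect_prob :: "nat \<Rightarrow> real \<Rightarrow> real \<Rightarrow> real" where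
  "disconnect_prob n r p \<equiv> \<P>(\<omega> in grp_space n p. \<not> connected_graph (grp_graph n r \<omega>))"

lemma pred_connected:
  assumes "r < 1/2" shows "Measurable.pred (grp_space n p) (\<lambda>\<omega>. connected_graph (grp_graph n r \<omega>))"
proof -
  have "Measurable.pred (grp_space n p) (\<lambda>\<omega>. edge_closed n r \<omega> S)" if "S \<in> Pow {..<n}" for S
  proof -
    have "finite S" using that finite_subset by blast
    then show ?thesis
      unfolding edge_closed_def by (intro pred_intros_logic pred_intros_finite pred_edge assms) auto
  qed
  then show ?thesis
    unfolding connected_grp_graph_iff by (intro pred_intros_logic pred_intros_finite) auto
qed

text \<open>Sums the location factor over all witness sets, using that n choose d is at most n^d.
  With \<open>A\<close> the area of a window, n A is the expected number of points in it; in the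
  sparse regime this is O(ln n), so the choice of witnesses costs only a power of ln n.\<close>

lemma sum_subsets_card_le:
  assumes "0 \<le> (A :: real)"
  shows "(\<Sum>U\<in>{U \<in> Pow {..<n}. card U \<le> k}. A ^ card U) \<le> (real k + 1) * (1 + real n * A) ^ k"
proof -
  have "{U \<in> Pow {..<n}. card U \<le> k} = (\<Union>d\<in>{..k}. {U. U \<subseteq> {..<n} \<and> card U = d})" by auto
  then have "(\<Sum>U\<in>{U \<in> Pow {..<n}. card U \<le> k}. A ^ card U) = (\<Sum>d\<le>k. \<Sum>U\<in>{U. U \<subseteq> {..<n} \<and> card U = d}. A ^ card U)"
    by (simp only:) (rule sum.UNION_disjoint, auto)
  also have "\<dots> = (\<Sum>d\<le>k. real (n choose d) * A ^ d)"
    by (intro sum.cong) (auto simp: n_subsets)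
  also have "\<dots> \<le> (\<Sum>d\<le>k. (1 + real n * A) ^ k)"
  proof (intro sum_mono)
    fix d assume d: "d \<in> {..k}"
    have "n choose d \<le> n ^ d"
      by (cases "d \<le> n") (auto intro: binomial_le_pow simp: binomial_eq_0)
    then have "real (n choose d) * A ^ d \<le> real n ^ d * A ^ d"
      using assms by (intro mult_right_mono) (auto simp: of_nat_power[symmetric] simp del: of_nat_power)
    also have "\<dots> = (real n * A) ^ d" by (simp add: power_mult_distrib)
    also have "\<dots> \<le> (1 + real n * A) ^ d" using assms by (intro power_mono) auto
    also have "\<dots> \<le> (1 + real n * A) ^ k" using assms d by (intro power_increasing) auto
    finally show "real (n choose d) * A ^ d \<le> (1 + real n * A) ^ k" .
  qed
  also have "\<dots> = (real k + 1) * (1 + real n * A) ^ k" by simp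
  finally show ?thesis .
qed

text \<open>A finite union of measurable certificates that covers the event of \<open>J\<close> bad
  cells in one window, so both measurability and the bound come from the certificates.\<close>

definition bad_window_event :: "nat \<Rightarrow> nat \<Rightarrow> int \<Rightarrow> nat \<Rightarrow> real \<Rightarrow> int \<Rightarrow> int \<Rightarrow> ((nat \<Rightarrow> real \<times> real) \<times> (nat set \<Rightarrow> bool)) set" where
  "bad_window_event n N h J p i j = (\<Union>B\<in>{B \<in> Pow ({- h..h} \<times> {- h..h}). card B = J}. \<Union>U\<in>{U \<in> Pow {..<n}. card U \<le> 2 * J}.
     \<Union>T\<in>{T \<in> B \<rightarrow>\<^sub>E Pow U. \<forall>c\<in>B. card (T c) \<le> 2}. {\<omega> \<in> space (grp_space n p). bad_pattern n N h i j B U T \<omega>})"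

lemma prob_bad_window:
  assumes p: "0 \<le> p" "p \<le> 1" and N: "2 * h + 21 \<le> int N" "0 \<le> h"
    and J: "real J * p\<^sup>2 / (real N)\<^sup>2 \<le> 1"
  shows "bad_window_event n N h J p i j \<in> sets (grp_space n p)"
    and "measure (grp_space n p) (bad_window_event n N h J p i j) \<le> 2 ^ card ({- h..h} \<times> {- h..h}) * (2 ^ (2 * J)) ^ J *
       ((real (2 * J) + 1) * (1 + real n * (of_int (2 * h + 21) / N)\<^sup>2) ^ (2 * J)) *
       (1 - real J * p\<^sup>2 / (real N)\<^sup>2) ^ (n - 2 * J)"
proof -
  interpret G: prob_space "grp_space n p" by (rule prob_space_grp_space)
  define BB where "BB = {B \<in> Pow ({- h..h} \<times> {- h..h}). card B = J}"
  define UU where "UU = {U \<in> Pow {..<n}. card U \<le> 2 * J}"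
  define TT where "TT B U = {T \<in> B \<rightarrow>\<^sub>E Pow U. \<forall>c\<in>B. card (T c) \<le> 2}" for B :: "(int \<times> int) set" and U :: "nat set"
  define P where "P B U T = {\<omega> \<in> space (grp_space n p). bad_pattern n N h i j B U T \<omega>}" for B U T
  define A where "A = (of_int (2 * h + 21) / real N)\<^sup>2"
  define s where "s = real J * p\<^sup>2 / (real N)\<^sup>2"
  have s: "0 \<le> s" "s \<le> 1" using J p by (auto simp: s_def)
  have A0: "0 \<le> A" by (simp add: A_def)
  have fin: "finite BB" "finite UU" by (auto simp: BB_def UU_def)
  have fB: "finite B" "card B = J" if "B \<in> BB" for B
    using that finite_subset[of B "{- h..h} \<times> {- h..h}"] by (auto simp: BB_def)
  have fU: "finite U" "card U \<le> 2 * J" if "U \<in> UU" for U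
    using that finite_subset[of U "{..<n}"] by (auto simp: UU_def)
  have cT: "finite (TT B U)" "card (TT B U) \<le> (2 ^ (2 * J)) ^ J" if "B \<in> BB" "U \<in> UU" for B U
  proof -
    have f: "finite (B \<rightarrow>\<^sub>E Pow U)" using fB[OF that(1)] fU[OF that(2)] by (intro finite_PiE) auto
    then show "finite (TT B U)" by (rule finite_subset[rotated]) (auto simp: TT_def)
    have "card (TT B U) \<le> card (B \<rightarrow>\<^sub>E Pow U)" by (rule card_mono[OF f]) (auto simp: TT_def)
    also have "\<dots> = (2 ^ card U) ^ J" using fB[OF that(1)] fU[OF that(2)] by (simp add: card_PiE card_Pow)
    also have "\<dots> \<le> (2 ^ (2 * J)) ^ J" using fU[OF that(2)] by (intro power_mono power_increasing) auto
    finally show "card (TT B U) \<le> (2 ^ (2 * J)) ^ J" .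
  qed
  have ev: "P B U T \<in> G.events" and pr: "G.prob (P B U T) \<le> (1 - s) ^ (n - 2 * J) * A ^ card U"
    if "B \<in> BB" "U \<in> UU" "T \<in> TT B U" for B U T
  proof -
    have a: "B \<subseteq> {- h..h} \<times> {- h..h}" "card B = J" "U \<subseteq> {..<n}" "T \<in> B \<rightarrow>\<^sub>E Pow U" "\<forall>c\<in>B. card (T c) \<le> 2"
      using that by (auto simp: BB_def UU_def TT_def)
    note pb = prob_bad_pattern[OF p N a, of i j, folded P_def A_def s_def]
    show "P B U T \<in> G.events" using prob_bad_pattern(1)[OF p N a, of i j] by (simp add: P_def pred_def)
    note pb(2)
    also have "(1 - s) ^ (n - card U) * A ^ card U \<le> (1 - s) ^ (n - 2 * J) * A ^ card U"
      using s A0 fU[OF that(2)] by (intro mult_right_mono power_decreasing) auto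
    finally show "G.prob (P B U T) \<le> (1 - s) ^ (n - 2 * J) * A ^ card U" .
  qed
  have E: "bad_window_event n N h J p i j = (\<Union>B\<in>BB. \<Union>U\<in>UU. \<Union>T\<in>TT B U. P B U T)"
    unfolding bad_window_event_def BB_def UU_def TT_def P_def ..
  have m1: "(\<Union>T\<in>TT B U. P B U T) \<in> G.events" if "B \<in> BB" "U \<in> UU" for B U
    by (rule sets.finite_UN[OF cT(1)[OF that]]) (rule ev[OF that])
  have m2: "(\<Union>U\<in>UU. \<Union>T\<in>TT B U. P B U T) \<in> G.events" if "B \<in> BB" for B
    by (rule sets.finite_UN[OF fin(2)]) (rule m1[OF that])
  show "bad_window_event n N h J p i j \<in> G.events" unfolding E by (rule sets.finite_UN[OF fin(1)]) (rule m2)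
  let ?K = "(2 ^ (2 * J)) ^ J :: real"
  have p1: "G.prob (\<Union>T\<in>TT B U. P B U T) \<le> ?K * ((1 - s) ^ (n - 2 * J) * A ^ card U)" if "B \<in> BB" "U \<in> UU" for B U
  proof -
    have "G.prob (\<Union>T\<in>TT B U. P B U T) \<le> (\<Sum>T\<in>TT B U. (1 - s) ^ (n - 2 * J) * A ^ card U)"
      using that cT ev pr by (intro G.prob_UN_le) auto
    also have "\<dots> = real (card (TT B U)) * ((1 - s) ^ (n - 2 * J) * A ^ card U)" by simp
    also have "\<dots> \<le> ?K * ((1 - s) ^ (n - 2 * J) * A ^ card U)"
    proof (rule mult_right_mono)
      have "real (card (TT B U)) \<le> real ((2 ^ (2 * J)) ^ J)" using cT(2)[OF that] by (simp only: of_nat_le_iff)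
      then show "real (card (TT B U)) \<le> ?K" by simp
    qed (use s A0 in simp)
    finally show ?thesis .
  qed
  define W where "W = ?K * (1 - s) ^ (n - 2 * J) * ((real (2 * J) + 1) * (1 + real n * A) ^ (2 * J))"
  have W0: "0 \<le> W" using s A0 by (simp add: W_def)
  have p2: "G.prob (\<Union>U\<in>UU. \<Union>T\<in>TT B U. P B U T) \<le> W" if "B \<in> BB" for B
  proof -
    have "G.prob (\<Union>U\<in>UU. \<Union>T\<in>TT B U. P B U T) \<le> (\<Sum>U\<in>UU. ?K * ((1 - s) ^ (n - 2 * J) * A ^ card U))"
      using that fin m1 p1 by (intro G.prob_UN_le) auto
    also have "\<dots> = ?K * (1 - s) ^ (n - 2 * J) * (\<Sum>U\<in>UU. A ^ card U)"
      by (simp only: sum_distrib_left mult.assoc)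
    also have "\<dots> \<le> W"
      unfolding W_def UU_def using s sum_subsets_card_le[OF A0, where n = n and k = "2 * J"] by (intro mult_left_mono) auto
    finally show ?thesis .
  qed
  have "G.prob (bad_window_event n N h J p i j) \<le> (\<Sum>B\<in>BB. W)"
    unfolding E using fin m2 p2 by (intro G.prob_UN_le) auto
  also have "\<dots> = real (card BB) * W" by simp
  also have "\<dots> \<le> 2 ^ card ({- h..h} \<times> {- h..h}) * W"
  proof (rule mult_right_mono[OF _ W0])
    have "card BB \<le> card (Pow ({- h..h} \<times> {- h..h}))" by (rule card_mono) (auto simp: BB_def)
    also have "\<dots> = 2 ^ card ({- h..h} \<times> {- h..h})" by (rule card_Pow) simp
    finally have "real (card BB) \<le> real (2 ^ card ({- h..h} \<times> {- h..h}))" by (simp only: of_nat_le_iff)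
    then show "real (card BB) \<le> 2 ^ card ({- h..h} \<times> {- h..h})" by simp
  qed
  finally show "G.prob (bad_window_event n N h J p i j) \<le> 2 ^ card ({- h..h} \<times> {- h..h}) * (2 ^ (2 * J)) ^ J *
       ((real (2 * J) + 1) * (1 + real n * (of_int (2 * h + 21) / N)\<^sup>2) ^ (2 * J)) *
       (1 - real J * p\<^sup>2 / (real N)\<^sup>2) ^ (n - 2 * J)"
    unfolding W_def A_def s_def by (simp only: mult_ac)
qed

text \<open>A disconnected graph has either a window with \<open>J\<close> bad cells or a trapped
  component, hence an extremal pair. The first summand runs over the N^2 windows, the second over
  the pairs (v, w), where v = w accounts for components with a single extreme vertex. The lower
  bound on \<open>N\<close> makes \<rho> at most 1/4, so boxes plus discs do not wrap
  around.\<close>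

lemma prob_not_connected_sparse:
  assumes p: "0 \<le> p" "p \<le> 1" and r: "0 \<le> r" "r \<le> 1/4" and Nr: "33/2 \<le> real N * r" "real N * r \<le> 19"
    and h: "h = int J + 20" and N: "8 * h + 84 \<le> int N" and n: "0 < n"
    and J: "real J * p\<^sup>2 / (real N)\<^sup>2 \<le> 1"
  shows "disconnect_prob n r p \<le>
     (real N)\<^sup>2 * (2 ^ card ({- h..h} \<times> {- h..h}) * (2 ^ (2 * J)) ^ J *
       ((real (2 * J) + 1) * (1 + real n * (of_int (2 * h + 21) / N)\<^sup>2) ^ (2 * J)) *
       (1 - real J * p\<^sup>2 / (real N)\<^sup>2) ^ (n - 2 * J)) +
     (real n * (1 - pi * r\<^sup>2 * p) ^ (n - 1) + (real n)\<^sup>2 * (2 * (of_int (2 * h + 1) / N)\<^sup>2 * (1 - pi * r\<^sup>2 * p) ^ (n - 2)))"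
    (is "_ \<le> (real N)\<^sup>2 * ?W + ?V")
proof -
  interpret G: prob_space "grp_space n p" by (rule prob_space_grp_space)
  define E where "E i j = bad_window_event n N h J p i j" for i j
  define \<rho> where "\<rho> = of_int (2 * h + 1) / real N"
  define q where "q = pi * r\<^sup>2 * p"
  define X where "X v w = {\<omega> \<in> space (grp_space n p). extremal_pair n r \<rho> \<omega> v w}" for v w
  have h0: "0 \<le> h" and N0: "0 < N" and N': "2 * h + 21 \<le> int N" using h N by linarith+
  have \<rho>: "0 \<le> \<rho>" "\<rho> \<le> 1/4"
  proof -
    show "0 \<le> \<rho>" using h0 by (simp add: \<rho>_def)
    have "4 * (2 * h + 1) \<le> int N" using N by (simp add: algebra_simps)
    then have "of_int (4 * (2 * h + 1)) \<le> real_of_int (int N)" by (simp only: of_int_le_iff)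
    then have "4 * of_int (2 * h + 1) \<le> real N" by simp
    then show "\<rho> \<le> 1/4" using N0 unfolding \<rho>_def by (simp add: pos_divide_le_eq)
  qed
  have q: "0 \<le> q" "q \<le> 1"
  proof -
    show "0 \<le> q" using p by (simp add: q_def)
    have "r\<^sup>2 \<le> (1/4)\<^sup>2" using r by (intro power_mono) auto
    then have "pi * r\<^sup>2 \<le> 4 * (1/4)\<^sup>2" using pi_less_4 by (intro mult_mono) auto
    then have "pi * r\<^sup>2 * p \<le> 1 * 1" using p by (intro mult_mono) (auto simp: power2_eq_square)
    then show "q \<le> 1" by (simp add: q_def)
  qed
  have Xm: "X v w \<in> G.events" and Xp: "G.prob (X v w) \<le> (if v = w then (1 - q) ^ (n - 1) else 0) + 2 * \<rho>\<^sup>2 * (1 - q) ^ (n - 2)"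
    if "v < n" "w < n" for v w
  proof -
    have sm: "2 * r + \<rho> < 1" "2 * \<rho> < 1" using r \<rho> by linarith+
    note e = prob_extremal_pair[OF p that r(1) \<rho>(1) sm]
    show "X v w \<in> G.events" using e(1) by (simp add: X_def pred_def)
    have "G.prob (X v w) \<le> (1 - q) ^ (n - card {v, w}) * (if v = w then 1 else 2 * \<rho>\<^sup>2)"
      using e(2) q unfolding X_def[symmetric] q_def[symmetric] G.emeasure_eq_measure
      by (subst (asm) ennreal_le_iff) auto
    also have "\<dots> \<le> (if v = w then (1 - q) ^ (n - 1) else 0) + 2 * \<rho>\<^sup>2 * (1 - q) ^ (n - 2)"
    proof (cases "v = w")
      case False
      then have "card {v, w} = 2" by simp
      with False show ?thesis by (simp only:) simp
    qed (use q in simp)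
    finally show "G.prob (X v w) \<le> (if v = w then (1 - q) ^ (n - 1) else 0) + 2 * \<rho>\<^sup>2 * (1 - q) ^ (n - 2)" .
  qed
  have Em: "E i j \<in> G.events" and Ep: "G.prob (E i j) \<le> ?W" for i j
    using prob_bad_window[OF p N' h0 J, where i = i and j = j and n = n] unfolding E_def by blast+
  define EE where "EE = (\<Union>ij\<in>{0..<int N} \<times> {0..<int N}. E (fst ij) (snd ij))"
  define XX where "XX = (\<Union>vw\<in>{..<n} \<times> {..<n}. X (fst vw) (snd vw))"
  have "G.prob EE \<le> (\<Sum>ij\<in>{0..<int N} \<times> {0..<int N}. ?W)"
    unfolding EE_def using Em Ep by (intro G.prob_UN_le) auto
  also have "\<dots> = (real N)\<^sup>2 * ?W"
    by (simp only: sum_constant card_cartesian_product card_atLeastLessThan_int) (simp add: power2_eq_square)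
  finally have EE: "G.prob EE \<le> (real N)\<^sup>2 * ?W" .
  have "G.prob XX \<le> (\<Sum>vw\<in>{..<n} \<times> {..<n}. (if fst vw = snd vw then (1 - q) ^ (n - 1) else 0) + 2 * \<rho>\<^sup>2 * (1 - q) ^ (n - 2))"
    unfolding XX_def by (intro G.prob_UN_le Xm Xp) auto
  also have "\<dots> = (\<Sum>v<n. \<Sum>w<n. (if v = w then (1 - q) ^ (n - 1) else 0) + 2 * \<rho>\<^sup>2 * (1 - q) ^ (n - 2))"
    by (simp add: sum.cartesian_product case_prod_beta)
  also have "\<dots> = ?V"
    unfolding \<rho>_def[symmetric] q_def[symmetric] by (simp add: sum.distrib power2_eq_square distrib_left mult.assoc)
  finally have XX: "G.prob XX \<le> ?V" .
  have XXm: "XX \<in> G.events" unfolding XX_def using Xm by (intro sets.finite_UN) auto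
  have EEm: "EE \<in> G.events" unfolding EE_def using Em by (intro sets.finite_UN) auto
  have "{\<omega> \<in> space (grp_space n p). \<not> connected_graph (grp_graph n r \<omega>)} \<subseteq> EE \<union> XX"
  proof
    fix \<omega> assume "\<omega> \<in> {\<omega> \<in> space (grp_space n p). \<not> connected_graph (grp_graph n r \<omega>)}"
    then have w: "\<omega> \<in> space (grp_space n p)" and nc: "\<not> connected_graph (grp_graph n r \<omega>)" by auto
    have r2: "r < 1/2" using r by simp
    show "\<omega> \<in> EE \<union> XX"
    proof (cases "\<exists>i\<in>{0..<int N}. \<exists>j\<in>{0..<int N}. J \<le> card (bad_window n N h \<omega> i j)")
      case True
      then obtain i j where ij: "i \<in> {0..<int N}" "j \<in> {0..<int N}" "J \<le> card (bad_window n N h \<omega> i j)" by blast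
      from ex_bad_pattern[OF N0 ij(3)] w have "\<omega> \<in> E i j" unfolding E_def bad_window_event_def by blast
      with ij show ?thesis unfolding EE_def by force
    next
      case False
      then have few: "\<And>i j. i \<in> {0..<int N} \<Longrightarrow> j \<in> {0..<int N} \<Longrightarrow> card (bad_window n N h \<omega> i j) < J"
        by (meson not_le)
      have "int J + 20 \<le> h" using h by simp
      from trapped_component[OF N0 r2 Nr this few n nc] obtain T z where
        T: "edge_closed n r \<omega> T" "z \<in> T" "\<forall>t\<in>T. fst \<omega> t \<in> block N h (grid_x N (fst \<omega> z)) (grid_y N (fst \<omega> z))"
        by blast
      have "\<rho> + r < 1" using \<rho> r by linarith
      from ex_extremal_pair[OF T(1,2) N0 h0 _ this[unfolded \<rho>_def] r2] T(3)
      obtain v w where "v \<in> {..<n}" "w \<in> {..<n}" "extremal_pair n r \<rho> \<omega> v w" unfolding \<rho>_def by blast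
      with w show ?thesis unfolding XX_def X_def by force
    qed
  qed
  then have "disconnect_prob n r p \<le> G.prob (EE \<union> XX)"
    using EEm XXm by (intro G.finite_measure_mono) auto
  also have "\<dots> \<le> G.prob EE + G.prob XX" using EEm XXm by (intro measure_Un_le)
  also have "\<dots> \<le> (real N)\<^sup>2 * ?W + ?V" using EE XX by linarith
  finally show ?thesis .
qed

section \<open>Asymptotics in the sparse regime\<close>

lemma polylog_over_power:
  fixes a b c d e \<epsilon> :: real
  assumes "\<epsilon> > 0"
  shows "(\<lambda>n. a * ((1 + b * ln (real n)) ^ k / (real n)\<^sup>2) + c * real n powr - \<epsilon> + d * ln (real n) * real n powr - \<epsilon>) \<longlonglongrightarrow> 0"
proof -
  \<comment> \<open>The exponent \<open>k\<close> is symbolic, so each of the \<open>k\<close>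
    logarithmic factors receives its own share n^(1/(k+1)); together the shares stay below n,
    leaving a bound 1/n.\<close>
  have 1: "(\<lambda>n. (1 + b * ln (real n)) / real n powr (1 / real (Suc k))) \<longlonglongrightarrow> 0"
    by real_asymp
  have "(\<lambda>n. (1 + b * ln (real n)) ^ k / (real n)\<^sup>2) \<longlonglongrightarrow> 0"
  proof -
    have "(\<lambda>n. ((1 + b * ln (real n)) / real n powr (1 / real (Suc k))) ^ k * (real n powr (real k / real (Suc k)) / (real n)\<^sup>2)) \<longlonglongrightarrow> 0"
    proof (rule Lim_null_comparison)
      have "\<forall>\<^sub>F n in sequentially. \<bar>(1 + b * ln (real n)) / real n powr (1 / real (Suc k))\<bar> < 1"
        using order_tendstoD(2)[OF tendsto_rabs_zero[OF 1], of 1] by simp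
      moreover have "\<forall>\<^sub>F n in sequentially. 0 < n" by (rule eventually_gt_at_top)
      ultimately show "\<forall>\<^sub>F n in sequentially. norm (((1 + b * ln (real n)) / real n powr (1 / real (Suc k))) ^ k * (real n powr (real k / real (Suc k)) / (real n)\<^sup>2)) \<le> real n powr -1"
      proof eventually_elim
        case (elim n)
        have "real n powr (real k / real (Suc k)) \<le> real n powr 1" using elim by (intro powr_mono) auto
        then have "real n powr (real k / real (Suc k)) / (real n)\<^sup>2 \<le> real n powr -1"
          using elim by (simp add: powr_minus power2_eq_square divide_simps)
        moreover have "\<bar>((1 + b * ln (real n)) / real n powr (1 / real (Suc k))) ^ k\<bar> \<le> 1"
          unfolding power_abs using elim by (intro power_le_one) auto
        ultimately have "\<bar>((1 + b * ln (real n)) / real n powr (1 / real (Suc k))) ^ k\<bar> * \<bar>real n powr (real k / real (Suc k)) / (real n)\<^sup>2\<bar> \<le> 1 * real n powr -1"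
          by (intro mult_mono) auto
        then show ?case by (simp add: abs_mult)
      qed
      show "(\<lambda>n. real n powr -1) \<longlonglongrightarrow> 0" by real_asymp
    qed
    moreover have "\<forall>\<^sub>F n in sequentially. ((1 + b * ln (real n)) / real n powr (1 / real (Suc k))) ^ k * (real n powr (real k / real (Suc k)) / (real n)\<^sup>2) =
        (1 + b * ln (real n)) ^ k / (real n)\<^sup>2"
      using eventually_gt_at_top[of 0]
    proof eventually_elim
      case (elim n)
      have "(real n powr (1 / real (Suc k))) ^ k = real n powr (real k / real (Suc k))"
        using elim by (simp add: powr_realpow[symmetric] powr_powr)
      moreover have "real n powr (real k / real (Suc k)) \<noteq> 0" using elim by simp
      ultimately show ?case by (simp add: power_divide)
    qed
    ultimately show ?thesis by (rule Lim_transform_eventually)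
  qed
  from tendsto_mult_right_zero[OF this, of a] have 2: "(\<lambda>n. a * ((1 + b * ln (real n)) ^ k / (real n)\<^sup>2)) \<longlonglongrightarrow> 0" .
  have 3: "(\<lambda>n. c * real n powr - \<epsilon>) \<longlonglongrightarrow> 0" using assms by real_asymp
  have 4: "(\<lambda>n. d * ln (real n) * real n powr - \<epsilon>) \<longlonglongrightarrow> 0" using assms by real_asymp
  from tendsto_add[OF tendsto_add[OF 2 3] 4] show ?thesis by simp
qed

lemma one_minus_power_le:
  fixes x :: real
  assumes "0 \<le> x" "x \<le> 1"
  shows "(1 - x) ^ m \<le> exp (- (x * real m))"
proof -
  have "(1 - x) ^ m \<le> exp (- x) ^ m"
    using assms exp_ge_add_one_self[of "- x"] by (intro power_mono) auto
  then show ?thesis by (simp add: exp_of_nat_mult[symmetric] mult.commute)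
qed

lemma powr_eq_exp: "0 < n \<Longrightarrow> exp (- (c * ln (real n))) = real n powr - c"
  by (simp add: powr_def)

text \<open>The bound has to beat N^2 windows and n^2 pairs. Windows contribute n^(-3) each, times a
  power of ln n, against at most 1100 n windows. For pairs, n^2 \<rho>^2 is O(n ln n), against
  n^(-1-\<epsilon>).\<close>

theorem connected_sparse:
  fixes \<epsilon> C :: real
  assumes \<epsilon>: "\<epsilon> > 0" and C: "C \<ge> 1"
  shows "\<exists>g. g \<longlonglongrightarrow> 0 \<and> (\<forall>\<^sub>F n in sequentially. \<forall>r p. 0 \<le> r \<longrightarrow> r \<le> 1/4 \<longrightarrow> 0 \<le> p \<longrightarrow> p \<le> 1 \<longrightarrow>
     (1 + \<epsilon>) * ln (real n) \<le> real n * (pi * r\<^sup>2 * p) \<longrightarrow> real n * (pi * r\<^sup>2) \<le> C * ln (real n) \<longrightarrow>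
     disconnect_prob n r p \<le> g n)"
proof -
  \<comment> \<open>With p >= 1/C, N r <= 18 and n r^2 >= 5/16 ln n, the exponent n J p^2 / N^2 is
    at least 7000/324 times 5/16 ln n, which exceeds 6 ln n. Removing 2 J exposed vertices leaves at
    least half of it, so a pattern costs n^(-3).\<close>
  define J where "J = nat \<lceil>7000 * C\<^sup>2\<rceil>"
  define h where "h = int J + 20"
  define K where "K = (2 :: real) ^ card ({- h..h} \<times> {- h..h}) * (2 ^ (2 * J)) ^ J * (real (2 * J) + 1)"
  define b where "b = (of_int (2 * h + 21))\<^sup>2 * C"
  define g where "g n = 1100 * K * ((1 + b * ln (real n)) ^ (2 * J) / (real n)\<^sup>2) + exp 1 * real n powr - \<epsilon> +
     exp 2 * (2 * (of_int (2 * h + 1))\<^sup>2 * C) * ln (real n) * real n powr - \<epsilon>" for n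
  have g: "g \<longlonglongrightarrow> 0" unfolding g_def by (rule polylog_over_power[OF \<epsilon>])
  have J: "7000 * C\<^sup>2 \<le> real J" unfolding J_def by linarith
  have K0: "0 \<le> K" by (simp add: K_def)
  have h0: "0 \<le> h" by (simp add: h_def)
  define h' where "h' = real_of_int (8 * h + 84)"
  have h': "h' > 0" using h0 by (simp add: h'_def)
  \<comment> \<open>D <= C ln n forces r to 0. This bound makes r < 17 / h', so that
    \<open>N\<close>, at least 17 / r, exceeds the size required of it.\<close>
  have ev1: "\<forall>\<^sub>F n in sequentially. C * ln (real n) / (pi * real n) < (17 / h')\<^sup>2"
  proof -
    have "(\<lambda>n. C * ln (real n) / (pi * real n)) \<longlonglongrightarrow> 0" by real_asymp
    then show ?thesis using h' by (intro order_tendstoD(2)) auto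
  qed
  have ev2: "\<forall>\<^sub>F n in sequentially. 1 \<le> ln (real n)" by real_asymp
  have ev3: "\<forall>\<^sub>F n in sequentially. 4 * J + 4 \<le> n" by (rule eventually_ge_at_top)
  from ev1 ev2 ev3 have "\<forall>\<^sub>F n in sequentially. \<forall>r p. 0 \<le> r \<longrightarrow> r \<le> 1/4 \<longrightarrow> 0 \<le> p \<longrightarrow> p \<le> 1 \<longrightarrow>
     (1 + \<epsilon>) * ln (real n) \<le> real n * (pi * r\<^sup>2 * p) \<longrightarrow> real n * (pi * r\<^sup>2) \<le> C * ln (real n) \<longrightarrow>
     disconnect_prob n r p \<le> g n"
  proof (eventually_elim, intro allI impI)
    fix n :: nat and r p :: real
    assume e1: "C * ln (real n) / (pi * real n) < (17 / h')\<^sup>2" and ln1: "1 \<le> ln (real n)" and n4: "4 * J + 4 \<le> n"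
      and r: "0 \<le> r" "r \<le> 1/4" and p: "0 \<le> p" "p \<le> 1"
      and q1: "(1 + \<epsilon>) * ln (real n) \<le> real n * (pi * r\<^sup>2 * p)" and D: "real n * (pi * r\<^sup>2) \<le> C * ln (real n)"
    define L where "L = ln (real n)"
    have n: "0 < n" "real n > 0" using n4 by auto
    define q where "q = pi * r\<^sup>2 * p"
    have L1: "1 \<le> L" using ln1 by (simp add: L_def)
    have "0 < real n * (pi * r\<^sup>2 * p)" using q1 L1 \<epsilon> unfolding L_def by (smt (verit) mult_pos_pos)
    then have r0: "0 < r" and p0: "0 < p" using r p n by (auto simp: zero_less_mult_iff)
    have nr: "L \<le> real n * (pi * r\<^sup>2)"
    proof -
      have "L \<le> (1 + \<epsilon>) * L" using \<epsilon> L1 by (simp add: mult_le_cancel_right1)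
      also have "\<dots> \<le> real n * (pi * r\<^sup>2) * p" using q1 by (simp add: L_def mult.assoc)
      also have "\<dots> \<le> real n * (pi * r\<^sup>2) * 1" using p n by (intro mult_left_mono) auto
      finally show ?thesis by simp
    qed
    \<comment> \<open>Here the sparse hypothesis bounds p below: n q is at least ln n, while D is at
      most C ln n.\<close>
    have pC: "1 \<le> C * p"
    proof -
      have "L \<le> (1 + \<epsilon>) * L" using \<epsilon> L1 by (simp add: mult_le_cancel_right1)
      also have "\<dots> \<le> real n * (pi * r\<^sup>2) * p" using q1 by (simp add: L_def mult.assoc)
      also have "\<dots> \<le> (C * L) * p" using D p by (intro mult_right_mono) (auto simp: L_def)
      finally have "L * 1 \<le> L * (C * p)" by (simp add: mult_ac)
      then show ?thesis using L1 by (subst (asm) mult_le_cancel_left_pos) auto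
    qed
    \<comment> \<open>Rounding up 17 / r puts N r between 17 and 17 + r, safely inside the range
      from 33/2 to 19.\<close>
    define N where "N = nat \<lceil>17 / r\<rceil>"
    have N17: "17 / r \<le> real N" unfolding N_def by linarith
    have "real N < 17 / r + 1" using r0 unfolding N_def by (simp add: of_nat_nat) linarith
    then have "real N * r < (17 / r + 1) * r" using r0 by (intro mult_strict_right_mono)
    also have "\<dots> = 17 + r" using r0 by (simp add: distrib_right)
    finally have Nr18: "real N * r \<le> 18" using r by linarith
    have Nr17: "17 \<le> real N * r" using N17 r0 by (simp add: field_simps)
    have N0: "0 < real N" using N17 r0 by (smt (verit) divide_pos_pos)
    have rh: "r < 17 / h'"
    proof (rule power2_less_imp_less)
      have "r\<^sup>2 \<le> C * L / (pi * real n)" using D n by (simp add: field_simps L_def)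
      with e1 show "r\<^sup>2 < (17 / h')\<^sup>2" by (simp add: L_def)
    qed (use h' in simp)
    then have "h' < 17 / r" using r0 h' by (simp add: field_simps)
    then have "h' \<le> real N" using N17 by linarith
    then have Nh: "8 * h + 84 \<le> int N" unfolding h'_def by linarith
    have invN: "r\<^sup>2 / 324 \<le> 1 / (real N)\<^sup>2" "1 / (real N)\<^sup>2 \<le> r\<^sup>2"
    proof -
      have "(real N * r)\<^sup>2 \<le> 18\<^sup>2" using Nr18 r0 by (intro power_mono) auto
      then show "r\<^sup>2 / 324 \<le> 1 / (real N)\<^sup>2" using N0 by (simp add: field_simps power_mult_distrib)
      have "1\<^sup>2 \<le> (real N * r)\<^sup>2" using Nr17 by (intro power_mono) auto
      then show "1 / (real N)\<^sup>2 \<le> r\<^sup>2" using N0 by (simp add: field_simps power_mult_distrib)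
    qed
    define s where "s = real J * p\<^sup>2 / (real N)\<^sup>2"
    have s0: "0 \<le> s" by (simp add: s_def)
    have s1: "s \<le> 1"
    proof -
      have "int J \<le> int N" using Nh h_def by linarith
      then have "real J \<le> real N" by linarith
      also have "\<dots> \<le> (real N)\<^sup>2" using N0 self_le_power[of "real N" 2] by (cases N) auto
      finally have "real J * p\<^sup>2 \<le> (real N)\<^sup>2 * 1" using p by (intro mult_mono power_le_one) auto
      then show ?thesis using N0 by (simp add: s_def divide_le_eq_1)
    qed
    have ns: "6 * L \<le> s * real n"
    proof -
      have "7000 * C\<^sup>2 * p\<^sup>2 * (r\<^sup>2 / 324) \<le> real J * p\<^sup>2 * (1 / (real N)\<^sup>2)"
        using J invN by (intro mult_mono) auto
      moreover have "1 \<le> (C * p)\<^sup>2" using pC by (simp add: one_le_power)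
      then have "7000 * 1 * (r\<^sup>2 / 324) \<le> 7000 * (C * p)\<^sup>2 * (r\<^sup>2 / 324)"
        by (intro mult_right_mono mult_left_mono) auto
      ultimately have "7000 * r\<^sup>2 / 324 \<le> s" by (simp add: s_def power_mult_distrib)
      then have "7000 * r\<^sup>2 / 324 * real n \<le> s * real n" by (intro mult_right_mono) auto
      moreover have "6 * L \<le> 7000 * r\<^sup>2 / 324 * real n"
      proof -
        have "pi * (real n * r\<^sup>2) \<le> 16/5 * (real n * r\<^sup>2)"
          using pi_approx by (intro mult_right_mono) auto
        with nr have "L \<le> 16/5 * (real n * r\<^sup>2)" by (simp add: mult_ac)
        moreover have "0 \<le> real n * r\<^sup>2" by simp
        ultimately have "6 * L \<le> 7000 / 324 * (real n * r\<^sup>2)" by linarith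
        then show ?thesis by (simp add: mult_ac)
      qed
      ultimately show ?thesis by linarith
    qed
    have t1: "(1 - s) ^ (n - 2 * J) \<le> real n powr - 3"
    proof -
      have "(1 - s) ^ (n - 2 * J) \<le> exp (- (s * real (n - 2 * J)))" by (rule one_minus_power_le[OF s0 s1])
      also have "\<dots> \<le> exp (- (3 * L))"
      proof -
        have "real n / 2 \<le> real (n - 2 * J)" using n4 by (simp add: of_nat_diff)
        then have "s * (real n / 2) \<le> s * real (n - 2 * J)" using s0 by (rule mult_left_mono)
        with ns show ?thesis by simp
      qed
      also have "\<dots> = real n powr - 3" unfolding L_def by (rule powr_eq_exp[OF n(1)])
      finally show ?thesis .
    qed
    have q01: "0 \<le> q" "q \<le> 1"
    proof -
      show "0 \<le> q" using p by (simp add: q_def)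
      have "r\<^sup>2 \<le> (1/4)\<^sup>2" using r by (intro power_mono) auto
      then have "pi * r\<^sup>2 \<le> 4 * (1/4)\<^sup>2" using pi_less_4 by (intro mult_mono) auto
      then have "pi * r\<^sup>2 * p \<le> 1 * 1" using p by (intro mult_mono) (auto simp: power2_eq_square)
      then show "q \<le> 1" by (simp add: q_def)
    qed
    \<comment> \<open>Each exposed vertex missing from the exponent costs at most a factor e, as q
      <= 1.\<close>
    have qk: "(1 - q) ^ (n - k) \<le> exp (real k) * real n powr - (1 + \<epsilon>)" if "k \<le> n" for k
    proof -
      have "(1 - q) ^ (n - k) \<le> exp (- (q * real (n - k)))" by (rule one_minus_power_le[OF q01])
      also have "\<dots> \<le> exp (real k - (1 + \<epsilon>) * L)"
      proof -
        have "q * real k \<le> 1 * real k" using q01 by (intro mult_right_mono) auto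
        then show ?thesis using q1 that by (simp add: of_nat_diff algebra_simps L_def q_def)
      qed
      also have "\<dots> = exp (real k) * real n powr - (1 + \<epsilon>)"
        using n by (simp add: powr_def L_def exp_add[symmetric] algebra_simps)
      finally show ?thesis .
    qed
    have nr2: "real n * r\<^sup>2 \<le> C * L"
    proof -
      have "1 * (real n * r\<^sup>2) \<le> pi * (real n * r\<^sup>2)" using pi_gt3 by (intro mult_right_mono) auto
      with D show ?thesis by (simp add: L_def mult_ac)
    qed
    have A: "1 + real n * (of_int (2 * h + 21) / real N)\<^sup>2 \<le> 1 + b * L"
    proof -
      have "real n * (of_int (2 * h + 21) / real N)\<^sup>2 = (of_int (2 * h + 21))\<^sup>2 * (real n * (1 / (real N)\<^sup>2))"
        by (simp add: power_divide)
      also have "\<dots> \<le> (of_int (2 * h + 21))\<^sup>2 * (real n * r\<^sup>2)"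
        using invN by (intro mult_left_mono) auto
      also have "\<dots> \<le> (of_int (2 * h + 21))\<^sup>2 * (C * L)" using nr2 by (intro mult_left_mono) auto
      finally show ?thesis by (simp add: b_def mult.assoc)
    qed
    \<comment> \<open>From n r^2 >= 5/16 and N r <= 18: the constant 16/5 times 324 is below
      1100.\<close>
    have NN: "(real N)\<^sup>2 \<le> 1100 * real n"
    proof -
      have "1 \<le> real n * (pi * r\<^sup>2)" using nr L1 by linarith
      moreover have "pi * (real n * r\<^sup>2) \<le> 16/5 * (real n * r\<^sup>2)"
        using pi_approx by (intro mult_right_mono) auto
      ultimately have "1 \<le> 16/5 * (real n * r\<^sup>2)" by (simp add: mult_ac)
      then have "(real N)\<^sup>2 * 1 \<le> (real N)\<^sup>2 * (16/5 * (real n * r\<^sup>2))" by (intro mult_left_mono) auto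
      also have "\<dots> = 16/5 * real n * (real N * r)\<^sup>2" by (simp add: power_mult_distrib)
      also have "\<dots> \<le> 16/5 * real n * 18\<^sup>2" using Nr18 r0 by (intro mult_left_mono power_mono) auto
      finally show ?thesis using n by simp
    qed
    have "disconnect_prob n r p \<le>
     (real N)\<^sup>2 * (2 ^ card ({- h..h} \<times> {- h..h}) * (2 ^ (2 * J)) ^ J *
       ((real (2 * J) + 1) * (1 + real n * (of_int (2 * h + 21) / N)\<^sup>2) ^ (2 * J)) *
       (1 - s) ^ (n - 2 * J)) +
     (real n * (1 - q) ^ (n - 1) + (real n)\<^sup>2 * (2 * (of_int (2 * h + 1) / N)\<^sup>2 * (1 - q) ^ (n - 2)))"
      unfolding s_def q_def using Nr17 Nr18 s1
      by (intro prob_not_connected_sparse p r h_def Nh n) (auto simp: s_def)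
    also have "\<dots> \<le> g n"
      unfolding g_def add.assoc
    proof (intro add_mono)
      let ?A = "1 + real n * (of_int (2 * h + 21) / real N)\<^sup>2"
      have "(real N)\<^sup>2 * (2 ^ card ({- h..h} \<times> {- h..h}) * (2 ^ (2 * J)) ^ J * ((real (2 * J) + 1) * ?A ^ (2 * J)) * (1 - s) ^ (n - 2 * J)) =
          (real N)\<^sup>2 * (K * (?A ^ (2 * J) * (1 - s) ^ (n - 2 * J)))"
        by (simp only: K_def mult_ac)
      also have "\<dots> \<le> (1100 * real n) * (K * ((1 + b * L) ^ (2 * J) * real n powr - 3))"
        using NN A t1 K0 s1 by (intro mult_mono power_mono) auto
      also have "\<dots> = 1100 * K * ((1 + b * L) ^ (2 * J) / (real n)\<^sup>2)"
      proof -
        have "real n powr - 3 = inverse (real n ^ 3)"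
          using n by (simp add: powr_minus powr_numeral)
        then have w: "real n * real n powr - 3 = 1 / (real n)\<^sup>2"
          using n by (simp add: power3_eq_cube power2_eq_square divide_inverse)
        have "(1100 * real n) * (K * ((1 + b * L) ^ (2 * J) * real n powr - 3)) =
            1100 * K * ((1 + b * L) ^ (2 * J) * (real n * real n powr - 3))"
          by (simp only: mult_ac)
        then show ?thesis unfolding w by simp
      qed
      finally show "(real N)\<^sup>2 * (2 ^ card ({- h..h} \<times> {- h..h}) * (2 ^ (2 * J)) ^ J * ((real (2 * J) + 1) * ?A ^ (2 * J)) * (1 - s) ^ (n - 2 * J)) \<le>
        1100 * K * ((1 + b * ln (real n)) ^ (2 * J) / (real n)\<^sup>2)" unfolding L_def .
      have np: "real n * real n powr - (1 + \<epsilon>) = real n powr - \<epsilon>"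
        using n by (simp add: powr_add powr_minus powr_diff field_simps)
      have "real n * (1 - q) ^ (n - 1) \<le> real n * (exp (real 1) * real n powr - (1 + \<epsilon>))"
        using n4 by (intro mult_left_mono qk) auto
      also have "\<dots> = exp 1 * real n powr - \<epsilon>" using np by (simp add: mult_ac)
      finally show "real n * (1 - q) ^ (n - 1) \<le> exp 1 * real n powr - \<epsilon>" .
      \<comment> \<open>One factor n is paired with 1 / N^2, turning it into O(ln n); only the other
        one faces n^(-1-\<epsilon>).\<close>
      have "(real n)\<^sup>2 * (2 * (of_int (2 * h + 1) / N)\<^sup>2 * (1 - q) ^ (n - 2)) =
         2 * (of_int (2 * h + 1))\<^sup>2 * (real n * (1 / (real N)\<^sup>2)) * (real n * (1 - q) ^ (n - 2))"
        by (simp add: power_divide power2_eq_square)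
      also have "\<dots> \<le> 2 * (of_int (2 * h + 1))\<^sup>2 * (C * L) * (real n * (exp (real 2) * real n powr - (1 + \<epsilon>)))"
      proof -
        have "real n * (1 / (real N)\<^sup>2) \<le> real n * r\<^sup>2" using invN by (intro mult_left_mono) auto
        with nr2 have a1: "real n * (1 / (real N)\<^sup>2) \<le> C * L" by linarith
        have a2: "real n * (1 - q) ^ (n - 2) \<le> real n * (exp (real 2) * real n powr - (1 + \<epsilon>))"
          using n4 by (intro mult_left_mono qk) auto
        have "0 \<le> C * L" using C L1 by simp
        then show ?thesis using q01 by (intro mult_mono[OF mult_left_mono[OF a1] a2]) auto
      qed
      also have "\<dots> = exp 2 * (2 * (of_int (2 * h + 1))\<^sup>2 * C) * L * real n powr - \<epsilon>"
        unfolding np[symmetric] by simp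
      finally show "(real n)\<^sup>2 * (2 * (of_int (2 * h + 1) / N)\<^sup>2 * (1 - q) ^ (n - 2)) \<le>
        exp 2 * (2 * (of_int (2 * h + 1))\<^sup>2 * C) * ln (real n) * real n powr - \<epsilon>" unfolding L_def .
    qed
    finally show "disconnect_prob n r p \<le> g n" .
  qed
  with g show ?thesis by blast
qed

subsection \<open>Concentration of the number of points in a cell\<close>

abbreviation cells :: "nat \<Rightarrow> (int \<times> int) set" where
  "cells N \<equiv> {0..<int N} \<times> {0..<int N}"

text \<open>The quadratic lower bound for exp x is inverted by the identity (1 - x + x^2/2) (1 + x +
  x^2/2) = 1 + x^4/4.\<close>

lemma exp_minus_le:
  assumes "0 \<le> (x :: real)" shows "exp (- x) \<le> 1 - x + x\<^sup>2 / 2"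
proof -
  have pos: "0 < 1 + x + x\<^sup>2 / 2" using assms by (smt (verit) zero_le_power2 divide_nonneg_nonneg)
  have "exp (- x) = 1 / exp x" by (simp add: exp_minus divide_inverse)
  also have "\<dots> \<le> 1 / (1 + x + x\<^sup>2 / 2)"
    using exp_lower_Taylor_quadratic[OF assms] pos by (intro divide_left_mono) auto
  also have "\<dots> \<le> 1 - x + x\<^sup>2 / 2"
  proof -
    have "(1 - x + x\<^sup>2 / 2) * (1 + x + x\<^sup>2 / 2) = 1 + (x\<^sup>2)\<^sup>2 / 4"
      by (simp add: field_simps power2_eq_square)
    then have "1 \<le> (1 - x + x\<^sup>2 / 2) * (1 + x + x\<^sup>2 / 2)" by simp
    then show ?thesis using pos by (simp add: pos_divide_le_eq)
  qed
  finally show ?thesis .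
qed

definition pts :: "nat \<Rightarrow> (nat \<Rightarrow> real \<times> real) \<Rightarrow> (real \<times> real) set \<Rightarrow> nat set" where
  "pts n X B = {v. v < n \<and> X v \<in> B}"

lemma finite_pts[simp]: "finite (pts n X B)"
  by (simp add: pts_def)

lemma pred_pts:
  assumes B: "B \<in> sets borel"
  shows "Measurable.pred (uniform_points n) (\<lambda>X. real (card (pts n X B)) \<le> a)"
proof -
  have "pts n X B = {..<n} \<inter> {v. X v \<in> B}" for X
    by (auto simp: pts_def)
  then have e: "real (card (pts n X B)) = (\<Sum>v<n. indicator B (X v))" for X
    by (simp add: indicator_def sum.If_cases)
  have "(\<lambda>X. \<Sum>v<n. indicator B (X v) :: real) \<in> borel_measurable (uniform_points n)"
    using B by (intro borel_measurable_sum measurable_compose[OF point_measurable borel_measurable_indicator]) auto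
  then show ?thesis unfolding e by measurable
qed

text \<open>Exponential Markov inequality. The tilt \<delta> in place of the optimal -ln (1 -
  \<delta>) already gives the exponent \<delta> (1 - \<delta>) n \<mu> - n \<mu> (\<delta> -
  \<delta>^2 / 2) = -\<delta>^2 n \<mu> / 2.\<close>

lemma chernoff_lower:
  assumes B: "B \<in> sets borel" and \<delta>: "0 \<le> \<delta>" and \<mu>: "measure unif_sq B = \<mu>"
  shows "emeasure (uniform_points n) {X \<in> space (uniform_points n). real (card (pts n X B)) \<le> (1 - \<delta>) * (real n * \<mu>)} \<le>
    ennreal (exp (- (\<delta>\<^sup>2 * (real n * \<mu>) / 2)))"
proof -
  interpret unif: prob_space unif_sq by (rule prob_space_unif_sq)
  define a where "a = (1 - \<delta>) * (real n * \<mu>)"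
  let ?A = "{X \<in> space (uniform_points n). real (card (pts n X B)) \<le> a}"
  define \<phi> where "\<phi> y = ennreal (exp (- (\<delta> * indicator B y)))" for y
  have \<mu>01: "0 \<le> \<mu>" "\<mu> \<le> 1" using \<mu> by auto
  have m[measurable]: "\<phi> \<in> borel_measurable unif_sq"
  proof -
    have f: "exp (- (\<delta> * indicator B y)) = 1 - (1 - exp (- \<delta>)) * indicator B y" for y
      by (simp add: indicator_def)
    show ?thesis
      unfolding \<phi>_def f using B
      by (intro measurable_compose[OF _ measurable_ennreal] borel_measurable_diff
        borel_measurable_times borel_measurable_const borel_measurable_indicator) simp
  qed
  have "emeasure (uniform_points n) ?A = (\<integral>\<^sup>+X. indicator ?A X \<partial>uniform_points n)"
    using pred_pts[OF B] by (simp add: pred_def)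
  also have "\<dots> \<le> (\<integral>\<^sup>+X. ennreal (exp (\<delta> * a)) * (\<Prod>v\<in>{..<n} - {}. \<phi> (X v)) \<partial>uniform_points n)"
  proof (intro nn_integral_mono)
    fix X
    have "(\<Prod>v<n. exp (- (\<delta> * indicator B (X v)))) = exp (- (\<delta> * real (card (pts n X B))))"
      by (simp add: exp_sum[symmetric] sum_negf sum_distrib_left[symmetric] pts_def indicator_def sum.If_cases Int_def of_bool_def)
    then have "ennreal (exp (\<delta> * a)) * (\<Prod>v\<in>{..<n} - {}. \<phi> (X v)) = ennreal (exp (\<delta> * a) * exp (- (\<delta> * real (card (pts n X B)))))"
      by (simp add: \<phi>_def prod_ennreal ennreal_mult'[symmetric])
    also have "\<dots> = ennreal (exp (\<delta> * (a - real (card (pts n X B)))))"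
      by (simp add: exp_add[symmetric] algebra_simps)
    finally have e: "ennreal (exp (\<delta> * a)) * (\<Prod>v\<in>{..<n} - {}. \<phi> (X v)) = \<dots>" .
    show "indicator ?A X \<le> ennreal (exp (\<delta> * a)) * (\<Prod>v\<in>{..<n} - {}. \<phi> (X v))"
      unfolding e using \<delta> by (auto simp: indicator_def simp del: ennreal_1 simp flip: ennreal_1)
  qed
  also have "\<dots> = (\<integral>\<^sup>+x. ennreal (exp (\<delta> * a)) * (\<integral>\<^sup>+y. \<phi> y \<partial>unif_sq) ^ card ({..<n} - {}) \<partial>PiM ({} :: nat set) (\<lambda>_. unif_sq))"
    unfolding uniform_points_eq
    by (rule nn_integral_PiM_split[where V = "{..<n}" and U = "{}" and Q = unif_sq and
          g = "\<lambda>_. ennreal (exp (\<delta> * a))" and \<phi> = "\<lambda>_. \<phi>", OF _ _ prob_space_unif_sq])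
       (auto intro: measurable_compose[OF measurable_snd m] simp: case_prod_beta)
  also have "\<dots> \<le> (\<integral>\<^sup>+x. ennreal (exp (\<delta> * a)) * ennreal (exp (- (\<mu> * (\<delta> - \<delta>\<^sup>2 / 2)))) ^ card ({..<n} - {}) \<partial>PiM ({} :: nat set) (\<lambda>_. unif_sq))"
  proof (intro nn_integral_mono mult_left_mono power_mono)
    have f: "exp (- (\<delta> * indicator B y)) = 1 - (1 - exp (- \<delta>)) * indicator B y" for y
      by (simp add: indicator_def)
    have "(\<integral>\<^sup>+y. \<phi> y \<partial>unif_sq) = ennreal (\<integral>y. 1 - (1 - exp (- \<delta>)) * indicator B y \<partial>unif_sq)"
      unfolding \<phi>_def f using B \<delta>
      by (intro nn_integral_eq_integral Bochner_Integration.integrable_diff integrable_mult_right integrable_real_indicator)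
         (auto simp: indicator_def less_top[symmetric])
    also have "(\<integral>y. 1 - (1 - exp (- \<delta>)) * indicator B y \<partial>unif_sq) = 1 - (1 - exp (- \<delta>)) * \<mu>"
      using B \<mu> unif.prob_space
      by (subst Bochner_Integration.integral_diff) (auto simp: less_top[symmetric])
    also have "\<dots> \<le> 1 + - (\<mu> * (\<delta> - \<delta>\<^sup>2 / 2))"
      using mult_right_mono[OF exp_minus_le[OF \<delta>] \<mu>01(1)] by (simp add: algebra_simps)
    also have "\<dots> \<le> exp (- (\<mu> * (\<delta> - \<delta>\<^sup>2 / 2)))" by (rule exp_ge_add_one_self)
    finally show "(\<integral>\<^sup>+y. \<phi> y \<partial>unif_sq) \<le> ennreal (exp (- (\<mu> * (\<delta> - \<delta>\<^sup>2 / 2))))"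
      by (simp add: ennreal_leI)
  qed auto
  also have "\<dots> = ennreal (exp (\<delta> * a)) * ennreal (exp (- (\<mu> * (\<delta> - \<delta>\<^sup>2 / 2)))) ^ n"
    by (simp add: PiM_empty)
  also have "\<dots> = ennreal (exp (\<delta> * a) * exp (- (real n * (\<mu> * (\<delta> - \<delta>\<^sup>2 / 2)))))"
    by (simp add: ennreal_power ennreal_mult'[symmetric] exp_of_nat_mult[symmetric])
  also have "exp (\<delta> * a) * exp (- (real n * (\<mu> * (\<delta> - \<delta>\<^sup>2 / 2)))) = exp (- (\<delta>\<^sup>2 * (real n * \<mu>) / 2))"
    by (simp add: exp_add[symmetric] a_def field_simps power2_eq_square)
  finally show ?thesis unfolding a_def .
qed

subsection \<open>Components when all cells are well filled\<close>

lemma torus_dist_triangle_le: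
  assumes "torus_dist x y \<le> \<rho>" "torus_dist y z \<le> \<sigma>" "\<rho> < 1/2" "\<sigma> < 1/2"
  shows "torus_dist x z \<le> \<rho> + \<sigma>"
proof -
  obtain a b where ab: "dist x (y + shift a b) \<le> \<rho>" using assms torus_dist_le_iff by blast
  obtain c d where cd: "dist y (z + shift c d) \<le> \<sigma>" using assms torus_dist_le_iff by blast
  have "dist (y + shift a b) (z + shift (c + a) (d + b)) \<le> \<sigma>"
    using cd by (simp only: shift_add[symmetric] dist_add_cancel2)
  then have "dist x (z + shift (c + a) (d + b)) \<le> \<rho> + \<sigma>"
    using ab dist_triangle[of x "z + shift (c + a) (d + b)" "y + shift a b"] by linarith
  then show ?thesis using torus_dist_le_dist[of x z "c + a" "d + b"] by linarith
qed

text \<open>The cells that meet the disc of radius \<rho> cover it, so by area there are at least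
  N^2 pi \<rho>^2 of them. A cell has diameter at most 3 / (2 N), so they all lie in the disc of
  radius r.\<close>

lemma ball_cells:
  assumes N: "0 < N" and \<rho>: "0 \<le> \<rho>" "\<rho> + 3 / (2 * real N) \<le> r" "r < 1/2"
  shows "\<exists>K \<subseteq> cells N. real N ^ 2 * (pi * \<rho>\<^sup>2) \<le> real (card K) \<and>
     (\<forall>c\<in>K. \<forall>y\<in>block N 0 (fst c) (snd c). torus_dist x y \<le> r)"
proof -
  interpret unif: prob_space unif_sq by (rule prob_space_unif_sq)
  define K where "K = {c \<in> cells N. \<exists>y\<in>block N 0 (fst c) (snd c). torus_dist x y \<le> \<rho>}"
  have fK: "finite K" unfolding K_def by (rule finite_subset[of _ "cells N"]) auto
  have N3: "0 < 3 / (2 * real N)" using N by simp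
  have "{y. torus_dist x y \<le> \<rho>} \<subseteq> (\<Union>c\<in>K. block N 0 (fst c) (snd c))"
  proof
    fix y assume y: "y \<in> {y. torus_dist x y \<le> \<rho>}"
    define c where "c = (grid_x N y mod int N, grid_y N y mod int N)"
    have yc: "y \<in> block N 0 (fst c) (snd c)" unfolding c_def fst_conv snd_conv block_mod[OF N] by (rule block_self[OF N])
    moreover have "c \<in> cells N" using N by (simp add: c_def)
    ultimately have "c \<in> K" using y unfolding K_def by blast
    with yc show "y \<in> (\<Union>c\<in>K. block N 0 (fst c) (snd c))" by blast
  qed
  then have "unif.prob {y. torus_dist x y \<le> \<rho>} \<le> unif.prob (\<Union>c\<in>K. block N 0 (fst c) (snd c))"
    using fK by (intro unif.finite_measure_mono) auto
  also have "\<dots> \<le> (\<Sum>c\<in>K. 1 / (real N)\<^sup>2)"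
    using N by (intro unif.prob_UN_le fK) (auto simp: measure_block power_divide)
  also have "unif.prob {y. torus_dist x y \<le> \<rho>} = pi * \<rho>\<^sup>2"
    using emeasure_torus_ball[of \<rho> x] \<rho> N3 by (simp add: measure_def)
  finally have "real N ^ 2 * (pi * \<rho>\<^sup>2) \<le> real (card K)"
    using N by (simp add: field_simps)
  moreover have "torus_dist x y \<le> r" if c: "c \<in> K" and y: "y \<in> block N 0 (fst c) (snd c)" for c y
  proof -
    obtain y' where y': "y' \<in> block N 0 (fst c) (snd c)" "torus_dist x y' \<le> \<rho>" using c unfolding K_def by blast
    have "torus_dist y' y \<le> 3 / (2 * real N)" using block_dist[OF N y'(1) y] by simp
    from torus_dist_triangle_le[OF y'(2) this] \<rho> N3 show ?thesis by linarith
  qed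
  moreover have "K \<subseteq> cells N" unfolding K_def by blast
  ultimately show ?thesis by blast
qed

definition cross_pairs :: "nat set \<Rightarrow> nat set \<Rightarrow> nat set set" where
  "cross_pairs A B = (\<lambda>(u, v). {u, v}) ` (A \<times> B)"

lemma card_cross_pairs:
  assumes "A \<inter> B = {}" shows "card (cross_pairs A B) = card A * card B"
proof -
  have "inj_on (\<lambda>(u, v). {u, v}) (A \<times> B)" using assms by (auto simp: inj_on_def doubleton_eq_iff)
  then show ?thesis by (simp add: cross_pairs_def card_image card_cartesian_product)
qed

lemma grid_connected:
  fixes P :: "int \<Rightarrow> int \<Rightarrow> bool"
  assumes P0: "P i0 j0" "i0 \<in> {0..<M}" "j0 \<in> {0..<M}"
    and step: "\<And>i j i' j'. P i j \<Longrightarrow> i \<in> {0..<M} \<Longrightarrow> j \<in> {0..<M} \<Longrightarrow> i' \<in> {0..<M} \<Longrightarrow> j' \<in> {0..<M} \<Longrightarrow>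
      \<bar>i - i'\<bar> \<le> 1 \<Longrightarrow> \<bar>j - j'\<bar> \<le> 1 \<Longrightarrow> P i' j'"
    and ij: "i \<in> {0..<M}" "j \<in> {0..<M}"
  shows "P i j"
proof -
  have "i \<in> {0..<M} \<longrightarrow> P i j0"
  proof (induction i rule: int_induct[where k = i0])
    case (step1 i)
    then show ?case using step[of i j0 "i + 1" j0] P0 by auto
  next
    case (step2 i)
    then show ?case using step[of i j0 "i - 1" j0] P0 by auto
  qed (use P0 in simp)
  with ij have Pi: "P i j0" by blast
  have "j \<in> {0..<M} \<longrightarrow> P i j"
  proof (induction j rule: int_induct[where k = j0])
    case (step1 j)
    then show ?case using step[of i j i "j + 1"] P0 ij by auto
  next
    case (step2 j)
    then show ?case using step[of i j i "j - 1"] P0 ij by auto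
  qed (use Pi in simp)
  with ij show ?thesis by blast
qed

abbreviation cellpts :: "nat \<Rightarrow> nat \<Rightarrow> (nat \<Rightarrow> real \<times> real) \<Rightarrow> int \<times> int \<Rightarrow> nat set" where
  "cellpts n N X c \<equiv> pts n X (block N 0 (fst c) (snd c))"

text \<open>Only coins are tested: points in adjacent cells are within r anyway once 3 / N <= r.
  Adjacency includes c = c' and does not wrap around, as the plain square grid is already
  connected.\<close>

definition unmixed :: "nat \<Rightarrow> nat \<Rightarrow> real \<Rightarrow> (nat \<Rightarrow> real \<times> real) \<Rightarrow> (nat set \<Rightarrow> bool) \<Rightarrow> bool" where
  "unmixed n N \<delta> X C \<longleftrightarrow> (\<forall>c\<in>cells N. \<forall>c'\<in>cells N.
     \<forall>A\<in>Pow (cellpts n N X c). \<forall>B\<in>Pow (cellpts n N X c'). A \<inter> B = {} \<and>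
      \<delta> * card (cellpts n N X c) \<le> card A \<and> \<delta> * card (cellpts n N X c') \<le> card B \<and>
      \<bar>fst c - fst c'\<bar> \<le> 1 \<and> \<bar>snd c - snd c'\<bar> \<le> 1 \<longrightarrow> \<not> (\<forall>e\<in>cross_pairs A B. \<not> C e))"

text \<open>If \<open>S\<close> holds a fraction \<delta> of one cell, then its complement holds
  less than \<delta> of each adjacent cell, as otherwise an edge would leave \<open>S\<close>. Since
  \<delta> <= 1/2, \<open>S\<close> is heavy there too, and heaviness spreads over the whole grid.
  The case c = c' then makes the complement light everywhere.\<close>

lemma light_or_colight:
  assumes N: "0 < N" and r: "3 / real N \<le> r" and \<delta>: "0 \<le> \<delta>" "\<delta> \<le> 1/2" and um: "unmixed n N \<delta> X C"
    and S: "edge_closed n r (X, C) S"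
  shows "(\<forall>c\<in>cells N. real (card (S \<inter> cellpts n N X c)) \<le> \<delta> * card (cellpts n N X c)) \<or>
    (\<forall>c\<in>cells N. real (card (({..<n} - S) \<inter> cellpts n N X c)) \<le> \<delta> * card (cellpts n N X c))"
proof -
  let ?G = "cells N"
  have key: "real (card (cellpts n N X c' - S)) < \<delta> * card (cellpts n N X c')"
    if c: "c \<in> ?G" "c' \<in> ?G" "\<bar>fst c - fst c'\<bar> \<le> 1" "\<bar>snd c - snd c'\<bar> \<le> 1"
      and a: "\<delta> * card (cellpts n N X c) \<le> card (S \<inter> cellpts n N X c)" for c c'
  proof (rule ccontr)
    let ?A = "S \<inter> cellpts n N X c" and ?B = "cellpts n N X c' - S"
    assume "\<not> real (card ?B) < \<delta> * card (cellpts n N X c')"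
    then have b: "\<delta> * card (cellpts n N X c') \<le> card ?B" by simp
    have "?A \<in> Pow (cellpts n N X c)" "?B \<in> Pow (cellpts n N X c')" "?A \<inter> ?B = {}" by auto
    with um c a b have "\<not> (\<forall>e\<in>cross_pairs ?A ?B. \<not> C e)" unfolding unmixed_def by blast
    then obtain u v where uv: "u \<in> ?A" "v \<in> ?B" "C {u, v}" by (auto simp: cross_pairs_def)
    have "X u \<in> block N 1 (fst c') (snd c')"
      using block_mono_shift[OF N, of "X u" 0 "fst c'" "fst c - fst c'" "snd c'" "snd c - snd c'" 1] uv c
      by (simp add: pts_def)
    moreover have "X v \<in> block N 0 (fst c') (snd c')" using uv by (simp add: pts_def)
    ultimately have "torus_dist (X u) (X v) \<le> 3/2 * (of_int (1 + 1) / real N)" by (rule block_dist[OF N])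
    also have "\<dots> = 3 / real N" by simp
    also have "\<dots> \<le> r" by (rule r)
    finally have "edge n r (X, C) u v" using uv by (auto simp: edge_iff pts_def)
    with S uv show False unfolding edge_closed_def pts_def by auto
  qed
  show ?thesis
  proof (cases "\<forall>c\<in>?G. real (card (S \<inter> cellpts n N X c)) \<le> \<delta> * card (cellpts n N X c)")
    case False
    then obtain i0 j0 where 0: "i0 \<in> {0..<int N}" "j0 \<in> {0..<int N}"
      "\<delta> * card (cellpts n N X (i0, j0)) \<le> card (S \<inter> cellpts n N X (i0, j0))" by force
    have heavy: "\<delta> * card (cellpts n N X (i, j)) \<le> card (S \<inter> cellpts n N X (i, j))"
      if "i \<in> {0..<int N}" "j \<in> {0..<int N}" for i j
    proof (rule grid_connected[where P = "\<lambda>i j. \<delta> * card (cellpts n N X (i, j)) \<le> card (S \<inter> cellpts n N X (i, j))", OF 0(3,1,2) _ that])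
      fix i j i' j' assume a: "\<delta> * card (cellpts n N X (i, j)) \<le> card (S \<inter> cellpts n N X (i, j))"
        "i \<in> {0..<int N}" "j \<in> {0..<int N}" "i' \<in> {0..<int N}" "j' \<in> {0..<int N}" "\<bar>i - i'\<bar> \<le> 1" "\<bar>j - j'\<bar> \<le> 1"
      let ?t = "cellpts n N X (i', j')"
      have "real (card (?t - S)) < \<delta> * card ?t" using key[of "(i, j)" "(i', j')"] a by simp
      moreover have "card ?t = card (S \<inter> ?t) + card (?t - S)"
      proof -
        have "?t = (S \<inter> ?t) \<union> (?t - S)" by blast
        moreover have "card ((S \<inter> ?t) \<union> (?t - S)) = card (S \<inter> ?t) + card (?t - S)"
          by (rule card_Un_disjoint) auto
        ultimately show ?thesis by simp
      qed
      moreover have "2 * (\<delta> * card ?t) \<le> card ?t" using mult_right_mono[of "2 * \<delta>" 1 "card ?t"] \<delta> by simp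
      ultimately show "\<delta> * card ?t \<le> card (S \<inter> ?t)" by linarith
    qed
    have "real (card (({..<n} - S) \<inter> cellpts n N X c)) \<le> \<delta> * card (cellpts n N X c)" if "c \<in> ?G" for c
    proof -
      have "({..<n} - S) \<inter> cellpts n N X c = cellpts n N X c - S" by (auto simp: pts_def)
      moreover have "real (card (cellpts n N X c - S)) < \<delta> * card (cellpts n N X c)"
        using key[of c c] heavy[of "fst c" "snd c"] that by auto
      ultimately show ?thesis by simp
    qed
    then show ?thesis by blast
  qed blast
qed

text \<open>Unordered pairs, because each of them is one coin that must show tails when
  \<open>S\<close> is a union of components.\<close>

definition boundary_pairs :: "nat \<Rightarrow> real \<Rightarrow> (nat \<Rightarrow> real \<times> real) \<Rightarrow> nat set \<Rightarrow> nat set set" where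
  "boundary_pairs n r X S = (\<lambda>(u, v). {u, v}) ` {(u, v). u \<in> S \<and> v \<in> {..<n} - S \<and> torus_dist (X u) (X v) \<le> r}"

text \<open>Of the two factors 1 - \<delta>, one comes from the filling of the cells and one from
  removing the share of \<open>S\<close> in each cell. Different (u, v) give different pairs because
  only u lies in \<open>S\<close>.\<close>

lemma card_boundary_pairs:
  fixes \<delta> \<rho> r :: real
  assumes N: "0 < N" and \<rho>: "0 \<le> \<rho>" "\<rho> + 3 / (2 * real N) \<le> r" "r < 1/2" and \<delta>: "0 \<le> \<delta>" "\<delta> \<le> 1"
    and S: "S \<subseteq> {..<n}"
    and light: "\<forall>c\<in>cells N. real (card (S \<inter> cellpts n N X c)) \<le> \<delta> * card (cellpts n N X c)"
    and full: "\<forall>c\<in>cells N. (1 - \<delta>) * (real n / (real N)\<^sup>2) \<le> card (cellpts n N X c)"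
  shows "real (card S) * ((1 - \<delta>)\<^sup>2 * (real n * (pi * \<rho>\<^sup>2))) \<le> card (boundary_pairs n r X S)"
proof -
  have fS: "finite S" using S finite_subset by blast
  define nb where "nb u = {v. v \<in> {..<n} - S \<and> torus_dist (X u) (X v) \<le> r}" for u
  have inj: "inj_on (\<lambda>(u, v). {u, v}) (Sigma S nb)"
    by (auto simp: inj_on_def doubleton_eq_iff nb_def)
  have "boundary_pairs n r X S = (\<lambda>(u, v). {u, v}) ` Sigma S nb"
    unfolding boundary_pairs_def nb_def by (rule arg_cong[where f = "image _"]) auto
  then have cb: "card (boundary_pairs n r X S) = (\<Sum>u\<in>S. card (nb u))"
    using inj fS by (simp add: card_image nb_def)
  have "(1 - \<delta>)\<^sup>2 * (real n * (pi * \<rho>\<^sup>2)) \<le> real (card (nb u))" for u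
  proof -
    obtain K where K: "K \<subseteq> cells N" "real N ^ 2 * (pi * \<rho>\<^sup>2) \<le> real (card K)"
       "\<forall>c\<in>K. \<forall>y\<in>block N 0 (fst c) (snd c). torus_dist (X u) y \<le> r"
      using ball_cells[OF N \<rho>] by blast
    have fK: "finite K" using K(1) finite_subset by blast
    have each: "(1 - \<delta>)\<^sup>2 * (real n / (real N)\<^sup>2) \<le> real (card (cellpts n N X c - S))" if "c \<in> K" for c
    proof -
      let ?t = "cellpts n N X c"
      have cG: "c \<in> cells N" using that K by blast
      have "card ?t = card (S \<inter> ?t) + card (?t - S)"
      proof -
        have "?t = (S \<inter> ?t) \<union> (?t - S)" by blast
        moreover have "card ((S \<inter> ?t) \<union> (?t - S)) = card (S \<inter> ?t) + card (?t - S)"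
          by (rule card_Un_disjoint) auto
        ultimately show ?thesis by simp
      qed
      then have "(1 - \<delta>) * card ?t \<le> real (card (?t - S))"
      proof -
        have "real (card (S \<inter> ?t)) \<le> \<delta> * card ?t" using light cG by blast
        moreover have "real (card ?t) = real (card (S \<inter> ?t)) + real (card (?t - S))"
          using \<open>card ?t = _\<close> by linarith
        ultimately show ?thesis unfolding left_diff_distrib by linarith
      qed
      moreover have "(1 - \<delta>) * ((1 - \<delta>) * (real n / (real N)\<^sup>2)) \<le> (1 - \<delta>) * card ?t"
        using full cG \<delta> by (intro mult_left_mono) auto
      ultimately show ?thesis by (simp add: power2_eq_square mult.assoc)
    qed
    have "(1 - \<delta>)\<^sup>2 * (real n * (pi * \<rho>\<^sup>2)) = (real N ^ 2 * (pi * \<rho>\<^sup>2)) * ((1 - \<delta>)\<^sup>2 * (real n / (real N)\<^sup>2))"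
      using N by (simp add: field_simps)
    also have "\<dots> \<le> real (card K) * ((1 - \<delta>)\<^sup>2 * (real n / (real N)\<^sup>2))"
      using K(2) by (intro mult_right_mono) auto
    also have "\<dots> \<le> (\<Sum>c\<in>K. real (card (cellpts n N X c - S)))"
      using sum_mono[of K "\<lambda>_. (1 - \<delta>)\<^sup>2 * (real n / (real N)\<^sup>2)", OF each] by simp
    also have "\<dots> = real (card (\<Union>c\<in>K. cellpts n N X c - S))"
    proof -
      have "card (\<Union>c\<in>K. cellpts n N X c - S) = (\<Sum>c\<in>K. card (cellpts n N X c - S))"
      proof (intro card_UN_disjoint ballI impI fK)
        fix c d assume cd: "c \<in> K" "d \<in> K" "c \<noteq> d"
        have False if "v \<in> cellpts n N X c" "v \<in> cellpts n N X d" for v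
        proof -
          have "X v \<in> block N 0 (fst c) (snd c)" "X v \<in> block N 0 (fst d) (snd d)" using that by (auto simp: pts_def)
          moreover have "c \<in> cells N" "d \<in> cells N" using cd K by blast+
          then have "\<bar>fst c - fst d\<bar> < int N" "\<bar>snd c - snd d\<bar> < int N" by (auto simp: mem_Times_iff)
          ultimately have "fst c = fst d \<and> snd c = snd d" by (rule block_0_unique[OF N])
          with cd show False by (auto simp: prod_eq_iff)
        qed
        then show "(cellpts n N X c - S) \<inter> (cellpts n N X d - S) = {}" by blast
      qed auto
      then show ?thesis by simp
    qed
    also have "\<dots> \<le> real (card (nb u))"
      using K(3) by (intro of_nat_mono card_mono) (auto simp: nb_def pts_def)
    finally show ?thesis .
  qed
  then have "(\<Sum>u\<in>S. (1 - \<delta>)\<^sup>2 * (real n * (pi * \<rho>\<^sup>2))) \<le> (\<Sum>u\<in>S. real (card (nb u)))"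
    by (intro sum_mono)
  then show ?thesis using cb by simp
qed

section \<open>Union bounds over the coins for fixed, well-spread positions\<close>

lemma prob_no_coin_exp:
  assumes p: "0 \<le> p" "p \<le> 1" and E: "E \<subseteq> vertex_pairs n" and m: "m \<le> real (card E)"
  shows "measure (edge_coins n p) {C \<in> space (edge_coins n p). \<forall>e\<in>E. \<not> C e} \<le> exp (- (p * m))"
proof -
  have "(1 - p) ^ card E \<le> exp (- p) ^ card E"
    using p exp_ge_add_one_self[of "- p"] by (intro power_mono) auto
  also have "\<dots> = exp (- (p * real (card E)))" by (simp add: exp_of_nat_mult[symmetric] mult.commute)
  also have "\<dots> \<le> exp (- (p * m))" using p m by (simp add: mult_left_mono)
  finally show ?thesis using prob_no_coin[OF p E] by simp
qed

lemma no_coin_event: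
  assumes "E \<subseteq> vertex_pairs n"
  shows "{C \<in> space (edge_coins n p). \<forall>e\<in>E. \<not> C e} \<in> sets (edge_coins n p)"
proof -
  have "finite E" using assms finite_subset finite_vertex_pairs by blast
  then have "Measurable.pred (edge_coins n p) (\<lambda>C. \<forall>e\<in>E. \<not> C e)"
    using assms by (intro pred_intros_finite pred_intros_logic coin_pred_measurable) auto
  then show ?thesis by (simp add: pred_def)
qed

text \<open>Cells with t and t' points offer at most 2^(t+t') choices of subsets, while a choice
  fails with probability at most exp (-2 (t + t')). The measurable superset \<open>F\<close> serves
  in place of the failure event in probability estimates.\<close>

lemma prob_mixed:
  fixes \<delta> p \<tau> :: real
  assumes p: "0 \<le> p" "p \<le> 1" and \<delta>: "0 \<le> \<delta>"
    and full: "\<forall>c\<in>cells N. \<tau> \<le> card (cellpts n N X c)" and \<tau>: "4 \<le> p * \<delta>\<^sup>2 * \<tau>" "0 \<le> \<tau>"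
  shows "\<exists>F\<in>sets (edge_coins n p). {C \<in> space (edge_coins n p). \<not> unmixed n N \<delta> X C} \<subseteq> F \<and>
    measure (edge_coins n p) F \<le> real N ^ 4 * exp (- (2 * \<tau>))"
proof -
  interpret E: prob_space "edge_coins n p" by (rule prob_space_edge_coins)
  let ?G = "cells N"
  let ?t = "\<lambda>c. cellpts n N X c"
  define AB where "AB c c' = {(A, B). A \<subseteq> ?t c \<and> B \<subseteq> ?t c' \<and> A \<inter> B = {} \<and> \<delta> * card (?t c) \<le> card A \<and> \<delta> * card (?t c') \<le> card B}" for c c'
  define F0 where "F0 A B = {C \<in> space (edge_coins n p). \<forall>e\<in>cross_pairs A B. \<not> C e}" for A B
  have fAB: "finite (AB c c')" and cAB: "card (AB c c') \<le> 2 ^ (card (?t c) + card (?t c'))" for c c'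
  proof -
    have sub: "AB c c' \<subseteq> Pow (?t c) \<times> Pow (?t c')" by (auto simp: AB_def)
    show "finite (AB c c')" by (rule finite_subset[OF sub]) auto
    have "card (AB c c') \<le> card (Pow (?t c) \<times> Pow (?t c'))" by (rule card_mono[OF _ sub]) auto
    then show "card (AB c c') \<le> 2 ^ (card (?t c) + card (?t c'))"
      by (simp add: card_cartesian_product card_Pow power_add)
  qed
  have ev: "F0 A B \<in> E.events" and pr: "E.prob (F0 A B) \<le> exp (- (2 * (real (card (?t c)) + real (card (?t c')))))"
    if c: "c \<in> ?G" "c' \<in> ?G" and AB: "(A, B) \<in> AB c c'" for A B c c'
  proof -
    have vp: "cross_pairs A B \<subseteq> vertex_pairs n"
      using AB by (auto simp: cross_pairs_def AB_def pts_def intro!: vertex_pairs_memI)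
    show "F0 A B \<in> E.events" unfolding F0_def by (rule no_coin_event[OF vp])
    define t t' where "t = real (card (?t c))" and "t' = real (card (?t c'))"
    have tt: "\<tau> \<le> t" "\<tau> \<le> t'" using full c by (auto simp: t_def t'_def)
    have card: "card (cross_pairs A B) = card A * card B" using AB by (intro card_cross_pairs) (auto simp: AB_def)
    have "(\<delta> * t) * (\<delta> * t') \<le> real (card A) * real (card B)"
      using AB \<delta> \<tau> tt by (intro mult_mono) (auto simp: AB_def t_def t'_def)
    then have "E.prob (F0 A B) \<le> exp (- (p * ((\<delta> * t) * (\<delta> * t'))))"
      unfolding F0_def by (intro prob_no_coin_exp[OF p vp]) (simp add: card)
    \<comment> \<open>By 4 <= p \<delta>^2 \<tau>, the product p \<delta>^2 t t' is at least 4 t and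
      at least 4 t'; their average is 2 (t + t').\<close>
    also have "\<dots> \<le> exp (- (2 * (t + t')))"
    proof -
      have pd: "0 \<le> p * \<delta>\<^sup>2" using p by simp
      have "4 * t' \<le> (p * \<delta>\<^sup>2 * \<tau>) * t'" using \<tau> tt by (intro mult_right_mono) auto
      also have "\<dots> \<le> (p * \<delta>\<^sup>2 * t) * t'" using tt pd \<tau> by (intro mult_right_mono mult_left_mono) auto
      finally have 1: "4 * t' \<le> (p * \<delta>\<^sup>2 * t) * t'" .
      have "4 * t \<le> (p * \<delta>\<^sup>2 * \<tau>) * t" using \<tau> tt by (intro mult_right_mono) auto
      also have "\<dots> \<le> (p * \<delta>\<^sup>2 * t') * t" using tt pd \<tau> by (intro mult_right_mono mult_left_mono) auto
      finally have 2: "4 * t \<le> (p * \<delta>\<^sup>2 * t') * t" .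
      have "p * ((\<delta> * t) * (\<delta> * t')) = (p * \<delta>\<^sup>2 * t) * t'" "(p * \<delta>\<^sup>2 * t') * t = (p * \<delta>\<^sup>2 * t) * t'"
        by (simp_all add: power2_eq_square)
      then have "4 * t' \<le> p * ((\<delta> * t) * (\<delta> * t'))" "4 * t \<le> p * ((\<delta> * t) * (\<delta> * t'))"
        using 1 2 by (simp_all only:)
      then have "2 * (t + t') \<le> p * ((\<delta> * t) * (\<delta> * t'))" by simp
      then show ?thesis by simp
    qed
    finally show "E.prob (F0 A B) \<le> exp (- (2 * (real (card (?t c)) + real (card (?t c')))))"
      by (simp add: t_def t'_def)
  qed
  define F1 where "F1 cc = (\<Union>AB\<in>AB (fst cc) (snd cc). F0 (fst AB) (snd AB))" for cc
  have F1e: "F1 cc \<in> E.events" and F1p: "E.prob (F1 cc) \<le> exp (- (2 * \<tau>))" if "cc \<in> ?G \<times> ?G" for cc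
  proof -
    have c: "fst cc \<in> ?G" "snd cc \<in> ?G" using that by (simp_all only: mem_Times_iff)
    define t t' where "t = card (?t (fst cc))" and "t' = card (?t (snd cc))"
    have tt: "\<tau> \<le> real t" "\<tau> \<le> real t'"
      unfolding t_def t'_def by (rule bspec[OF full c(1)]) (rule bspec[OF full c(2)])
    have ev': "F0 (fst ab) (snd ab) \<in> E.events" and pr': "E.prob (F0 (fst ab) (snd ab)) \<le> exp (- (2 * (real t + real t')))"
      if "ab \<in> AB (fst cc) (snd cc)" for ab
      using ev[OF c, of "fst ab" "snd ab"] pr[OF c, of "fst ab" "snd ab"] that unfolding t_def t'_def prod.collapse by blast+
    show "F1 cc \<in> E.events" unfolding F1_def by (rule sets.finite_UN[OF fAB]) (rule ev')
    have "E.prob (F1 cc) \<le> (\<Sum>ab\<in>AB (fst cc) (snd cc). exp (- (2 * (real t + real t'))))"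
      unfolding F1_def by (intro E.prob_UN_le fAB ev' pr')
    also have "\<dots> = real (card (AB (fst cc) (snd cc))) * exp (- (2 * (real t + real t')))" by simp
    also have "\<dots> \<le> exp (real t + real t') * exp (- (2 * (real t + real t')))"
    proof (rule mult_right_mono)
      have "real (card (AB (fst cc) (snd cc))) \<le> real (2 ^ (t + t'))"
        using cAB unfolding t_def t'_def by (simp only: of_nat_le_iff)
      also have "\<dots> = 2 ^ (t + t')" by simp
      also have "\<dots> \<le> exp 1 ^ (t + t')" using exp_ge_add_one_self[of 1] by (intro power_mono) auto
      also have "\<dots> = exp (real t + real t')" by (simp add: exp_of_nat_mult[symmetric])
      finally show "real (card (AB (fst cc) (snd cc))) \<le> exp (real t + real t')" .
    qed simp
    also have "\<dots> = exp (- (real t + real t'))" by (simp add: exp_add[symmetric])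
    also have "\<dots> \<le> exp (- (2 * \<tau>))" using tt by simp
    finally show "E.prob (F1 cc) \<le> exp (- (2 * \<tau>))" .
  qed
  define F where "F = (\<Union>cc\<in>?G \<times> ?G. F1 cc)"
  have fG: "finite (?G \<times> ?G)" by simp
  have Fe: "F \<in> E.events" unfolding F_def by (rule sets.finite_UN[OF fG]) (rule F1e)
  have "E.prob F \<le> (\<Sum>cc\<in>?G \<times> ?G. exp (- (2 * \<tau>)))"
    unfolding F_def by (intro E.prob_UN_le fG F1e F1p)
  also have "\<dots> = real N ^ 4 * exp (- (2 * \<tau>))"
    by (simp add: card_cartesian_product power4_eq_xxxx)
  finally have Fp: "E.prob F \<le> real N ^ 4 * exp (- (2 * \<tau>))" .
  have "{C \<in> space (edge_coins n p). \<not> unmixed n N \<delta> X C} \<subseteq> F"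
  proof
    fix C assume "C \<in> {C \<in> space (edge_coins n p). \<not> unmixed n N \<delta> X C}"
    then have C: "C \<in> space (edge_coins n p)" and "\<not> unmixed n N \<delta> X C" by auto
    then obtain c c' A B where c: "c \<in> ?G" "c' \<in> ?G" and ab: "(A, B) \<in> AB c c'" "\<forall>e\<in>cross_pairs A B. \<not> C e"
      unfolding unmixed_def AB_def by blast
    then have "C \<in> F1 (c, c')" using C unfolding F1_def F0_def by force
    moreover have "(c, c') \<in> ?G \<times> ?G" using c by blast
    ultimately show "C \<in> F" unfolding F_def by blast
  qed
  with Fe Fp show ?thesis by blast
qed

lemma sum_Pow_power: "(\<Sum>S\<in>Pow {..<n}. (x :: real) ^ card S) = (1 + x) ^ n"
  using prod_add[of "{..<n}" "\<lambda>_. x" "\<lambda>_. 1"] by (simp add: add.commute)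

text \<open>A light set has at least |S| times the reduced degree boundary coins, so it is closed
  with probability at most x^|S|. This is multiplicative in the elements of \<open>S\<close>, and
  the sum over all nonempty \<open>S\<close> is (1 + x)^n - 1.\<close>

lemma prob_not_connected_full:
  fixes \<delta> p \<tau> \<rho> r :: real
  assumes p: "0 \<le> p" "p \<le> 1" and N: "0 < N" and \<rho>: "0 \<le> \<rho>" "\<rho> + 3 / (2 * real N) \<le> r" "r < 1/2" and Nr: "3 / real N \<le> r"
    and \<delta>: "0 \<le> \<delta>" "\<delta> \<le> 1/2" and n: "0 < n"
    and \<tau>: "\<tau> = (1 - \<delta>) * (real n / (real N)\<^sup>2)" "4 \<le> p * \<delta>\<^sup>2 * \<tau>"
    and full: "\<forall>c\<in>cells N. \<tau> \<le> card (cellpts n N X c)" and X: "X \<in> space (uniform_points n)"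
  shows "measure (edge_coins n p) {C \<in> space (edge_coins n p). \<not> connected_graph (grp_graph n r (X, C))} \<le>
    real N ^ 4 * exp (- (2 * \<tau>)) + ((1 + exp (- (p * ((1 - \<delta>)\<^sup>2 * (real n * (pi * \<rho>\<^sup>2)))))) ^ n - 1)"
proof -
  interpret E: prob_space "edge_coins n p" by (rule prob_space_edge_coins)
  let ?G = "cells N"
  define x where "x = exp (- (p * ((1 - \<delta>)\<^sup>2 * (real n * (pi * \<rho>\<^sup>2)))))"
  have "0 \<le> \<tau>" using \<tau> \<delta> by simp
  then obtain F where F: "F \<in> E.events" "{C \<in> space (edge_coins n p). \<not> unmixed n N \<delta> X C} \<subseteq> F" "E.prob F \<le> real N ^ 4 * exp (- (2 * \<tau>))"
    using prob_mixed[OF p \<delta>(1) full \<tau>(2)] by blast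
  define L where "L = {S \<in> Pow {..<n}. S \<noteq> {} \<and> (\<forall>c\<in>?G. real (card (S \<inter> cellpts n N X c)) \<le> \<delta> * card (cellpts n N X c))}"
  define B where "B S = {C \<in> space (edge_coins n p). \<forall>e\<in>boundary_pairs n r X S. \<not> C e}" for S
  have fL: "finite L" unfolding L_def by simp
  have Be: "B S \<in> E.events" and Bp: "E.prob (B S) \<le> x ^ card S" if "S \<in> L" for S
  proof -
    have S: "S \<subseteq> {..<n}" and light: "\<forall>c\<in>?G. real (card (S \<inter> cellpts n N X c)) \<le> \<delta> * card (cellpts n N X c)"
      using that by (auto simp: L_def)
    have vp: "boundary_pairs n r X S \<subseteq> vertex_pairs n"
      using S by (auto simp: boundary_pairs_def intro!: vertex_pairs_memI)
    show "B S \<in> E.events" unfolding B_def by (rule no_coin_event[OF vp])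
    have "real (card S) * ((1 - \<delta>)\<^sup>2 * (real n * (pi * \<rho>\<^sup>2))) \<le> card (boundary_pairs n r X S)"
      using \<delta> by (intro card_boundary_pairs[OF N \<rho> _ _ S light full[unfolded \<tau>(1)]]) auto
    from prob_no_coin_exp[OF p vp this]
    have "E.prob (B S) \<le> exp (- (p * (real (card S) * ((1 - \<delta>)\<^sup>2 * (real n * (pi * \<rho>\<^sup>2))))))"
      unfolding B_def .
    also have "\<dots> = x ^ card S" unfolding x_def by (simp add: exp_of_nat_mult[symmetric] mult_ac)
    finally show "E.prob (B S) \<le> x ^ card S" .
  qed
  have Ue: "(\<Union>S\<in>L. B S) \<in> E.events" by (rule sets.finite_UN[OF fL]) (rule Be)
  have "E.prob (\<Union>S\<in>L. B S) \<le> (\<Sum>S\<in>L. x ^ card S)" by (intro E.prob_UN_le fL Be Bp)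
  also have "\<dots> \<le> (\<Sum>S\<in>Pow {..<n} - {{}}. x ^ card S)"
    by (rule sum_mono2) (auto simp: L_def x_def)
  also have "\<dots> = (1 + x) ^ n - 1"
    by (subst sum_diff) (auto simp: sum_Pow_power)
  finally have Up: "E.prob (\<Union>S\<in>L. B S) \<le> (1 + x) ^ n - 1" .
  have "{C \<in> space (edge_coins n p). \<not> connected_graph (grp_graph n r (X, C))} \<subseteq> F \<union> (\<Union>S\<in>L. B S)"
  proof
    fix C assume "C \<in> {C \<in> space (edge_coins n p). \<not> connected_graph (grp_graph n r (X, C))}"
    then have C: "C \<in> space (edge_coins n p)" and nc: "\<not> connected_graph (grp_graph n r (X, C))" by auto
    show "C \<in> F \<union> (\<Union>S\<in>L. B S)"
    proof (cases "unmixed n N \<delta> X C")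
      case False
      with C F show ?thesis by blast
    next
      case True
      from nc n obtain S where S: "edge_closed n r (X, C) S" "S \<noteq> {}" "S \<noteq> {..<n}"
        unfolding connected_grp_graph_iff by blast
      have inB: "C \<in> (\<Union>S\<in>L. B S)" if T: "edge_closed n r (X, C) T" "T \<noteq> {}"
        and light: "\<forall>c\<in>?G. real (card (T \<inter> cellpts n N X c)) \<le> \<delta> * card (cellpts n N X c)" for T
      proof -
        have Tn: "T \<subseteq> {..<n}" using T by (simp add: edge_closed_def)
        have "\<not> C e" if e: "e \<in> boundary_pairs n r X T" for e
        proof
          assume "C e"
          obtain u v where uv: "u \<in> T" "v \<in> {..<n} - T" "torus_dist (X u) (X v) \<le> r" "e = {u, v}"
            using e unfolding boundary_pairs_def by blast
          then have "edge n r (X, C) u v" using \<open>C e\<close> Tn by (auto simp: edge_iff)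
          with T uv show False unfolding edge_closed_def by blast
        qed
        then have "C \<in> B T" using C unfolding B_def by blast
        moreover have "T \<in> L" using T(2) Tn light unfolding L_def by blast
        ultimately show ?thesis by blast
      qed
      have Sn: "S \<subseteq> {..<n}" using S by (simp add: edge_closed_def)
      from light_or_colight[OF N Nr \<delta> True S(1)] show ?thesis
      proof
        assume "\<forall>c\<in>?G. real (card (S \<inter> cellpts n N X c)) \<le> \<delta> * card (cellpts n N X c)"
        from inB[OF S(1,2) this] show ?thesis by blast
      next
        assume a: "\<forall>c\<in>?G. real (card (({..<n} - S) \<inter> cellpts n N X c)) \<le> \<delta> * card (cellpts n N X c)"
        have "{..<n} - S \<noteq> {}" using S Sn by blast
        from inB[OF edge_closed_compl[OF S(1)] this a] show ?thesis by blast
      qed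
    qed
  qed
  then have "E.prob {C \<in> space (edge_coins n p). \<not> connected_graph (grp_graph n r (X, C))} \<le> E.prob (F \<union> (\<Union>S\<in>L. B S))"
    using F Ue by (intro E.finite_measure_mono) auto
  also have "\<dots> \<le> E.prob F + E.prob (\<Union>S\<in>L. B S)" using F Ue by (intro measure_Un_le)
  finally show ?thesis using F(3) Up unfolding x_def by linarith
qed

text \<open>Integration over the positions: badly filled ones are bounded by probability 1 and
  weighted by the Chernoff bound, all others by the estimate for fixed positions.\<close>

lemma prob_not_connected_dense:
  fixes \<delta> p \<tau> \<rho> r :: real
  assumes p: "0 \<le> p" "p \<le> 1" and N: "0 < N" and \<rho>: "0 \<le> \<rho>" "\<rho> + 3 / (2 * real N) \<le> r" "r < 1/2" and Nr: "3 / real N \<le> r"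
    and \<delta>: "0 \<le> \<delta>" "\<delta> \<le> 1/2" and n: "0 < n"
    and \<tau>: "\<tau> = (1 - \<delta>) * (real n / (real N)\<^sup>2)" "4 \<le> p * \<delta>\<^sup>2 * \<tau>"
  shows "disconnect_prob n r p \<le>
    (real N)\<^sup>2 * exp (- (\<delta>\<^sup>2 * (real n / (real N)\<^sup>2) / 2)) +
    (real N ^ 4 * exp (- (2 * \<tau>)) + ((1 + exp (- (p * ((1 - \<delta>)\<^sup>2 * (real n * (pi * \<rho>\<^sup>2)))))) ^ n - 1))"
    (is "_ \<le> ?b1 + ?b2")
proof -
  interpret G: prob_space "grp_space n p" by (rule prob_space_grp_space)
  interpret E: prob_space "edge_coins n p" by (rule prob_space_edge_coins)
  interpret U: prob_space "uniform_points n" by (rule prob_space_uniform_points)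
  let ?G = "cells N"
  define \<beta> where "\<beta> = ?b2"
  have b2: "0 \<le> \<beta>"
  proof -
    have "1 \<le> (1 + exp (- (p * ((1 - \<delta>)\<^sup>2 * (real n * (pi * \<rho>\<^sup>2)))))) ^ n"
      by (intro one_le_power) simp
    moreover have "0 \<le> real N ^ 4 * exp (- (2 * \<tau>))" by simp
    ultimately show ?thesis unfolding \<beta>_def by linarith
  qed
  define bad where "bad c = {X \<in> space (uniform_points n). real (card (cellpts n N X c)) \<le> \<tau>}" for c
  have be: "bad c \<in> U.events" for c
    using pred_pts[OF sets_block] unfolding bad_def by (simp add: pred_def)
  have bp: "U.prob (bad c) \<le> exp (- (\<delta>\<^sup>2 * (real n / (real N)\<^sup>2) / 2))" for c
  proof -
    have m: "measure unif_sq (block N 0 (fst c) (snd c)) = 1 / (real N)\<^sup>2"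
      using N by (simp add: measure_block power_divide)
    from chernoff_lower[OF sets_block \<delta>(1) m, of n]
    show ?thesis unfolding bad_def \<tau>(1) by (simp add: U.emeasure_eq_measure)
  qed
  define BAD where "BAD = (\<Union>c\<in>?G. bad c)"
  have fG: "finite ?G" by simp
  have Be: "BAD \<in> U.events" unfolding BAD_def by (rule sets.finite_UN[OF fG]) (rule be)
  have "U.prob BAD \<le> (\<Sum>c\<in>?G. exp (- (\<delta>\<^sup>2 * (real n / (real N)\<^sup>2) / 2)))"
    unfolding BAD_def by (intro U.prob_UN_le fG be bp)
  also have "\<dots> = ?b1" by (simp add: card_cartesian_product power2_eq_square)
  finally have Bp: "U.prob BAD \<le> ?b1" .
  have pc: "Measurable.pred (grp_space n p) (\<lambda>\<omega>. \<not> connected_graph (grp_graph n r \<omega>))"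
    using pred_connected[OF \<rho>(3)] by (rule pred_intros_logic)
  have "ennreal (disconnect_prob n r p) =
     (\<integral>\<^sup>+X. emeasure (edge_coins n p) {C \<in> space (edge_coins n p). \<not> connected_graph (grp_graph n r (X, C))} \<partial>uniform_points n)"
    using emeasure_grp_space[OF pc] by (simp add: G.emeasure_eq_measure)
  also have "\<dots> \<le> (\<integral>\<^sup>+X. indicator BAD X + ennreal \<beta> \<partial>uniform_points n)"
  proof (rule nn_integral_mono)
    fix X assume X: "X \<in> space (uniform_points n)"
    show "emeasure (edge_coins n p) {C \<in> space (edge_coins n p). \<not> connected_graph (grp_graph n r (X, C))} \<le> indicator BAD X + ennreal \<beta>"
    proof (cases "X \<in> BAD")
      case True
      have "emeasure (edge_coins n p) {C \<in> space (edge_coins n p). \<not> connected_graph (grp_graph n r (X, C))} \<le> 1 + 0"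
        using E.emeasure_le_1 by simp
      also have "\<dots> \<le> indicator BAD X + ennreal \<beta>" using True by (intro add_mono) auto
      finally show ?thesis .
    next
      case False
      then have "\<tau> \<le> card (cellpts n N X c)" if "c \<in> ?G" for c
        using X that unfolding BAD_def bad_def by force
      then have "E.prob {C \<in> space (edge_coins n p). \<not> connected_graph (grp_graph n r (X, C))} \<le> \<beta>"
        unfolding \<beta>_def by (intro prob_not_connected_full[OF p N \<rho> Nr \<delta> n \<tau> _ X]) blast
      then show ?thesis using False by (simp add: E.emeasure_eq_measure ennreal_leI)
    qed
  qed
  also have "\<dots> = ennreal (U.prob BAD) + ennreal \<beta>"
    using Be U.emeasure_space_1 by (subst nn_integral_add) (auto simp: U.emeasure_eq_measure simp del: ennreal_plus)
  also have "\<dots> = ennreal (U.prob BAD + \<beta>)"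
    using b2 by (subst ennreal_plus) auto
  also have "\<dots> \<le> ennreal (?b1 + \<beta>)" using Bp by (intro ennreal_leI) linarith
  finally show ?thesis unfolding \<beta>_def[symmetric] using b2 by (subst (asm) ennreal_le_iff) (auto intro!: add_nonneg_nonneg)
qed

theorem connected_dense:
  fixes \<epsilon> :: real
  assumes \<epsilon>: "0 < \<epsilon>" "\<epsilon> \<le> 1"
  shows "\<exists>C \<ge> 1. \<exists>g. g \<longlonglongrightarrow> 0 \<and> (\<forall>\<^sub>F n in sequentially. \<forall>r p. 0 \<le> r \<longrightarrow> r \<le> 1/4 \<longrightarrow> 0 \<le> p \<longrightarrow> p \<le> 1 \<longrightarrow>
     (1 + \<epsilon>) * ln (real n) \<le> real n * (pi * r\<^sup>2 * p) \<longrightarrow> C * ln (real n) \<le> real n * (pi * r\<^sup>2) \<longrightarrow>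
     disconnect_prob n r p \<le> g n)"
proof -
  \<comment> \<open>The losses amount to a factor (1 - \<delta>)^4 in the exponent; 4 \<delta> =
    \<epsilon> / 4 leaves (1 - \<epsilon>/4) (1 + \<epsilon>) >= 1 + \<epsilon>/2 for \<epsilon> <=
    1.\<close>
  define \<delta> where "\<delta> = \<epsilon> / 16"
  have \<delta>: "0 < \<delta>" "\<delta> \<le> 1/16" using \<epsilon> by (auto simp: \<delta>_def)
  \<comment> \<open>Of the four powers of \<delta>, two come from the area of cells of side about
    \<delta> r and two from the exponent \<delta>^2 in the Chernoff bound. The factor 64 makes
    \<delta>^2 n / N^2 at least 4 ln n.\<close>
  define C where "C = 64 / \<delta> ^ 4"
  have C1: "C \<ge> 1"
  proof -
    have "\<delta> ^ 4 \<le> 1 ^ 4" using \<delta> by (intro power_mono) auto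
    then show ?thesis using \<delta> by (simp add: C_def pos_le_divide_eq)
  qed
  define g where "g n = real n powr - 1 + real n powr - 2 + 2 * real n powr - (\<epsilon> / 2)" for n
  have g: "g \<longlonglongrightarrow> 0" unfolding g_def using \<epsilon> by real_asymp
  \<comment> \<open>Here p may tend to 0, so p \<delta>^2 \<tau> >= 4 is drawn from n q >= ln n
    instead: p \<delta>^2 \<tau> is at least \<delta>^4 ln n / 32.\<close>
  have ev1: "\<forall>\<^sub>F n in sequentially. 128 / \<delta> ^ 4 \<le> ln (real n)" by real_asymp
  have ev2: "\<forall>\<^sub>F n in sequentially. 1 \<le> ln (real n)" by real_asymp
  have ev3: "\<forall>\<^sub>F n in sequentially. 0 < n" by (rule eventually_gt_at_top)
  from ev1 ev2 ev3 have "\<forall>\<^sub>F n in sequentially. \<forall>r p. 0 \<le> r \<longrightarrow> r \<le> 1/4 \<longrightarrow> 0 \<le> p \<longrightarrow> p \<le> 1 \<longrightarrow>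
     (1 + \<epsilon>) * ln (real n) \<le> real n * (pi * r\<^sup>2 * p) \<longrightarrow> C * ln (real n) \<le> real n * (pi * r\<^sup>2) \<longrightarrow>
     disconnect_prob n r p \<le> g n"
  proof (eventually_elim, intro allI impI)
    fix n :: nat and r p :: real
    assume big: "128 / \<delta> ^ 4 \<le> ln (real n)" and ln1: "1 \<le> ln (real n)" and n: "0 < n"
      and r: "0 \<le> r" "r \<le> 1/4" and p: "0 \<le> p" "p \<le> 1"
      and q1: "(1 + \<epsilon>) * ln (real n) \<le> real n * (pi * r\<^sup>2 * p)" and D: "C * ln (real n) \<le> real n * (pi * r\<^sup>2)"
    define L where "L = ln (real n)"
    have L1: "1 \<le> L" using ln1 by (simp add: L_def)
    have n0: "0 < real n" using n by simp
    have r0: "0 < r"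
    proof -
      have "0 < C * L" using C1 L1 by simp
      then have "0 < real n * (pi * r\<^sup>2)" using D by (simp add: L_def)
      then show ?thesis using r n0 by (auto simp: zero_less_mult_iff)
    qed
    \<comment> \<open>Makes the diameter bound 3 / (2 N) at most \<delta> r, so the inner radius (1
      - \<delta>) r is admissible in \<open>ball_cells\<close>.\<close>
    define N where "N = nat \<lceil>3 / (2 * \<delta> * r)\<rceil>"
    have dr: "0 < \<delta> * r" using \<delta> r0 by simp
    have dr1: "\<delta> * r \<le> 1/64" using mult_mono[OF \<delta>(2) r(2)] r0 by simp
    have Nlo: "3 / (2 * \<delta> * r) \<le> real N" unfolding N_def by linarith
    have pos: "0 < 3 / (2 * \<delta> * r)" using \<delta> r0 by simp
    have N0: "0 < real N" using Nlo pos by linarith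
    then have N0': "0 < N" by simp
    have "real N < 3 / (2 * \<delta> * r) + 1" using pos unfolding N_def by linarith
    then have "real N * (\<delta> * r) < (3 / (2 * \<delta> * r) + 1) * (\<delta> * r)" using dr by (intro mult_strict_right_mono)
    also have "\<dots> = 3 / 2 + \<delta> * r" using \<delta> r0 by (simp add: distrib_right)
    finally have Nhi: "real N * (\<delta> * r) \<le> 2" using dr1 by linarith
    have Nlo': "3 / 2 \<le> real N * (\<delta> * r)" using Nlo \<delta> r0 by (simp add: field_simps)
    have N3: "3 / (2 * real N) \<le> \<delta> * r" using Nlo' N0 by (simp add: field_simps)
    define \<rho> where "\<rho> = (1 - \<delta>) * r"
    have \<rho>: "0 \<le> \<rho>" "\<rho> + 3 / (2 * real N) \<le> r" "r < 1/2"
      using \<delta> r0 N3 r by (auto simp: \<rho>_def algebra_simps)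
    have Nr: "3 / real N \<le> r"
    proof -
      have "3 / real N = 2 * (3 / (2 * real N))" by simp
      also have "\<dots> \<le> 2 * (\<delta> * r)" using N3 by linarith
      also have "\<dots> \<le> 1 * r" using \<delta> r0 mult_right_mono[of "2 * \<delta>" 1 r] by simp
      finally show ?thesis by simp
    qed
    define lm where "lm = real n / (real N)\<^sup>2"
    have N2: "(real N)\<^sup>2 * (\<delta>\<^sup>2 * r\<^sup>2) \<le> 4"
    proof -
      have "(real N * (\<delta> * r))\<^sup>2 \<le> 2\<^sup>2" using Nhi dr by (intro power_mono) auto
      then show ?thesis by (simp add: power_mult_distrib)
    qed
    have lam: "real n * (\<delta>\<^sup>2 * r\<^sup>2) \<le> 4 * lm"
    proof -
      have "real n * (\<delta>\<^sup>2 * r\<^sup>2) * (real N)\<^sup>2 \<le> real n * 4"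
        using N2 mult_left_mono[of "(real N)\<^sup>2 * (\<delta>\<^sup>2 * r\<^sup>2)" 4 "real n"] by (simp add: mult_ac)
      then show ?thesis using N0 by (simp add: lm_def pos_le_divide_eq)
    qed
    have nrC: "16 * L \<le> \<delta> ^ 4 * (real n * r\<^sup>2)"
    proof -
      have "64 * L = \<delta> ^ 4 * (C * L)" using \<delta> by (simp add: C_def)
      also have "\<dots> \<le> \<delta> ^ 4 * (real n * (pi * r\<^sup>2))" using D by (intro mult_left_mono) (auto simp: L_def)
      also have "\<dots> = pi * (\<delta> ^ 4 * (real n * r\<^sup>2))" by simp
      also have "\<dots> \<le> 4 * (\<delta> ^ 4 * (real n * r\<^sup>2))" using pi_less_4 by (intro mult_right_mono) auto
      finally show ?thesis by linarith
    qed
    have d4: "\<delta> ^ 4 = \<delta>\<^sup>2 * \<delta>\<^sup>2" by simp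
    have dl: "4 * L \<le> \<delta>\<^sup>2 * lm"
    proof -
      have "16 * L \<le> \<delta>\<^sup>2 * (real n * (\<delta>\<^sup>2 * r\<^sup>2))" using nrC unfolding d4 by (simp only: mult_ac)
      also have "\<dots> \<le> \<delta>\<^sup>2 * (4 * lm)" using lam by (intro mult_left_mono) auto
      also have "\<dots> = 4 * (\<delta>\<^sup>2 * lm)" by (simp only: mult_ac)
      finally show ?thesis by linarith
    qed
    have lm0: "0 \<le> lm" by (simp add: lm_def)
    have lam4: "4 * L \<le> lm"
    proof -
      have "\<delta>\<^sup>2 \<le> 1" using \<delta> by (intro power_le_one) auto
      then have "\<delta>\<^sup>2 * lm \<le> 1 * lm" using lm0 by (intro mult_right_mono) auto
      with dl show ?thesis by linarith
    qed
    have NN: "(real N)\<^sup>2 \<le> real n"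
    proof -
      have "1 \<le> lm" using lam4 L1 by linarith
      then show ?thesis using N0 by (simp add: lm_def pos_le_divide_eq)
    qed
    define \<tau> where "\<tau> = (1 - \<delta>) * (real n / (real N)\<^sup>2)"
    have tau: "lm / 2 \<le> \<tau>"
      using mult_right_mono[of "1/2" "1 - \<delta>" lm] \<delta> lm0 by (simp add: \<tau>_def lm_def)
    have pD: "L \<le> p * (real n * (4 * r\<^sup>2))"
    proof -
      have "L \<le> (1 + \<epsilon>) * L" using \<epsilon> L1 by (simp add: mult_le_cancel_right1)
      also have "\<dots> \<le> pi * (p * (real n * r\<^sup>2))" using q1 by (simp add: L_def mult_ac)
      also have "\<dots> \<le> 4 * (p * (real n * r\<^sup>2))" using pi_less_4 p by (intro mult_right_mono) auto
      finally show ?thesis by (simp add: mult_ac)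
    qed
    have ptau: "4 \<le> p * \<delta>\<^sup>2 * \<tau>"
    proof -
      have "128 \<le> \<delta> ^ 4 * L" using big \<delta> by (simp add: L_def pos_divide_le_eq mult.commute)
      also have "\<dots> \<le> \<delta> ^ 4 * (p * (real n * (4 * r\<^sup>2)))" using pD by (intro mult_left_mono) auto
      also have "\<dots> = 4 * (p * \<delta>\<^sup>2 * (real n * (\<delta>\<^sup>2 * r\<^sup>2)))" unfolding d4 by (simp only: mult_ac)
      also have "\<dots> \<le> 4 * (p * \<delta>\<^sup>2 * (4 * lm))" using lam p by (intro mult_left_mono) auto
      also have "\<dots> \<le> 4 * (p * \<delta>\<^sup>2 * (8 * \<tau>))" using tau p by (intro mult_left_mono) auto
      also have "\<dots> = 32 * (p * \<delta>\<^sup>2 * \<tau>)" by simp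
      finally show ?thesis by linarith
    qed
    define x where "x = exp (- (p * ((1 - \<delta>)\<^sup>2 * (real n * (pi * \<rho>\<^sup>2)))))"
    have xle: "x \<le> real n powr - (1 + \<epsilon> / 2)"
    proof -
      have "(1 + \<epsilon> / 2) * L \<le> p * ((1 - \<delta>)\<^sup>2 * (real n * (pi * \<rho>\<^sup>2)))"
      proof -
        have "1 - 4 * \<delta> \<le> (1 - \<delta>) ^ 4"
          using Bernoulli_inequality[of "- \<delta>" 4] \<delta> by simp
        moreover have "1 + \<epsilon> / 2 \<le> (1 - 4 * \<delta>) * (1 + \<epsilon>)"
        proof -
          have "\<epsilon> * \<epsilon> \<le> 1 * \<epsilon>" using \<epsilon> by (intro mult_right_mono) auto
          then show ?thesis by (simp add: \<delta>_def field_simps)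
        qed
        moreover have "(1 - 4 * \<delta>) * (1 + \<epsilon>) \<le> (1 - \<delta>) ^ 4 * (1 + \<epsilon>)"
          using calculation(1) \<epsilon> by (intro mult_right_mono) auto
        ultimately have "1 + \<epsilon> / 2 \<le> (1 - \<delta>) ^ 4 * (1 + \<epsilon>)" by linarith
        then have "(1 + \<epsilon> / 2) * L \<le> ((1 - \<delta>) ^ 4 * (1 + \<epsilon>)) * L" using L1 by (intro mult_right_mono) auto
        also have "\<dots> = (1 - \<delta>) ^ 4 * ((1 + \<epsilon>) * L)" by simp
        also have "\<dots> \<le> (1 - \<delta>) ^ 4 * (real n * (pi * r\<^sup>2 * p))"
          using q1 by (intro mult_left_mono) (auto simp: L_def)
        also have "\<dots> = p * ((1 - \<delta>)\<^sup>2 * (real n * (pi * \<rho>\<^sup>2)))"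
          by (simp add: \<rho>_def power_mult_distrib power4_eq_xxxx power2_eq_square)
        finally show ?thesis .
      qed
      then have "x \<le> exp (- ((1 + \<epsilon> / 2) * L))" unfolding x_def by simp
      also have "\<dots> = real n powr - (1 + \<epsilon> / 2)" using n by (simp add: powr_def L_def algebra_simps)
      finally show ?thesis .
    qed
    \<comment> \<open>(1 + x)^n <= exp (n x) <= 1 + 2 n x as soon as n x <= 1, and n x is at most
      n^(-\<epsilon>/2).\<close>
    have b3: "(1 + x) ^ n - 1 \<le> 2 * real n powr - (\<epsilon> / 2)"
    proof -
      have x0: "0 \<le> x" by (simp add: x_def)
      have nx: "real n * x \<le> real n powr - (\<epsilon> / 2)"
      proof -
        have "real n * x \<le> real n * real n powr - (1 + \<epsilon> / 2)" using xle by (intro mult_left_mono) auto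
        also have "\<dots> = real n powr - (\<epsilon> / 2)" by (simp add: powr_mult_base)
        finally show ?thesis .
      qed
      also have "\<dots> \<le> 1"
      proof -
        have "real n powr - (\<epsilon> / 2) \<le> real n powr 0" using n \<epsilon> by (intro powr_mono) auto
        then show ?thesis using n by simp
      qed
      finally have nx1: "real n * x \<le> 1" .
      have "(1 + x) ^ n \<le> exp x ^ n" using x0 exp_ge_add_one_self[of x] by (intro power_mono) auto
      also have "\<dots> = exp (real n * x)" by (simp add: exp_of_nat_mult[symmetric])
      also have "\<dots> \<le> 1 + real n * x + (real n * x)\<^sup>2" using x0 nx1 by (intro exp_bound) auto
      also have "(real n * x)\<^sup>2 \<le> real n * x" using x0 nx1 by (simp add: power2_eq_square mult_left_le)
      finally have "(1 + x) ^ n \<le> 1 + real n * x + real n * x" by linarith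
      with nx show ?thesis by linarith
    qed
    have "disconnect_prob n r p \<le>
      (real N)\<^sup>2 * exp (- (\<delta>\<^sup>2 * (real n / (real N)\<^sup>2) / 2)) + (real N ^ 4 * exp (- (2 * \<tau>)) + ((1 + x) ^ n - 1))"
      unfolding x_def using \<delta> by (intro prob_not_connected_dense[OF p N0' \<rho> Nr _ _ n \<tau>_def ptau]) auto
    also have "\<dots> \<le> real n powr - 1 + (real n powr - 2 + 2 * real n powr - (\<epsilon> / 2))"
    proof (intro add_mono b3)
      have e: "exp (- (k * L)) = real n powr - k" for k using n by (simp add: powr_def L_def)
      have "exp (- (\<delta>\<^sup>2 * (real n / (real N)\<^sup>2) / 2)) \<le> exp (- (2 * L))" using dl by (simp add: lm_def)
      then have "(real N)\<^sup>2 * exp (- (\<delta>\<^sup>2 * (real n / (real N)\<^sup>2) / 2)) \<le> real n * real n powr - 2"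
        unfolding e using NN by (intro mult_mono) auto
      also have "\<dots> = real n powr - 1" using n by (simp add: powr_minus powr_numeral power2_eq_square field_simps)
      finally show "(real N)\<^sup>2 * exp (- (\<delta>\<^sup>2 * (real n / (real N)\<^sup>2) / 2)) \<le> real n powr - 1" .
      have "exp (- (2 * \<tau>)) \<le> exp (- (4 * L))" using tau lam4 by simp
      moreover have "real N ^ 4 \<le> (real n)\<^sup>2"
        using power_mono[OF NN, of 2] by (simp add: power_mult[symmetric])
      ultimately have "real N ^ 4 * exp (- (2 * \<tau>)) \<le> (real n)\<^sup>2 * real n powr - 4"
        unfolding e by (intro mult_mono) auto
      also have "\<dots> = real n powr - 2"
      proof -
        have "real n powr (2 + (- 4)) = real n powr 2 * real n powr - 4" by (rule powr_add)
        then show ?thesis using n by simp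
      qed
      finally show "real N ^ 4 * exp (- (2 * \<tau>)) \<le> real n powr - 2" .
    qed
    finally show "disconnect_prob n r p \<le> g n"
      unfolding g_def by simp
  qed
  with g C1 show ?thesis by blast
qed

subsection \<open>Isolated vertices: first and second moment\<close>

text \<open>For a single vertex this is isolation. For two it ignores the edge between them, so it
  is implied by both being isolated, and it factorises over the outside vertices.\<close>

definition no_edges_from :: "nat \<Rightarrow> real \<Rightarrow> nat set \<Rightarrow> (nat \<Rightarrow> real \<times> real) \<times> (nat set \<Rightarrow> bool) \<Rightarrow> bool" where
  "no_edges_from n r U \<omega> \<longleftrightarrow> (\<forall>u\<in>U. \<forall>w\<in>{..<n} - U. \<not> edge n r \<omega> u w)"

text \<open>Conditional probability that a vertex at \<open>y\<close> has no edge to any vertex of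
  \<open>U\<close>, given the positions \<open>x\<close> of \<open>U\<close>.\<close>

definition miss :: "real \<Rightarrow> real \<Rightarrow> nat set \<Rightarrow> (nat \<Rightarrow> real \<times> real) \<Rightarrow> real \<times> real \<Rightarrow> real" where
  "miss r p U x y = (\<Prod>u\<in>U. 1 - p * indicator {y. torus_dist (x u) y \<le> r} y)"

lemma pred_torus_ball:
  assumes "r < 1/2" "u \<in> U"
  shows "Measurable.pred (PiM U (\<lambda>_. unif_sq) \<Otimes>\<^sub>M unif_sq) (\<lambda>z. torus_dist (fst z u) (snd z) \<le> r)"
proof (rule torus_dist_le_measurable[OF assms(1)])
  show "(\<lambda>z. fst z u) \<in> PiM U (\<lambda>_. unif_sq) \<Otimes>\<^sub>M unif_sq \<rightarrow>\<^sub>M borel"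
    unfolding measurable_unif_sq_iff[symmetric]
    by (rule measurable_compose[OF measurable_fst measurable_component_singleton[OF assms(2)]])
  show "snd \<in> PiM U (\<lambda>_. unif_sq) \<Otimes>\<^sub>M unif_sq \<rightarrow>\<^sub>M borel"
    unfolding measurable_unif_sq_iff[symmetric] by (rule measurable_snd)
qed

lemma miss_measurable:
  assumes "r < 1/2"
  shows "(\<lambda>(x, y). miss r p U x y) \<in> borel_measurable (PiM U (\<lambda>_. unif_sq) \<Otimes>\<^sub>M unif_sq)"
proof -
  have "(\<lambda>z. indicator {y. torus_dist (fst z u) y \<le> r} (snd z) :: real) \<in> borel_measurable (PiM U (\<lambda>_. unif_sq) \<Otimes>\<^sub>M unif_sq)" if "u \<in> U" for u
    using pred_torus_ball[OF assms that] by (intro borel_measurable_indicator') (simp add: pred_def)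
  then show ?thesis
    unfolding miss_def case_prod_beta
    by (intro borel_measurable_prod borel_measurable_diff borel_measurable_times borel_measurable_const)
qed

lemma miss_nonneg: "0 \<le> p \<Longrightarrow> p \<le> 1 \<Longrightarrow> 0 \<le> miss r p U x y"
  unfolding miss_def by (intro prod_nonneg) (auto simp: indicator_def)

lemma pred_no_edges_from:
  assumes "r < 1/2" "finite U"
  shows "Measurable.pred (grp_space n p) (no_edges_from n r U)"
  unfolding no_edges_from_def using assms by (intro pred_intros_finite pred_intros_logic pred_edge) auto

text \<open>Edges from \<open>U\<close> to different outside vertices use different coins, so for
  fixed positions the probability is a product with one factor per outside vertex, which integrates
  to a power.\<close>

lemma prob_no_edges_from:
  assumes p: "0 \<le> p" "p \<le> 1" and r: "r < 1/2" and U: "U \<subseteq> {..<n}"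
  shows "emeasure (grp_space n p) {\<omega> \<in> space (grp_space n p). no_edges_from n r U \<omega>} =
    (\<integral>\<^sup>+x. (\<integral>\<^sup>+y. ennreal (miss r p U x y) \<partial>unif_sq) ^ (n - card U) \<partial>PiM U (\<lambda>_. unif_sq))"
proof -
  interpret E: prob_space "edge_coins n p" by (rule prob_space_edge_coins)
  have fU: "finite U" using U finite_subset by blast
  have coin: "emeasure (edge_coins n p) {C \<in> space (edge_coins n p). no_edges_from n r U (X, C)} =
      (\<Prod>w\<in>{..<n} - U. ennreal (miss r p U (restrict X U) (X w)))" for X
  proof -
    define E where "E w = {u \<in> U. torus_dist (X u) (X w) \<le> r}" for w
    define F where "F = (\<lambda>(w, u). {w, u}) ` Sigma ({..<n} - U) E"
    have fE: "finite (E w)" for w using fU by (simp add: E_def)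
    have inj: "inj_on (\<lambda>(w, u). {w, u}) (Sigma ({..<n} - U) E)"
      by (auto simp: inj_on_def doubleton_eq_iff E_def)
    have vp: "F \<subseteq> vertex_pairs n"
      using U by (auto simp: F_def E_def intro!: vertex_pairs_memI)
    have "no_edges_from n r U (X, C) \<longleftrightarrow> (\<forall>e\<in>F. \<not> C e)" for C
    proof -
      have "edge n r (X, C) u w \<longleftrightarrow> u \<in> E w \<and> C {w, u}" if "u \<in> U" "w \<in> {..<n} - U" for u w
        using that U by (auto simp: edge_iff E_def insert_commute)
      then have "no_edges_from n r U (X, C) \<longleftrightarrow> (\<forall>w\<in>{..<n} - U. \<forall>u\<in>E w. \<not> C {w, u})"
        unfolding no_edges_from_def E_def by blast
      also have "\<dots> \<longleftrightarrow> (\<forall>e\<in>F. \<not> C e)" by (auto simp: F_def)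
      finally show ?thesis .
    qed
    then have "emeasure (edge_coins n p) {C \<in> space (edge_coins n p). no_edges_from n r U (X, C)} = ennreal ((1 - p) ^ card F)"
      using prob_no_coin[OF p vp] by (simp add: E.emeasure_eq_measure)
    also have "card F = (\<Sum>w\<in>{..<n} - U. card (E w))"
      using inj fE by (simp add: F_def card_image)
    also have "(1 - p) ^ \<dots> = (\<Prod>w\<in>{..<n} - U. (1 - p) ^ card (E w))" by (simp add: power_sum)
    also have "\<dots> = (\<Prod>w\<in>{..<n} - U. miss r p U (restrict X U) (X w))"
    proof (intro prod.cong refl)
      fix w
      have "miss r p U (restrict X U) (X w) = (\<Prod>u\<in>U. if torus_dist (X u) (X w) \<le> r then 1 - p else 1)"
        unfolding miss_def by (intro prod.cong) auto
      also have "\<dots> = (1 - p) ^ card (E w)" using fU by (simp add: prod.If_cases E_def Int_def)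
      finally show "(1 - p) ^ card (E w) = miss r p U (restrict X U) (X w)" by simp
    qed
    finally show ?thesis using p by (simp add: prod_ennreal miss_nonneg)
  qed
  have "emeasure (grp_space n p) {\<omega> \<in> space (grp_space n p). no_edges_from n r U \<omega>} =
      (\<integral>\<^sup>+X. 1 * (\<Prod>w\<in>{..<n} - U. ennreal (miss r p U (restrict X U) (X w))) \<partial>uniform_points n)"
    unfolding emeasure_grp_space[OF pred_no_edges_from[OF r fU]] coin by simp
  also have "\<dots> = (\<integral>\<^sup>+x. 1 * (\<integral>\<^sup>+y. ennreal (miss r p U x y) \<partial>unif_sq) ^ card ({..<n} - U) \<partial>PiM U (\<lambda>_. unif_sq))"
    unfolding uniform_points_eq using measurable_compose[OF miss_measurable[OF r] measurable_ennreal]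
    by (intro nn_integral_PiM_split U prob_space_unif_sq) (auto simp: case_prod_beta)
  finally show ?thesis using U fU by (simp add: card_Diff_subset)
qed

lemma isolated_iff_no_edges: "v < n \<Longrightarrow> isolated_vertex (grp_graph n r \<omega>) v \<longleftrightarrow> no_edges_from n r {v} \<omega>"
  by (auto simp: isolated_grp_graph_iff no_edges_from_def edge_iff)

lemma sets_torus_ball: "r < 1/2 \<Longrightarrow> {y. torus_dist x y \<le> r} \<in> sets unif_sq"
  by (simp add: torus_ball_eq)

lemma measure_torus_ball: "0 \<le> r \<Longrightarrow> r < 1/2 \<Longrightarrow> measure unif_sq {y. torus_dist x y \<le> r} = pi * r\<^sup>2"
  by (simp add: measure_def emeasure_torus_ball)

text \<open>All discs on the torus have area pi r^2, so the conditional probability is the same for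
  every position of \<open>v\<close> and the formula is exact.\<close>

lemma prob_isolated:
  assumes p: "0 \<le> p" "p \<le> 1" and r: "0 \<le> r" "r < 1/2" and v: "v < n"
  shows "measure (grp_space n p) {\<omega> \<in> space (grp_space n p). isolated_vertex (grp_graph n r \<omega>) v} = (1 - pi * r\<^sup>2 * p) ^ (n - 1)"
proof -
  interpret unif: prob_space unif_sq by (rule prob_space_unif_sq)
  interpret M: prob_space "PiM {v} (\<lambda>_. unif_sq)" by (intro prob_space_PiM prob_space_unif_sq)
  have int: "integrable unif_sq (\<lambda>y. p * indicator {y. torus_dist (x v) y \<le> r} y :: real)" for x :: "nat \<Rightarrow> real \<times> real"
    using sets_torus_ball[OF r(2)] by (intro integrable_mult_right integrable_real_indicator) (auto simp: less_top[symmetric])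
  have "(\<integral>\<^sup>+y. ennreal (miss r p {v} x y) \<partial>unif_sq) = ennreal (\<integral>y. 1 - p * indicator {y. torus_dist (x v) y \<le> r} y \<partial>unif_sq)" for x
  proof -
    have e: "miss r p {v} x y = 1 - p * indicator {y. torus_dist (x v) y \<le> r} y" for y by (simp add: miss_def)
    show ?thesis
      unfolding e using miss_nonneg[OF p, of r "{v}" x, unfolded e]
      by (intro nn_integral_eq_integral Bochner_Integration.integrable_diff unif.integrable_const int AE_I2)
  qed
  also have "(\<integral>y. 1 - p * indicator {y. torus_dist (x v) y \<le> r} y \<partial>unif_sq) = 1 - pi * r\<^sup>2 * p" for x :: "nat \<Rightarrow> real \<times> real"
    using int[of x] sets_torus_ball[OF r(2)] measure_torus_ball[OF r] unif.prob_space
    by (subst Bochner_Integration.integral_diff) auto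
  finally have phi: "(\<integral>\<^sup>+y. ennreal (miss r p {v} x y) \<partial>unif_sq) = ennreal (1 - pi * r\<^sup>2 * p)" for x .
  have pr: "pi * r\<^sup>2 \<le> 1" using measure_torus_ball[OF r, of "(0,0)"] unif.prob_le_1 by metis
  have q: "0 \<le> 1 - pi * r\<^sup>2 * p" using mult_mono[OF pr p(2)] p by simp
  have "emeasure (grp_space n p) {\<omega> \<in> space (grp_space n p). isolated_vertex (grp_graph n r \<omega>) v} = ennreal ((1 - pi * r\<^sup>2 * p) ^ (n - 1))"
    unfolding isolated_iff_no_edges[OF v] using v q
    by (subst prob_no_edges_from[OF p r(2)]) (auto simp: phi M.emeasure_space_1 ennreal_power)
  then show ?thesis using q by (simp add: measure_def)
qed

text \<open>Exchanging the integrals fixes the common point \<open>y\<close>; the two centres then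
  fall within r of it independently.\<close>

lemma ball_overlap_integral:
  assumes r: "0 \<le> r" "r < 1/2" and ij: "i \<noteq> j"
  shows "(\<integral>\<^sup>+x. emeasure unif_sq ({y. torus_dist (x i) y \<le> r} \<inter> {y. torus_dist (x j) y \<le> r}) \<partial>PiM {i, j :: nat} (\<lambda>_. unif_sq)) =
     ennreal ((pi * r\<^sup>2)\<^sup>2)"
proof -
  interpret unif: prob_space unif_sq by (rule prob_space_unif_sq)
  interpret product_sigma_finite "\<lambda>_. unif_sq" ..
  let ?U = "{i, j}"
  let ?M = "PiM ?U (\<lambda>_. unif_sq)"
  interpret M: prob_space ?M by (intro prob_space_PiM prob_space_unif_sq)
  interpret MU: pair_sigma_finite ?M unif_sq ..
  define f :: "(nat \<Rightarrow> real \<times> real) \<times> (real \<times> real) \<Rightarrow> ennreal" where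
    "f z = (\<Prod>u\<in>?U. indicator {y. torus_dist (fst z u) y \<le> r} (snd z))" for z
  have fm: "f \<in> borel_measurable (?M \<Otimes>\<^sub>M unif_sq)"
    unfolding f_def using pred_torus_ball[OF r(2), of _ ?U]
    by (intro borel_measurable_prod_ennreal borel_measurable_indicator') (simp add: pred_def)
  have "(\<integral>\<^sup>+x. emeasure unif_sq ({y. torus_dist (x i) y \<le> r} \<inter> {y. torus_dist (x j) y \<le> r}) \<partial>?M) =
      (\<integral>\<^sup>+x. (\<integral>\<^sup>+y. f (x, y) \<partial>unif_sq) \<partial>?M)"
  proof (intro nn_integral_cong)
    fix x :: "nat \<Rightarrow> real \<times> real"
    have "(\<integral>\<^sup>+y. f (x, y) \<partial>unif_sq) = (\<integral>\<^sup>+y. indicator ({y. torus_dist (x i) y \<le> r} \<inter> {y. torus_dist (x j) y \<le> r}) y \<partial>unif_sq)"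
      using ij by (intro nn_integral_cong) (auto simp: f_def indicator_def)
    also have "\<dots> = emeasure unif_sq ({y. torus_dist (x i) y \<le> r} \<inter> {y. torus_dist (x j) y \<le> r})"
      using sets_torus_ball[OF r(2)] by (intro nn_integral_indicator) auto
    finally show "emeasure unif_sq ({y. torus_dist (x i) y \<le> r} \<inter> {y. torus_dist (x j) y \<le> r}) = (\<integral>\<^sup>+y. f (x, y) \<partial>unif_sq)" ..
  qed
  also have "\<dots> = (\<integral>\<^sup>+y. (\<integral>\<^sup>+x. f (x, y) \<partial>?M) \<partial>unif_sq)"
    by (rule MU.Fubini'[symmetric]) (use fm in \<open>simp add: case_prod_eta\<close>)
  also have "\<dots> = (\<integral>\<^sup>+y. (\<Prod>u\<in>?U. ennreal (pi * r\<^sup>2)) \<partial>unif_sq)"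
  proof (intro nn_integral_cong)
    fix y :: "real \<times> real"
    have "(\<integral>\<^sup>+x. f (x, y) \<partial>?M) = (\<integral>\<^sup>+x. (\<Prod>u\<in>?U. indicator {z. torus_dist y z \<le> r} (x u)) \<partial>?M)"
      by (intro nn_integral_cong) (simp add: f_def indicator_def torus_dist_commute[of y])
    also have "\<dots> = (\<Prod>u\<in>?U. \<integral>\<^sup>+z. indicator {z. torus_dist y z \<le> r} z \<partial>unif_sq)"
      by (intro product_nn_integral_prod borel_measurable_indicator sets_torus_ball r(2)) simp
    also have "\<dots> = (\<Prod>u\<in>?U. ennreal (pi * r\<^sup>2))"
      using sets_torus_ball[OF r(2)] emeasure_torus_ball[OF r] by simp
    finally show "(\<integral>\<^sup>+x. f (x, y) \<partial>?M) = (\<Prod>u\<in>?U. ennreal (pi * r\<^sup>2))" .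
  qed
  also have "\<dots> = ennreal ((pi * r\<^sup>2)\<^sup>2)"
    using ij unif.emeasure_space_1 by (simp add: ennreal_mult'[symmetric] power2_eq_square)
  finally show ?thesis .
qed

text \<open>With z = p^2 s / (1 - q)^2 the base is at most (1 - q)^2 (1 + z), and z measures the
  dependence. The power of 1 + z is replaced by a bound linear in s, whose mean is known; the
  exponential left over is estimated by the largest possible overlap. That is crude but affordable,
  since it only multiplies n q^2 up to powers of 1 - q.\<close>

lemma prob_two_isolated:
  assumes p: "0 \<le> p" "p \<le> 1" and r: "0 \<le> r" "r < 1/2" and ij: "i < n" "j < n" "i \<noteq> j"
    and q: "q = pi * r\<^sup>2 * p" "q < 1"
  shows "measure (grp_space n p) {\<omega> \<in> space (grp_space n p). isolated_vertex (grp_graph n r \<omega>) i \<and> isolated_vertex (grp_graph n r \<omega>) j} \<le>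
    ((1 - q)\<^sup>2) ^ (n - 2) * (1 + real n * (q / (1 - q))\<^sup>2 * exp (real n * q / (1 - q)\<^sup>2))"
proof -
  interpret unif: prob_space unif_sq by (rule prob_space_unif_sq)
  interpret G: prob_space "grp_space n p" by (rule prob_space_grp_space)
  let ?U = "{i, j}"
  let ?M = "PiM ?U (\<lambda>_. unif_sq)"
  interpret M: prob_space ?M by (intro prob_space_PiM prob_space_unif_sq)
  define B where "B x u = {y. torus_dist (x u) y \<le> r}" for x :: "nat \<Rightarrow> real \<times> real" and u
  define s where "s x = unif.prob (B x i \<inter> B x j)" for x
  have Bs: "B x u \<in> sets unif_sq" for x u unfolding B_def by (rule sets_torus_ball[OF r(2)])
  have mB: "unif.prob (B x u) = pi * r\<^sup>2" for x u unfolding B_def by (rule measure_torus_ball[OF r])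
  have q0: "0 \<le> q" using p q by simp
  have q1: "0 < 1 - q" using q by simp
  have ints: "integrable unif_sq (\<lambda>y. indicator A y :: real)" if "A \<in> sets unif_sq" for A
    using that by (intro integrable_real_indicator) (auto simp: less_top[symmetric])
  have m: "miss r p ?U x y = 1 - p * indicator (B x i) y - p * indicator (B x j) y + p\<^sup>2 * indicator (B x i \<inter> B x j) y" for x y
    using ij(3) unfolding miss_def B_def by (simp add: indicator_def power2_eq_square algebra_simps)
  have phi: "(\<integral>\<^sup>+y. ennreal (miss r p ?U x y) \<partial>unif_sq) = ennreal (1 - 2 * q + p\<^sup>2 * s x)" for x
  proof -
    have "integrable unif_sq (\<lambda>y. miss r p ?U x y)"
      unfolding m by (intro Bochner_Integration.integrable_add Bochner_Integration.integrable_diff integrable_mult_right ints sets.Int Bs) simp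
    then have "(\<integral>\<^sup>+y. ennreal (miss r p ?U x y) \<partial>unif_sq) = ennreal (\<integral>y. miss r p ?U x y \<partial>unif_sq)"
      using miss_nonneg[OF p] by (intro nn_integral_eq_integral) auto
    also have "(\<integral>y. miss r p ?U x y \<partial>unif_sq) = 1 - p * unif.prob (B x i) - p * unif.prob (B x j) + p\<^sup>2 * s x"
      unfolding m s_def using Bs ints unif.prob_space
      by (simp add: sets.Int)
    finally show ?thesis by (simp add: mB q mult_ac)
  qed
  define W where "W = real n / (1 - q)\<^sup>2 * p\<^sup>2 * exp (real n * q / (1 - q)\<^sup>2)"
  have W0: "0 \<le> W" by (simp add: W_def)
  have pw: "(1 - 2 * q + p\<^sup>2 * s x) ^ (n - 2) \<le> ((1 - q)\<^sup>2) ^ (n - 2) * (1 + W * s x)" and nn: "0 \<le> 1 - 2 * q + p\<^sup>2 * s x" for x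
  proof -
    have s0: "0 \<le> s x" by (simp add: s_def)
    have "s x \<le> unif.prob (B x i)" unfolding s_def using Bs by (intro unif.finite_measure_mono) auto
    then have s1: "s x \<le> pi * r\<^sup>2" by (simp add: mB)
    define z where "z = p\<^sup>2 * s x / (1 - q)\<^sup>2"
    have z0: "0 \<le> z" using s0 by (simp add: z_def)
    have "p\<^sup>2 * s x \<le> q"
    proof -
      have "p\<^sup>2 * s x \<le> p\<^sup>2 * (pi * r\<^sup>2)" using s1 by (intro mult_left_mono) auto
      also have "\<dots> = p * q" by (simp add: q power2_eq_square)
      also have "\<dots> \<le> 1 * q" using p q0 by (intro mult_right_mono) auto
      finally show ?thesis by simp
    qed
    then have zq: "z \<le> q / (1 - q)\<^sup>2" by (simp add: z_def divide_right_mono)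
    \<comment> \<open>By inclusion-exclusion the union of the discs has area 2 pi r^2 - s, at most
      1. The decomposition weights the points of both, exactly one and neither disc by (1 - p)^2, 1
      - p and 1.\<close>
    show nn: "0 \<le> 1 - 2 * q + p\<^sup>2 * s x"
    proof -
      have "unif.prob (B x i) + unif.prob (B x j) = unif.prob (B x i \<union> B x j) + s x"
        unfolding s_def using Bs[of x i] Bs[of x j]
        by (subst measure_Un3) (auto simp: fmeasurable_def less_top[symmetric])
      then have u: "2 * (pi * r\<^sup>2) - s x \<le> 1" using unif.prob_le_1[of "B x i \<union> B x j"] by (simp add: mB)
      have "1 - 2 * q + p\<^sup>2 * s x = (1 - p)\<^sup>2 * s x + (1 - p) * (2 * (pi * r\<^sup>2 - s x)) + (1 - (2 * (pi * r\<^sup>2) - s x))"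
        by (simp add: q power2_eq_square algebra_simps)
      also have "0 \<le> \<dots>" using p s0 s1 u by (intro add_nonneg_nonneg mult_nonneg_nonneg) auto
      finally show ?thesis .
    qed
    have "1 - 2 * q + p\<^sup>2 * s x \<le> (1 - q)\<^sup>2 * (1 + z)"
    proof -
      have "(1 - q)\<^sup>2 * z = p\<^sup>2 * s x" using q1 by (simp add: z_def)
      then have "(1 - q)\<^sup>2 * (1 + z) = 1 - 2 * q + q\<^sup>2 + p\<^sup>2 * s x" by (simp add: distrib_left power2_diff)
      then show ?thesis by simp
    qed
    then have "(1 - 2 * q + p\<^sup>2 * s x) ^ (n - 2) \<le> ((1 - q)\<^sup>2 * (1 + z)) ^ (n - 2)"
      using nn by (intro power_mono) auto
    also have "\<dots> = ((1 - q)\<^sup>2) ^ (n - 2) * (1 + z) ^ (n - 2)" by (rule power_mult_distrib)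
    also have "\<dots> \<le> ((1 - q)\<^sup>2) ^ (n - 2) * (1 + W * s x)"
    proof (rule mult_left_mono)
      have "(1 + z) ^ (n - 2) \<le> (1 + z) ^ n" using z0 by (intro power_increasing) auto
      also have "\<dots> \<le> exp z ^ n" using z0 exp_ge_add_one_self[of z] by (intro power_mono) auto
      also have "\<dots> = exp (real n * z)" by (simp add: exp_of_nat_mult[symmetric])
      \<comment> \<open>From 1 - t <= exp (-t), multiplied by exp t.\<close>
      also have "\<dots> \<le> 1 + real n * z * exp (real n * z)"
      proof -
        have "1 - real n * z \<le> exp (- (real n * z))" using exp_ge_add_one_self[of "- (real n * z)"] by simp
        then have "(1 - real n * z) * exp (real n * z) \<le> exp (- (real n * z)) * exp (real n * z)"
          by (intro mult_right_mono) auto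
        then show ?thesis by (simp add: exp_minus left_diff_distrib)
      qed
      also have "\<dots> \<le> 1 + real n * z * exp (real n * (q / (1 - q)\<^sup>2))"
      proof -
        have "real n * z \<le> real n * (q / (1 - q)\<^sup>2)" using zq by (intro mult_left_mono) auto
        then have "exp (real n * z) \<le> exp (real n * (q / (1 - q)\<^sup>2))" by (simp only: exp_le_cancel_iff)
        then show ?thesis using z0 by (intro add_left_mono mult_left_mono) auto
      qed
      also have "\<dots> = 1 + W * s x" by (simp add: W_def z_def)
      finally show "(1 + z) ^ (n - 2) \<le> 1 + W * s x" .
    qed simp
    finally show "(1 - 2 * q + p\<^sup>2 * s x) ^ (n - 2) \<le> ((1 - q)\<^sup>2) ^ (n - 2) * (1 + W * s x)" .
  qed
  have "emeasure (grp_space n p) {\<omega> \<in> space (grp_space n p). isolated_vertex (grp_graph n r \<omega>) i \<and> isolated_vertex (grp_graph n r \<omega>) j} \<le>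
     emeasure (grp_space n p) {\<omega> \<in> space (grp_space n p). no_edges_from n r ?U \<omega>}"
    using pred_no_edges_from[OF r(2), of ?U] 
    by (intro emeasure_mono) (auto simp: isolated_grp_graph_iff no_edges_from_def pred_def)
  also have "\<dots> = (\<integral>\<^sup>+x. ennreal ((1 - 2 * q + p\<^sup>2 * s x) ^ (n - 2)) \<partial>?M)"
  proof -
    have c: "n - card ?U = n - 2" and sub: "?U \<subseteq> {..<n}" using ij by simp_all
    show ?thesis
      unfolding prob_no_edges_from[OF p r(2) sub] phi c by (simp only: ennreal_power[OF nn])
  qed
  also have "\<dots> \<le> (\<integral>\<^sup>+x. ennreal (((1 - q)\<^sup>2) ^ (n - 2)) * (1 + ennreal W * ennreal (s x)) \<partial>?M)"
  proof (intro nn_integral_mono)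
    fix x
    have "0 \<le> s x" by (simp add: s_def)
    then have "ennreal (((1 - q)\<^sup>2) ^ (n - 2)) * (1 + ennreal W * ennreal (s x)) = ennreal (((1 - q)\<^sup>2) ^ (n - 2) * (1 + W * s x))"
      using W0 by (simp add: ennreal_mult ennreal_plus)
    then show "ennreal ((1 - 2 * q + p\<^sup>2 * s x) ^ (n - 2)) \<le> ennreal (((1 - q)\<^sup>2) ^ (n - 2)) * (1 + ennreal W * ennreal (s x))"
      using pw[of x] by (simp add: ennreal_leI)
  qed
  also have "\<dots> = ennreal (((1 - q)\<^sup>2) ^ (n - 2)) * (1 + ennreal W * ennreal ((pi * r\<^sup>2)\<^sup>2))"
  proof -
    have es: "ennreal (s x) = emeasure unif_sq (B x i \<inter> B x j)" for x by (simp add: s_def unif.emeasure_eq_measure)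
    have sm: "(\<lambda>x. ennreal (s x)) \<in> borel_measurable ?M"
    proof -
      have "Measurable.pred (?M \<Otimes>\<^sub>M unif_sq) (\<lambda>z. torus_dist (fst z i) (snd z) \<le> r \<and> torus_dist (fst z j) (snd z) \<le> r)"
        using pred_torus_ball[OF r(2), of i ?U] pred_torus_ball[OF r(2), of j ?U] by (auto intro: pred_intros_logic)
      then have "{z \<in> space (?M \<Otimes>\<^sub>M unif_sq). torus_dist (fst z i) (snd z) \<le> r \<and> torus_dist (fst z j) (snd z) \<le> r} \<in> sets (?M \<Otimes>\<^sub>M unif_sq)" (is "?Z \<in> _")
        unfolding pred_def .
      from unif.measurable_emeasure_Pair[OF this] have "(\<lambda>x. emeasure unif_sq (Pair x -` ?Z)) \<in> borel_measurable ?M" .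
      also have "?this \<longleftrightarrow> ?thesis"
        unfolding es by (intro measurable_cong arg_cong[where f = "emeasure unif_sq"]) (auto simp: B_def space_pair_measure)
      finally show ?thesis .
    qed
    have "(\<integral>\<^sup>+x. ennreal (s x) \<partial>?M) = ennreal ((pi * r\<^sup>2)\<^sup>2)"
      unfolding es B_def by (rule ball_overlap_integral[OF r ij(3)])
    then show ?thesis
      using sm M.emeasure_space_1 by (simp add: nn_integral_cmult nn_integral_add)
  qed
  also have "\<dots> = ennreal (((1 - q)\<^sup>2) ^ (n - 2) * (1 + W * (pi * r\<^sup>2)\<^sup>2))"
    using W0 by (simp add: ennreal_mult ennreal_plus)
  also have "W * (pi * r\<^sup>2)\<^sup>2 = real n * (q / (1 - q))\<^sup>2 * exp (real n * q / (1 - q)\<^sup>2)"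
    by (simp add: W_def q power_divide power_mult_distrib)
  finally show ?thesis
    unfolding G.emeasure_eq_measure by (subst (asm) ennreal_le_iff) auto
qed

abbreviation (input) isolated_prob :: "nat \<Rightarrow> real \<Rightarrow> real \<Rightarrow> real" where
  "isolated_prob n r p \<equiv> \<P>(\<omega> in grp_space n p. \<not> connected_graph (grp_graph n r \<omega>) \<and> (\<exists>v. isolated_vertex (grp_graph n r \<omega>) v))"

text \<open>Chebyshev for the number f of isolated vertices: f = 0 is a deviation by the whole mean.
  The diagonal of the second moment gives 1 / \<mu>, and the pairs give the remainder.\<close>

lemma prob_no_isolated:
  assumes p: "0 \<le> p" "p \<le> 1" and r: "0 \<le> r" "r < 1/2" and q: "q = pi * r\<^sup>2 * p" "q < 1" and n: "2 \<le> n"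
  shows "1 - isolated_prob n r p \<le>
    1 / (real n * (1 - q) ^ (n - 1)) + ((1 + real n * (q / (1 - q))\<^sup>2 * exp (real n * q / (1 - q)\<^sup>2)) / (1 - q)\<^sup>2 - 1)"
proof -
  interpret G: prob_space "grp_space n p" by (rule prob_space_grp_space)
  define A where "A v = {\<omega> \<in> space (grp_space n p). isolated_vertex (grp_graph n r \<omega>) v}" for v
  have Am: "A v \<in> G.events" if "v < n" for v
    using pred_no_edges_from[OF r(2), of "{v}" n p] unfolding A_def isolated_iff_no_edges[OF that] by (simp add: pred_def)
  define \<mu> where "\<mu> = real n * (1 - q) ^ (n - 1)"
  define w where "w = 1 + real n * (q / (1 - q))\<^sup>2 * exp (real n * q / (1 - q)\<^sup>2)"
  have q1: "0 < 1 - q" using q by simp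
  have \<mu>0: "0 < \<mu>" using n q1 by (simp add: \<mu>_def)
  define f where "f \<omega> = (\<Sum>v<n. indicator (A v) \<omega> :: real)" for \<omega>
  have iA: "integrable (grp_space n p) (indicator A' :: _ \<Rightarrow> real)" if "A' \<in> G.events" for A'
    using that by (intro integrable_real_indicator) (auto simp: less_top[symmetric])
  have fm: "f \<in> borel_measurable (grp_space n p)"
    unfolding f_def using Am by (intro borel_measurable_sum borel_measurable_indicator) auto
  have fsq: "(f \<omega>)\<^sup>2 = (\<Sum>v<n. \<Sum>u<n. indicator (A v \<inter> A u) \<omega>)" for \<omega>
    unfolding f_def power2_eq_square sum_product by (simp add: indicator_inter_arith)
  have Ef: "G.expectation f = \<mu>"
  proof -
    have "G.expectation f = (\<Sum>v<n. G.prob (A v))"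
      unfolding f_def using Am iA by (subst Bochner_Integration.integral_sum) auto
    also have "\<dots> = (\<Sum>v<n. (1 - q) ^ (n - 1))"
      using prob_isolated[OF p r] by (intro sum.cong) (auto simp: A_def q)
    finally show ?thesis by (simp add: \<mu>_def)
  qed
  have int2: "integrable (grp_space n p) (\<lambda>\<omega>. (f \<omega>)\<^sup>2)"
    unfolding fsq using Am by (intro Bochner_Integration.integrable_sum iA sets.Int) auto
  have Ef2: "G.expectation (\<lambda>\<omega>. (f \<omega>)\<^sup>2) \<le> \<mu> + (real n)\<^sup>2 * (((1 - q)\<^sup>2) ^ (n - 2) * w)"
  proof -
    have "G.expectation (\<lambda>\<omega>. (f \<omega>)\<^sup>2) = (\<Sum>v<n. \<Sum>u<n. G.prob (A v \<inter> A u))"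
      unfolding fsq using Am iA
      by (subst Bochner_Integration.integral_sum, simp)
         (auto intro!: sum.cong Bochner_Integration.integral_sum Bochner_Integration.integrable_sum iA simp: Bochner_Integration.integral_sum)
    also have "\<dots> \<le> (\<Sum>v<n. \<Sum>u<n. (if v = u then (1 - q) ^ (n - 1) else 0) + ((1 - q)\<^sup>2) ^ (n - 2) * w)"
    proof (intro sum_mono)
      fix v u assume vu: "v \<in> {..<n}" "u \<in> {..<n}"
      have w0: "0 \<le> ((1 - q)\<^sup>2) ^ (n - 2) * w" by (simp add: w_def)
      show "G.prob (A v \<inter> A u) \<le> (if v = u then (1 - q) ^ (n - 1) else 0) + ((1 - q)\<^sup>2) ^ (n - 2) * w"
      proof (cases "v = u")
        case True
        then show ?thesis using prob_isolated[OF p r, of v n] vu w0 by (simp add: A_def q)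
      next
        case False
        have "A v \<inter> A u = {\<omega> \<in> space (grp_space n p). isolated_vertex (grp_graph n r \<omega>) v \<and> isolated_vertex (grp_graph n r \<omega>) u}"
          by (auto simp: A_def)
        then show ?thesis using prob_two_isolated[OF p r _ _ False q, of n] vu False by (simp add: w_def)
      qed
    qed
    also have "\<dots> = \<mu> + (real n)\<^sup>2 * (((1 - q)\<^sup>2) ^ (n - 2) * w)"
      by (simp add: sum.distrib \<mu>_def power2_eq_square distrib_left mult.assoc)
    finally show ?thesis .
  qed
  define Z where "Z = {\<omega> \<in> space (grp_space n p). \<mu> \<le> \<bar>f \<omega> - G.expectation f\<bar>}"
  have "G.prob Z \<le> G.variance f / \<mu>\<^sup>2"
    unfolding Z_def using \<mu>0 by (intro G.Chebyshev_inequality fm int2)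
  also have "G.variance f = G.expectation (\<lambda>\<omega>. (f \<omega>)\<^sup>2) - \<mu>\<^sup>2"
  proof -
    have "integrable (grp_space n p) f"
      unfolding f_def using Am by (intro Bochner_Integration.integrable_sum iA) auto
    from G.variance_eq[OF this int2] show ?thesis by (simp add: Ef)
  qed
  also have "\<dots> / \<mu>\<^sup>2 \<le> (\<mu> + (real n)\<^sup>2 * (((1 - q)\<^sup>2) ^ (n - 2) * w) - \<mu>\<^sup>2) / \<mu>\<^sup>2"
    using Ef2 by (intro divide_right_mono) auto
  \<comment> \<open>The divisor (1 - q)^2 comes from the exponents: n - 1 for one vertex in \<mu>,
    but n - 2 for a pair.\<close>
  also have "\<dots> = 1 / \<mu> + (w / (1 - q)\<^sup>2 - 1)"
  proof -
    have nn: "n - 1 = Suc (n - 2)" using n by simp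
    have "\<mu>\<^sup>2 = (real n)\<^sup>2 * (((1 - q)\<^sup>2) ^ (n - 2) * (1 - q)\<^sup>2)"
      unfolding \<mu>_def nn power_mult_distrib by (simp add: power_mult_distrib power2_eq_square)
    then have "(real n)\<^sup>2 * (((1 - q)\<^sup>2) ^ (n - 2) * w) / \<mu>\<^sup>2 = w / (1 - q)\<^sup>2"
      using n q1 by simp
    moreover have "\<mu> / \<mu>\<^sup>2 = 1 / \<mu>" "\<mu>\<^sup>2 / \<mu>\<^sup>2 = 1" using \<mu>0 by (simp_all add: power2_eq_square)
    ultimately show ?thesis by (simp add: add_divide_distrib diff_divide_distrib)
  qed
  finally have Zp: "G.prob Z \<le> 1 / \<mu> + (w / (1 - q)\<^sup>2 - 1)" .
  let ?I = "{\<omega> \<in> space (grp_space n p). \<not> connected_graph (grp_graph n r \<omega>) \<and> (\<exists>v. isolated_vertex (grp_graph n r \<omega>) v)}"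
  have I: "?I = (\<Union>v\<in>{..<n}. A v)"
  proof -
    have "isolated_vertex (grp_graph n r \<omega>) v \<Longrightarrow> v < n \<and> \<not> connected_graph (grp_graph n r \<omega>)" for v \<omega>
      using isolated_imp_not_connected[OF _ n] by (auto simp: isolated_grp_graph_iff)
    then show ?thesis unfolding A_def by auto
  qed
  have Im: "?I \<in> G.events" unfolding I using Am by (intro sets.finite_UN) auto
  have "space (grp_space n p) - ?I \<subseteq> Z"
  proof
    fix \<omega> assume w: "\<omega> \<in> space (grp_space n p) - ?I"
    then have "f \<omega> = 0" unfolding f_def I by (intro sum.neutral) (auto simp: indicator_def)
    with w \<mu>0 show "\<omega> \<in> Z" unfolding Z_def Ef by simp
  qed
  moreover have "Z \<in> G.events" unfolding Z_def using fm by measurable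
  ultimately have "G.prob (space (grp_space n p) - ?I) \<le> G.prob Z" by (intro G.finite_measure_mono)
  then have "1 - G.prob ?I \<le> G.prob Z" using G.prob_compl[OF Im] by simp
  with Zp show ?thesis unfolding \<mu>_def w_def by linarith
qed

theorem isolated_vertices_limit:
  fixes \<epsilon> :: real
  assumes \<epsilon>: "0 < \<epsilon>" "\<epsilon> \<le> 1/2"
  shows "\<exists>g. g \<longlonglongrightarrow> 0 \<and> (\<forall>\<^sub>F n in sequentially. \<forall>r p. 0 \<le> r \<longrightarrow> r \<le> 1/4 \<longrightarrow> 0 \<le> p \<longrightarrow> p \<le> 1 \<longrightarrow>
     pi * r\<^sup>2 * p \<le> (1 - \<epsilon>) * ln (real n) / real n \<longrightarrow>
     1 - isolated_prob n r p \<le> g n)"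
proof -
  define l where "l n = ln (real n) / real n" for n
  \<comment> \<open>Bounds 1 / \<mu> through 1 - q >= exp (-q - 2 q^2), valid for q <= 1/2, together
    with n q^2 <= (ln n)^2 / n.\<close>
  define g1 where "g1 n = exp ((1 - \<epsilon>) * ln (real n) + 2 * (ln (real n))\<^sup>2 / real n) / real n" for n
  define g2 where "g2 n = 4 * (ln (real n))\<^sup>2 / real n * real n powr (1 - \<epsilon>\<^sup>2)" for n
  define g where "g n = g1 n + ((1 + g2 n) / (1 - l n)\<^sup>2 - 1)" for n
  have l0: "l \<longlonglongrightarrow> 0" unfolding l_def by real_asymp
  have "g1 \<longlonglongrightarrow> 0" unfolding g1_def using \<epsilon> by real_asymp
  moreover have "g2 \<longlonglongrightarrow> 0"
  proof -
    have e2: "0 < \<epsilon>\<^sup>2" using \<epsilon> by simp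
    show ?thesis unfolding g2_def using e2 by real_asymp
  qed
  ultimately have "g \<longlonglongrightarrow> 0 + ((1 + 0) / (1 - 0)\<^sup>2 - 1)"
    unfolding g_def by (intro tendsto_add tendsto_diff tendsto_divide tendsto_power tendsto_const l0) auto
  then have g: "g \<longlonglongrightarrow> 0" by simp
  have "(\<lambda>n. 1 / (1 - l n)\<^sup>2) \<longlonglongrightarrow> 1 / (1 - 0)\<^sup>2"
    by (intro tendsto_divide tendsto_power tendsto_diff tendsto_const l0) auto
  \<comment> \<open>Turns n q / (1 - q)^2 into at most (1 - \<epsilon>) (1 + \<epsilon>) ln n. The
    exponential is then at most n^(1 - \<epsilon>^2), just below the power that (ln n)^2 / n can
    absorb.\<close>
  then have ev1: "\<forall>\<^sub>F n in sequentially. 1 / (1 - l n)\<^sup>2 < 1 + \<epsilon>"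
    using \<epsilon> by (intro order_tendstoD(2)) auto
  have ev2: "\<forall>\<^sub>F n in sequentially. l n < 1/2" using l0 by (intro order_tendstoD(2)) auto
  have ev3: "\<forall>\<^sub>F n in sequentially. 2 \<le> n" by (rule eventually_ge_at_top)
  have ev4: "\<forall>\<^sub>F n in sequentially. 1 \<le> ln (real n)" by real_asymp
  from ev1 ev2 ev3 ev4 have "\<forall>\<^sub>F n in sequentially. \<forall>r p. 0 \<le> r \<longrightarrow> r \<le> 1/4 \<longrightarrow> 0 \<le> p \<longrightarrow> p \<le> 1 \<longrightarrow>
     pi * r\<^sup>2 * p \<le> (1 - \<epsilon>) * ln (real n) / real n \<longrightarrow>
     1 - isolated_prob n r p \<le> g n"
  proof (eventually_elim, intro allI impI)
    fix n :: nat and r p :: real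
    assume e1: "1 / (1 - l n)\<^sup>2 < 1 + \<epsilon>" and e2: "l n < 1/2" and n: "2 \<le> n" and ln1: "1 \<le> ln (real n)"
      and r: "0 \<le> r" "r \<le> 1/4" and p: "0 \<le> p" "p \<le> 1" and ql: "pi * r\<^sup>2 * p \<le> (1 - \<epsilon>) * ln (real n) / real n"
    define q where "q = pi * r\<^sup>2 * p"
    define L where "L = ln (real n)"
    have n0: "0 < real n" using n by simp
    have q0: "0 \<le> q" using p by (simp add: q_def)
    have nq: "real n * q \<le> (1 - \<epsilon>) * L" using ql n0 by (simp add: q_def L_def field_simps)
    have "q \<le> (1 - \<epsilon>) * l n" using ql by (simp add: q_def l_def)
    also have "\<dots> \<le> 1 * l n" using \<epsilon> ln1 by (intro mult_right_mono) (auto simp: l_def)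
    finally have ql': "q \<le> l n" by simp
    have q12: "q \<le> 1/2" using ql' e2 by simp
    have mu: "1 / (real n * (1 - q) ^ (n - 1)) \<le> g1 n"
    proof -
      have "exp (- q - 2 * q\<^sup>2) \<le> 1 - q"
      proof -
        have "- q - 2 * q\<^sup>2 \<le> ln (1 - q)" using q0 q12 by (rule ln_one_minus_pos_lower_bound)
        then show ?thesis using q12 by (subst (asm) ln_ge_iff) auto
      qed
      then have "exp (- q - 2 * q\<^sup>2) ^ n \<le> (1 - q) ^ n" by (intro power_mono) auto
      also have "\<dots> \<le> (1 - q) ^ (n - 1)" using q0 q12 by (intro power_decreasing) auto
      finally have "exp (- (real n * q + 2 * real n * q\<^sup>2)) \<le> (1 - q) ^ (n - 1)"
        by (simp add: exp_of_nat_mult[symmetric] algebra_simps)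
      moreover have "exp (- ((1 - \<epsilon>) * L + 2 * L\<^sup>2 / real n)) \<le> exp (- (real n * q + 2 * real n * q\<^sup>2))"
      proof -
        have "q\<^sup>2 \<le> (l n)\<^sup>2" using ql' q0 by (intro power_mono) auto
        then have "real n * q\<^sup>2 \<le> real n * (l n)\<^sup>2" by (intro mult_left_mono) auto
        also have "\<dots> = L\<^sup>2 / real n" using n0 by (simp add: l_def L_def power_divide power2_eq_square)
        finally show ?thesis using nq by simp
      qed
      ultimately have "exp (- ((1 - \<epsilon>) * L + 2 * L\<^sup>2 / real n)) \<le> (1 - q) ^ (n - 1)" by linarith
      then have "1 / (real n * (1 - q) ^ (n - 1)) \<le> 1 / (real n * exp (- ((1 - \<epsilon>) * L + 2 * L\<^sup>2 / real n)))"
        using n0 by (intro divide_left_mono mult_left_mono mult_pos_pos) (auto intro: less_le_trans[OF exp_gt_zero])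
      also have "\<dots> = g1 n"
      proof -
        have "1 / (real n * exp (- A)) = exp A / real n" for A by (simp add: exp_minus divide_inverse mult.commute)
        then show ?thesis unfolding g1_def L_def[symmetric] .
      qed
      finally show ?thesis .
    qed
    have sq: "(1 - l n)\<^sup>2 \<le> (1 - q)\<^sup>2" using ql' e2 by (intro power_mono) auto
    have sq0: "0 < (1 - l n)\<^sup>2" using e2 by simp
    have inv: "1 / (1 - q)\<^sup>2 \<le> 1 / (1 - l n)\<^sup>2" using sq sq0 by (intro divide_left_mono mult_pos_pos) auto
    have w: "real n * (q / (1 - q))\<^sup>2 * exp (real n * q / (1 - q)\<^sup>2) \<le> g2 n"
    proof -
      have iq: "1 / (1 - q)\<^sup>2 \<le> 1 + \<epsilon>" using inv e1 by linarith
      have "real n * q * (1 / (1 - q)\<^sup>2) \<le> ((1 - \<epsilon>) * L) * (1 + \<epsilon>)"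
        using \<epsilon> ln1 by (intro mult_mono[OF nq iq]) (auto simp: L_def)
      also have "\<dots> = (1 - \<epsilon>\<^sup>2) * L" by (simp add: power2_eq_square algebra_simps)
      finally have "exp (real n * q / (1 - q)\<^sup>2) \<le> exp ((1 - \<epsilon>\<^sup>2) * L)" by simp
      also have "\<dots> = real n powr (1 - \<epsilon>\<^sup>2)" using n by (simp add: powr_def L_def)
      finally have a: "exp (real n * q / (1 - q)\<^sup>2) \<le> real n powr (1 - \<epsilon>\<^sup>2)" .
      have "q / (1 - q) \<le> 2 * l n"
      proof -
        have "q / (1 - q) \<le> q / (1/2)" using q0 q12 by (intro divide_left_mono) auto
        with ql' show ?thesis by simp
      qed
      then have "(q / (1 - q))\<^sup>2 \<le> (2 * l n)\<^sup>2" using q0 q12 by (intro power_mono) auto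
      then have "real n * (q / (1 - q))\<^sup>2 \<le> real n * (2 * l n)\<^sup>2" by (intro mult_left_mono) auto
      also have "\<dots> = 4 * L\<^sup>2 / real n" using n0 by (simp add: l_def L_def power_divide power2_eq_square)
      finally show ?thesis unfolding g2_def L_def[symmetric] using a by (intro mult_mono) auto
    qed
    have "1 - isolated_prob n r p \<le>
      1 / (real n * (1 - q) ^ (n - 1)) + ((1 + real n * (q / (1 - q))\<^sup>2 * exp (real n * q / (1 - q)\<^sup>2)) / (1 - q)\<^sup>2 - 1)"
      using r q12 by (intro prob_no_isolated p q_def n) auto
    also have "\<dots> \<le> g n"
    proof -
      have g20: "0 \<le> g2 n" by (simp add: g2_def)
      have "(1 + real n * (q / (1 - q))\<^sup>2 * exp (real n * q / (1 - q)\<^sup>2)) * (1 / (1 - q)\<^sup>2) \<le> (1 + g2 n) * (1 / (1 - l n)\<^sup>2)"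
        using w inv g20 by (intro mult_mono) auto
      then show ?thesis using mu unfolding g_def by simp
    qed
    finally show "1 - isolated_prob n r p \<le> g n" .
  qed
  with g show ?thesis by blast
qed

subsection \<open>The threshold\<close>

theorem theorem2:
  fixes \<epsilon> :: real
  assumes "\<epsilon> > 0"
  shows "\<exists>r0 > 0. \<forall>r p :: nat \<Rightarrow> real.
    (\<forall>n. 0 \<le> r n \<and> r n \<le> r0 \<and> 0 \<le> p n \<and> p n \<le> 1) \<longrightarrow>
      ((\<forall>\<^sub>F n in sequentially. pi * (r n)\<^sup>2 * p n \<le> (1 - \<epsilon>) * ln (real n) / real n) \<longrightarrow>
        (\<lambda>n. \<P>(\<omega> in grp_space n (p n). \<not> connected_graph (grp_graph n (r n) \<omega>) \<and>
                (\<exists>v. isolated_vertex (grp_graph n (r n) \<omega>) v))) \<longlonglongrightarrow> 1) \<and>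
      ((\<forall>\<^sub>F n in sequentially. pi * (r n)\<^sup>2 * p n \<ge> (1 + \<epsilon>) * ln (real n) / real n) \<longrightarrow>
        (\<lambda>n. \<P>(\<omega> in grp_space n (p n). connected_graph (grp_graph n (r n) \<omega>))) \<longlonglongrightarrow> 1)"
proof (intro exI[of _ "1/4"] conjI allI impI)
  \<comment> \<open>The radius 1/4 meets every smallness condition: discs stay below radius 1/2, and
    2 r + \<rho> <= 3/4 for the box sizes \<rho> <= 1/4 of the sparse regime.\<close>
  show "(0::real) < 1/4" by simp
next
  fix r p :: "nat \<Rightarrow> real"
  assume rp: "\<forall>n. 0 \<le> r n \<and> r n \<le> 1/4 \<and> 0 \<le> p n \<and> p n \<le> 1"
    and q: "\<forall>\<^sub>F n in sequentially. pi * (r n)\<^sup>2 * p n \<le> (1 - \<epsilon>) * ln (real n) / real n"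
  \<comment> \<open>Shrinking \<epsilon> only relaxes the condition on q and makes the quantitative
    bound applicable.\<close>
  define \<epsilon>' where "\<epsilon>' = min \<epsilon> (1/2)"
  have \<epsilon>': "0 < \<epsilon>'" "\<epsilon>' \<le> 1/2" "\<epsilon>' \<le> \<epsilon>" using assms by (auto simp: \<epsilon>'_def)
  let ?P = "\<lambda>n. \<P>(\<omega> in grp_space n (p n). \<not> connected_graph (grp_graph n (r n) \<omega>) \<and>
                (\<exists>v. isolated_vertex (grp_graph n (r n) \<omega>) v))"
  from isolated_vertices_limit[OF \<epsilon>'(1,2)] obtain g where g: "g \<longlonglongrightarrow> 0" and
    ev: "\<forall>\<^sub>F n in sequentially. \<forall>r p. 0 \<le> r \<longrightarrow> r \<le> 1/4 \<longrightarrow> 0 \<le> p \<longrightarrow> p \<le> 1 \<longrightarrow>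
     pi * r\<^sup>2 * p \<le> (1 - \<epsilon>') * ln (real n) / real n \<longrightarrow>
     1 - isolated_prob n r p \<le> g n"
    by blast
  show "?P \<longlonglongrightarrow> 1"
  proof (rule tendsto_sandwich)
    show "\<forall>\<^sub>F n in sequentially. 1 - g n \<le> ?P n"
      using ev q eventually_ge_at_top[of 1]
    proof eventually_elim
      case (elim n)
      have "(1 - \<epsilon>) * (ln (real n) / real n) \<le> (1 - \<epsilon>') * (ln (real n) / real n)"
        using \<epsilon>'(3) elim(3) by (intro mult_right_mono) auto
      then have "pi * (r n)\<^sup>2 * p n \<le> (1 - \<epsilon>') * ln (real n) / real n" using elim(2) by simp
      then have "1 - ?P n \<le> g n" using elim(1) rp by blast
      then show ?case by simp
    qed
    show "\<forall>\<^sub>F n in sequentially. ?P n \<le> 1"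
      by (intro always_eventually allI prob_space.prob_le_1 prob_space_grp_space)
    show "(\<lambda>n. 1 - g n) \<longlonglongrightarrow> 1" using tendsto_diff[OF tendsto_const g, of 1] by simp
  qed simp
next
  fix r p :: "nat \<Rightarrow> real"
  assume rp: "\<forall>n. 0 \<le> r n \<and> r n \<le> 1/4 \<and> 0 \<le> p n \<and> p n \<le> 1"
    and q: "\<forall>\<^sub>F n in sequentially. pi * (r n)\<^sup>2 * p n \<ge> (1 + \<epsilon>) * ln (real n) / real n"
  define \<epsilon>' where "\<epsilon>' = min \<epsilon> 1"
  have \<epsilon>': "0 < \<epsilon>'" "\<epsilon>' \<le> 1" "\<epsilon>' \<le> \<epsilon>" using assms by (auto simp: \<epsilon>'_def)
  let ?P = "\<lambda>n. \<P>(\<omega> in grp_space n (p n). connected_graph (grp_graph n (r n) \<omega>))"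
  \<comment> \<open>The dense regime determines C; the sparse bound is then taken for that same C,
    so the two cases are exhaustive.\<close>
  from connected_dense[OF \<epsilon>'(1,2)] obtain C g1 where C: "C \<ge> 1" and g1: "g1 \<longlonglongrightarrow> 0" and
    ev1: "\<forall>\<^sub>F n in sequentially. \<forall>r p. 0 \<le> r \<longrightarrow> r \<le> 1/4 \<longrightarrow> 0 \<le> p \<longrightarrow> p \<le> 1 \<longrightarrow>
     (1 + \<epsilon>') * ln (real n) \<le> real n * (pi * r\<^sup>2 * p) \<longrightarrow> C * ln (real n) \<le> real n * (pi * r\<^sup>2) \<longrightarrow>
     disconnect_prob n r p \<le> g1 n"
    by blast
  from connected_sparse[OF \<epsilon>'(1) C] obtain g2 where g2: "g2 \<longlonglongrightarrow> 0" and
    ev2: "\<forall>\<^sub>F n in sequentially. \<forall>r p. 0 \<le> r \<longrightarrow> r \<le> 1/4 \<longrightarrow> 0 \<le> p \<longrightarrow> p \<le> 1 \<longrightarrow>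
     (1 + \<epsilon>') * ln (real n) \<le> real n * (pi * r\<^sup>2 * p) \<longrightarrow> real n * (pi * r\<^sup>2) \<le> C * ln (real n) \<longrightarrow>
     disconnect_prob n r p \<le> g2 n"
    by blast
  show "?P \<longlonglongrightarrow> 1"
  proof (rule tendsto_sandwich)
    \<comment> \<open>The regime may change with n, hence the maximum of both error terms.\<close>
    show "\<forall>\<^sub>F n in sequentially. 1 - max (g1 n) (g2 n) \<le> ?P n"
      using ev1 ev2 q eventually_ge_at_top[of 1]
    proof eventually_elim
      case (elim n)
      interpret G: prob_space "grp_space n (p n)" by (rule prob_space_grp_space)
      have "(1 + \<epsilon>') * (ln (real n) / real n) \<le> (1 + \<epsilon>) * (ln (real n) / real n)"
        using \<epsilon>'(3) elim(4) by (intro mult_right_mono) auto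
      then have "(1 + \<epsilon>') * ln (real n) / real n \<le> pi * (r n)\<^sup>2 * p n" using elim(3) by simp
      then have qn: "(1 + \<epsilon>') * ln (real n) \<le> real n * (pi * (r n)\<^sup>2 * p n)"
        using elim(4) by (simp add: pos_divide_le_eq mult.commute)
      have "disconnect_prob n (r n) (p n) \<le> max (g1 n) (g2 n)"
      proof (cases "C * ln (real n) \<le> real n * (pi * (r n)\<^sup>2)")
        case True
        with elim(1) rp qn have "disconnect_prob n (r n) (p n) \<le> g1 n"
          by blast
        then show ?thesis by simp
      next
        case False
        then have "real n * (pi * (r n)\<^sup>2) \<le> C * ln (real n)" by simp
        with elim(2) rp qn have "disconnect_prob n (r n) (p n) \<le> g2 n"
          by blast
        then show ?thesis by simp
      qed
      moreover have "{\<omega> \<in> space (grp_space n (p n)). connected_graph (grp_graph n (r n) \<omega>)} \<in> G.events"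
      proof -
        have "r n < 1/2" using rp[rule_format, of n] by simp
        from pred_connected[OF this, of n "p n"] show ?thesis by (simp add: pred_def)
      qed
      from G.prob_neg[OF this] have "disconnect_prob n (r n) (p n) = 1 - ?P n"
        by simp
      ultimately show ?case by simp
    qed
    show "\<forall>\<^sub>F n in sequentially. ?P n \<le> 1"
      by (intro always_eventually allI prob_space.prob_le_1 prob_space_grp_space)
    show "(\<lambda>n. 1 - max (g1 n) (g2 n)) \<longlonglongrightarrow> 1"
      using tendsto_diff[OF tendsto_const tendsto_max[OF g1 g2], of 1] by simp
  qed simp
qed

end
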